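(* Let $p$ and $q$ be positive integers with $\frac1p+\frac1q<\frac12$. The tessellation of type $\{p,q\}$ of the hyperbolic plane $\mathbb{H}^2$ is a tessellation of $\mathbb{H}^2$ by fundamental domains of some Fuchsian group if and only if $q$ has a prime divisor less than or equal to $p$.
   Context: For positive integers $p,q$ with $1/p+1/q<1/2$, the tessellation of type $\{p,q\}$ is the tessellation of the hyperbolic plane $\mathbb{H}^2$ by (congruent) regular $p$-gons with exactly $q$ $p$-gons meeting at each vertex; it exists and is unique up to isometry. A Fuchsian group is a discrete group of orientation-preserving isometries of $\mathbb{H}^2$; it may contain elliptic elements (for example, rotations by $\pi$ about midpoints of edges). The tessellation is "a tessellation by fundamental domains of a Fuchsian group $\Gamma$" if its $p$-gons are fundamental domains for $\Gamma$ and are permuted by $\Gamma$; equivalently, $\Gamma$ is a group of orientation-preserving symmetries of the tessellation which acts freely and transitively on the set of $p$-gons of the tessellation (that is, for any two $p$-gons $F,F'$ of the tessellation there is exactly one $\gamma\in\Gamma$ with $\gamma F=F'$). *)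

theory Defs
  imports
    "HOL-Analysis.Analysis"
    "HOL-Algebra.Bij"
    "HOL-Computational_Algebra.Primes"
begin

section \<open>The hyperbolic plane\<close>

text \<open>The Poincare disc model, with its metric of constant curvature $-1$.\<close>

typedef hyperbolic_plane = "ball (0::complex) 1"
  morphisms disc_coord of_disc
  by (rule exI[of _ 0]) simp

definition cosh_hdist :: "complex \<Rightarrow> complex \<Rightarrow> real" where
  "cosh_hdist z w =
     1 + 2 * (cmod (z - w))\<^sup>2 / ((1 - (cmod z)\<^sup>2) * (1 - (cmod w)\<^sup>2))"

lemma cosh_hdist_ge_1:
  assumes "cmod z < 1" "cmod w < 1"
  shows "1 \<le> cosh_hdist z w"
proof -
  have "(cmod z)\<^sup>2 < 1" "(cmod w)\<^sup>2 < 1"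
    using assms by (simp_all add: power_less_one_iff abs_square_less_1)
  then show ?thesis
    by (simp add: cosh_hdist_def)
qed

lemma cosh_hdist_eq_1_iff:
  assumes "cmod z < 1" "cmod w < 1"
  shows "cosh_hdist z w = 1 \<longleftrightarrow> z = w"
proof -
  have "(cmod z)\<^sup>2 < 1" "(cmod w)\<^sup>2 < 1"
    using assms by (simp_all add: power_less_one_iff abs_square_less_1)
  then show ?thesis
    by (simp add: cosh_hdist_def)
qed

lemma cosh_hdist_commute: "cosh_hdist z w = cosh_hdist w z"
  by (simp add: cosh_hdist_def norm_minus_commute mult.commute)

text \<open>Passing to the hyperboloid, \<^term>\<open>cosh_hdist\<close> is minus the Lorentz form.
  The triangle inequality is then the sign of a Gram determinant.\<close>

lemma cosh_hdist_hyperboloid: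
  assumes "cmod z < 1" "cmod w < 1"
  defines "s \<equiv> \<lambda>u. 1 - (cmod u)\<^sup>2"
  shows "cosh_hdist z w =
    ((1 + (cmod z)\<^sup>2) / s z) * ((1 + (cmod w)\<^sup>2) / s w)
    - (2 * Re z / s z) * (2 * Re w / s w) - (2 * Im z / s z) * (2 * Im w / s w)"
proof -
  have "(cmod z)\<^sup>2 < 1" "(cmod w)\<^sup>2 < 1"
    using assms by (simp_all add: power_less_one_iff abs_square_less_1)
  then have nz: "s z \<noteq> 0" "s w \<noteq> 0"
    by (auto simp: s_def)
  have "cosh_hdist z w = 1 + 2 * (cmod (z - w))\<^sup>2 / (s z * s w)"
    by (simp add: cosh_hdist_def s_def)
  also have "\<dots> = (s z * s w + 2 * (cmod (z - w))\<^sup>2) / (s z * s w)"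
    using nz by (simp add: field_simps)
  also have "s z * s w + 2 * (cmod (z - w))\<^sup>2
      = (1 + (cmod z)\<^sup>2) * (1 + (cmod w)\<^sup>2) - (2 * Re z) * (2 * Re w) - (2 * Im z) * (2 * Im w)"
    unfolding s_def cmod_power2 by (simp add: power2_eq_square algebra_simps)
  finally show ?thesis
    by (simp add: diff_divide_distrib)
qed

lemma gram_det_hyperboloid:
  fixes x0 x1 x2 y0 y1 y2 z0 z1 z2 :: real
  assumes "x0\<^sup>2 = 1 + x1\<^sup>2 + x2\<^sup>2" "y0\<^sup>2 = 1 + y1\<^sup>2 + y2\<^sup>2" "z0\<^sup>2 = 1 + z1\<^sup>2 + z2\<^sup>2"
  defines "a \<equiv> x0 * y0 - x1 * y1 - x2 * y2"
    and "b \<equiv> y0 * z0 - y1 * z1 - y2 * z2"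
    and "c \<equiv> x0 * z0 - x1 * z1 - x2 * z2"
  shows "(c - a * b)\<^sup>2 \<le> (a\<^sup>2 - 1) * (b\<^sup>2 - 1)"
proof -
  define d where "d = x0 * (y1 * z2 - y2 * z1) - x1 * (y0 * z2 - y2 * z0) + x2 * (y0 * z1 - y1 * z0)"
  define X where "X = x0\<^sup>2 - x1\<^sup>2 - x2\<^sup>2"
  define Y where "Y = y0\<^sup>2 - y1\<^sup>2 - y2\<^sup>2"
  define Z where "Z = z0\<^sup>2 - z1\<^sup>2 - z2\<^sup>2"
  have "X * Y * Z + 2 * a * b * c - a\<^sup>2 * Z - b\<^sup>2 * X - c\<^sup>2 * Y = d\<^sup>2"
    unfolding a_def b_def c_def d_def X_def Y_def Z_def by algebra
  moreover have "X = 1" "Y = 1" "Z = 1"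
    using assms(1-3) by (auto simp: X_def Y_def Z_def)
  ultimately have "(a\<^sup>2 - 1) * (b\<^sup>2 - 1) - (c - a * b)\<^sup>2 = d\<^sup>2"
    by (simp add: power2_eq_square algebra_simps)
  then show ?thesis
    using zero_le_power2[of d] by linarith
qed

lemma hdist_triangle:
  assumes "cmod x < 1" "cmod y < 1" "cmod z < 1"
  shows "arcosh (cosh_hdist x z) \<le> arcosh (cosh_hdist x y) + arcosh (cosh_hdist y z)"
proof -
  define a b c where "a = cosh_hdist x y" and "b = cosh_hdist y z" and "c = cosh_hdist x z"
  have ge: "a \<ge> 1" "b \<ge> 1" "c \<ge> 1"
    unfolding a_def b_def c_def using assms cosh_hdist_ge_1 by blast+
  have hyp: "((1 + (cmod u)\<^sup>2) / (1 - (cmod u)\<^sup>2))\<^sup>2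
      = 1 + (2 * Re u / (1 - (cmod u)\<^sup>2))\<^sup>2 + (2 * Im u / (1 - (cmod u)\<^sup>2))\<^sup>2"
    if "cmod u < 1" for u
  proof -
    have "(cmod u)\<^sup>2 < 1"
      using that by (simp add: power_less_one_iff abs_square_less_1)
    then have nz: "(1 - (cmod u)\<^sup>2)\<^sup>2 \<noteq> 0"
      by simp
    have "(1 + (cmod u)\<^sup>2)\<^sup>2 = (1 - (cmod u)\<^sup>2)\<^sup>2 + (2 * Re u)\<^sup>2 + (2 * Im u)\<^sup>2"
      unfolding cmod_power2 by (simp add: power2_eq_square algebra_simps)
    then have "(1 + (cmod u)\<^sup>2)\<^sup>2 / (1 - (cmod u)\<^sup>2)\<^sup>2
        = (1 - (cmod u)\<^sup>2)\<^sup>2 / (1 - (cmod u)\<^sup>2)\<^sup>2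
          + (2 * Re u)\<^sup>2 / (1 - (cmod u)\<^sup>2)\<^sup>2 + (2 * Im u)\<^sup>2 / (1 - (cmod u)\<^sup>2)\<^sup>2"
      by (simp only: add_divide_distrib)
    then show ?thesis
      by (simp only: power_divide divide_self[OF nz])
  qed
  have "(c - a * b)\<^sup>2 \<le> (a\<^sup>2 - 1) * (b\<^sup>2 - 1)"
    unfolding a_def b_def c_def cosh_hdist_hyperboloid[OF assms(1,2)]
      cosh_hdist_hyperboloid[OF assms(2,3)] cosh_hdist_hyperboloid[OF assms(1,3)]
    by (rule gram_det_hyperboloid[OF hyp[OF assms(1)] hyp[OF assms(2)] hyp[OF assms(3)]])
  then have "c - a * b \<le> sqrt ((a\<^sup>2 - 1) * (b\<^sup>2 - 1))"
    by (rule real_le_rsqrt)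
  then have "c \<le> cosh (arcosh a + arcosh b)"
    using ge by (simp add: cosh_add sinh_arcosh_real real_sqrt_mult)
  then have "arcosh c \<le> arcosh (cosh (arcosh a + arcosh b))"
    using ge arcosh_real_strict_mono[of c "cosh (arcosh a + arcosh b)"]
    by (cases "c = cosh (arcosh a + arcosh b)") (simp_all del: arcosh_less_iff_real)
  then show ?thesis
    using ge by (simp add: arcosh_cosh_real a_def b_def c_def)
qed

lemma disc_coord_less_1 [simp]: "cmod (disc_coord x) < 1"
  using disc_coord[of x] by simp

instantiation hyperbolic_plane :: metric_space
begin

definition dist_hyperbolic_plane_def:
  "dist x y = arcosh (cosh_hdist (disc_coord x) (disc_coord y))"

definition uniformity_hyperbolic_plane_def:
  "uniformity = (INF e\<in>{0<..}. principal {(x::hyperbolic_plane, y). dist x y < e})"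

definition open_hyperbolic_plane_def:
  "open (U :: hyperbolic_plane set) \<longleftrightarrow> (\<forall>x\<in>U. eventually (\<lambda>(x', y). x' = x \<longrightarrow> y \<in> U) uniformity)"

instance
proof
  fix x y z :: hyperbolic_plane
  show "dist x y = 0 \<longleftrightarrow> x = y"
    by (simp add: dist_hyperbolic_plane_def cosh_hdist_ge_1 cosh_hdist_eq_1_iff disc_coord_inject)
  have "dist x y \<le> dist x z + dist z y"
    unfolding dist_hyperbolic_plane_def by (rule hdist_triangle) simp_all
  then show "dist x y \<le> dist x z + dist y z"
    by (simp add: dist_hyperbolic_plane_def cosh_hdist_commute)
qed (simp_all add: uniformity_hyperbolic_plane_def open_hyperbolic_plane_def)

end

section \<open>Isometries and Fuchsian groups\<close>

definition hyp_isometry :: "(hyperbolic_plane \<Rightarrow> hyperbolic_plane) \<Rightarrow> bool" where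
  "hyp_isometry f \<longleftrightarrow> surj f \<and> (\<forall>x y. dist (f x) (f y) = dist x y)"

text \<open>\<^term>\<open>Im (cnj (D 1) * D \<i>)\<close> is the determinant of the real-linear map \<^term>\<open>D\<close>
  on \<^typ>\<open>complex\<close>, i.e.\ the Jacobian of \<^term>\<open>f\<close> in the disc coordinate.\<close>

definition orientation_preserving :: "(hyperbolic_plane \<Rightarrow> hyperbolic_plane) \<Rightarrow> bool" where
  "orientation_preserving f \<longleftrightarrow>
     (\<forall>z\<in>ball 0 1. \<exists>D. ((\<lambda>w. disc_coord (f (of_disc w))) has_derivative D) (at z)
        \<and> 0 < Im (cnj (D 1) * D \<i>))"

text \<open>Discreteness refers to the library topology of pointwise convergence on functions,
  which on isometries agrees with the compact-open topology.\<close>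

definition fuchsian_group :: "(hyperbolic_plane \<Rightarrow> hyperbolic_plane) set \<Rightarrow> bool" where
  "fuchsian_group \<Gamma> \<longleftrightarrow>
     subgroup \<Gamma> (BijGroup UNIV) \<and>
     (\<forall>\<gamma>\<in>\<Gamma>. hyp_isometry \<gamma> \<and> orientation_preserving \<gamma>) \<and>
     discrete \<Gamma>"

section \<open>Regular polygons\<close>

definition hyp_segment :: "hyperbolic_plane \<Rightarrow> hyperbolic_plane \<Rightarrow> hyperbolic_plane set" where
  "hyp_segment x y = {z. dist x z + dist z y = dist x y}"

definition hyp_convex :: "hyperbolic_plane set \<Rightarrow> bool" where
  "hyp_convex S \<longleftrightarrow> (\<forall>x\<in>S. \<forall>y\<in>S. hyp_segment x y \<subseteq> S)"

text \<open>The vertices of a regular \<open>p\<close>-gon, in cyclic order: \<open>p\<close> equally spaced points on a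
  hyperbolic circle. A circle about the origin of the disc is also a Euclidean one, and the
  isometry moves the centre to an arbitrary point. The enumeration is \<open>p\<close>-periodic.\<close>

definition regular_vertices :: "nat \<Rightarrow> (nat \<Rightarrow> hyperbolic_plane) \<Rightarrow> bool" where
  "regular_vertices p v \<longleftrightarrow>
     (\<exists>g r. hyp_isometry g \<and> 0 < r \<and> r < 1 \<and>
        (\<forall>k. v k = g (of_disc (of_real r * cis (2 * pi * real k / real p)))))"

definition regular_polygon_with ::
    "nat \<Rightarrow> (nat \<Rightarrow> hyperbolic_plane) \<Rightarrow> hyperbolic_plane set \<Rightarrow> bool" where
  "regular_polygon_with p v F \<longleftrightarrow> regular_vertices p v \<and> F = hyp_convex hull (v ` {..<p})"

definition regular_polygon :: "nat \<Rightarrow> hyperbolic_plane set \<Rightarrow> bool" where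
  "regular_polygon p F \<longleftrightarrow> (\<exists>v. regular_polygon_with p v F)"

definition is_vertex_of :: "nat \<Rightarrow> hyperbolic_plane \<Rightarrow> hyperbolic_plane set \<Rightarrow> bool" where
  "is_vertex_of p x F \<longleftrightarrow> (\<exists>v k. regular_polygon_with p v F \<and> k < p \<and> x = v k)"

definition is_side_of :: "nat \<Rightarrow> hyperbolic_plane set \<Rightarrow> hyperbolic_plane set \<Rightarrow> bool" where
  "is_side_of p s F \<longleftrightarrow>
     (\<exists>v k. regular_polygon_with p v F \<and> k < p \<and> s = hyp_segment (v k) (v (Suc k)))"

section \<open>Tessellations\<close>

text \<open>A tessellation is given by its set of tiles; it is edge-to-edge, as implied by speaking of
  the polygons meeting at a vertex. Since \<open>0 < q\<close> in use, the cardinality condition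
  includes finiteness.\<close>

definition tessellation_of_type :: "nat \<Rightarrow> nat \<Rightarrow> hyperbolic_plane set set \<Rightarrow> bool" where
  "tessellation_of_type p q T \<longleftrightarrow>
     (\<forall>F\<in>T. regular_polygon p F) \<and>
     (\<forall>F\<in>T. \<forall>F'\<in>T. \<exists>g. hyp_isometry g \<and> g ` F = F') \<and>
     \<Union>T = UNIV \<and>
     locally_finite_in euclidean T \<and>
     (\<forall>F\<in>T. \<forall>F'\<in>T. F \<noteq> F' \<longrightarrow> interior F \<inter> interior F' = {}) \<and>
     (\<forall>F\<in>T. \<forall>F'\<in>T. F \<noteq> F' \<longrightarrow>
        F \<inter> F' = {} \<or>
        (\<exists>x. F \<inter> F' = {x} \<and> is_vertex_of p x F \<and> is_vertex_of p x F') \<or>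
        (is_side_of p (F \<inter> F') F \<and> is_side_of p (F \<inter> F') F')) \<and>
     (\<forall>F\<in>T. \<forall>x. is_vertex_of p x F \<longrightarrow> card {F'\<in>T. x \<in> F'} = q)"

text \<open>The tiles are permuted by \<open>\<Gamma>\<close> and are fundamental domains for it, expressed as a
  free and transitive action on the set of tiles: existence gives transitivity, uniqueness
  gives freeness.\<close>

definition tessellation_by_fundamental_domains ::
    "(hyperbolic_plane \<Rightarrow> hyperbolic_plane) set \<Rightarrow> hyperbolic_plane set set \<Rightarrow> bool" where
  "tessellation_by_fundamental_domains \<Gamma> T \<longleftrightarrow>
     (\<forall>\<gamma>\<in>\<Gamma>. \<forall>F\<in>T. \<gamma> ` F \<in> T) \<and>
     (\<forall>F\<in>T. \<forall>F'\<in>T. \<exists>!\<gamma>. \<gamma> \<in> \<Gamma> \<and> \<gamma> ` F = F')"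

end

theory Submission
  imports Defs
begin

text \<open>Let \<open>\<Gamma>\<close> act simply transitively on the tiles. Labelling the sides of a base tile by \<open>\<int>/p\<close> and
  transporting the labels with \<open>\<Gamma>\<close> labels every dart (tile with a distinguished side). Passing to the
  neighbour across a side induces an involution \<open>\<sigma>\<close> of the labels, passing to the next side of the
  same tile the \<open>p\<close>-cycle \<open>\<rho>\<close>, and \<open>\<rho>\<sigma>\<close> describes a rotation step about a vertex; hence \<open>(\<rho>\<sigma>)\<^sup>q = 1\<close>.
  The cycle lengths of \<open>\<rho>\<sigma>\<close> divide \<open>q\<close> and are at most \<open>p\<close>, so if no prime \<open>r \<le> p\<close> divides \<open>q\<close> then
  \<open>\<rho>\<sigma> = 1\<close>, and \<open>\<sigma>\<^sup>2 = 1\<close> forces \<open>p \<le> 2\<close>.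

  Conversely, for \<open>2 \<le> r \<le> p\<close> there are a \<open>p\<close>-cycle \<open>\<rho>\<close> and an involution \<open>\<sigma>\<close> with \<open>(\<rho>\<sigma>)\<^sup>r = 1\<close>.
  If \<open>r\<close> divides \<open>q\<close>, then labels of one tile extend consistently to the tiles around a vertex, and by
  simple connectivity of the plane to all darts. The orientation-preserving symmetries of the
  tessellation act simply transitively on the darts, so those that respect the labels act simply
  transitively on the tiles.\<close>

text \<open>The labels stand for the sides of one polygon, so the pair (\<rho>, \<sigma>) is the
  combinatorial part of a Poincare side pairing. Fixed points of \<sigma> correspond to half turns
  about midpoints of sides, cycles of \<rho>\<sigma> shorter than q to rotations about vertices.
  This freedom is why a single r \<le> p dividing q suffices: cycles of lengths r and 1 are glued in
  a tree-like way at fixed points of \<sigma>, and each gluing merges two cycles of \<rho> into one.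
  The Poincare polygon theorem is not invoked: the tessellation is given, the group is sought among
  its symmetries, and only the labels have to be constructed. The obstacle is that the tessellation
  is given merely as a family of sets. That each side has exactly one neighbour across it, that the
  tiles at a vertex form one cycle of length q, and that every tile is reached from every other by
  crossing sides must be derived. All three rest on unions of tiles being closed, by local
  finiteness; the last two also use connectedness, of a punctured disc and of the plane.\<close>

section \<open>Moebius transformations of the disc\<close>

text \<open>The action of the matrix with rows \<open>(a, b)\<close> and \<open>(cnj b, cnj a)\<close>, which lies in \<open>SU(1,1)\<close> up to
  a scalar if \<open>|b| < |a|\<close>.\<close>

definition su_act :: "complex \<Rightarrow> complex \<Rightarrow> complex \<Rightarrow> complex" where
  "su_act a b z = (a * z + b) / (cnj b * z + cnj a)"

lemma su_act_denominator:
  assumes "cmod b < cmod a" "cmod z < 1"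
  shows "cnj b * z + cnj a \<noteq> 0"
proof
  assume "cnj b * z + cnj a = 0"
  then have "cnj b * z = - cnj a" by (simp add: eq_neg_iff_add_eq_0)
  then have "cmod (cnj b * z) = cmod (cnj a)" by (metis norm_minus_cancel)
  then have "cmod b * cmod z = cmod a" by (simp add: norm_mult)
  moreover have "cmod b * cmod z \<le> cmod b * 1"
    using assms by (intro mult_left_mono) auto
  ultimately show False using assms by simp
qed

text \<open>The matrix multiplies the Hermitian form of signature (1,1) by its determinant; here the
  form is evaluated at the vector (z, 1).\<close>

lemma su_act_norm_identity:
  "(cmod (cnj b * z + cnj a))\<^sup>2 - (cmod (a * z + b))\<^sup>2
     = ((cmod a)\<^sup>2 - (cmod b)\<^sup>2) * (1 - (cmod z)\<^sup>2)"
  unfolding cmod_power2 by (simp add: power2_eq_square algebra_simps)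

lemma su_act_norm:
  assumes "cmod b < cmod a" "cmod z < 1"
  shows "1 - (cmod (su_act a b z))\<^sup>2
     = ((cmod a)\<^sup>2 - (cmod b)\<^sup>2) * (1 - (cmod z)\<^sup>2) / (cmod (cnj b * z + cnj a))\<^sup>2"
proof -
  have "(cmod (cnj b * z + cnj a))\<^sup>2 \<noteq> 0"
    using su_act_denominator[OF assms] by simp
  then show ?thesis
    unfolding su_act_norm_identity[symmetric] su_act_def norm_divide power_divide
    by (simp add: diff_divide_distrib)
qed

lemma su_act_disc:
  assumes "cmod b < cmod a" "cmod z < 1"
  shows "cmod (su_act a b z) < 1"
proof -
  have "(cmod b)\<^sup>2 < (cmod a)\<^sup>2" "(cmod z)\<^sup>2 < 1"
    using assms by (auto simp: power_strict_mono abs_square_less_1)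
  then have "0 < 1 - (cmod (su_act a b z))\<^sup>2"
    unfolding su_act_norm[OF assms] using su_act_denominator[OF assms] by simp
  then show ?thesis by (simp add: abs_square_less_1)
qed

lemma su_act_diff:
  assumes "cmod b < cmod a" "cmod z < 1" "cmod w < 1"
  shows "su_act a b z - su_act a b w
     = (a * cnj a - b * cnj b) * (z - w) / ((cnj b * z + cnj a) * (cnj b * w + cnj a))"
  unfolding su_act_def using su_act_denominator[OF assms(1,2)] su_act_denominator[OF assms(1,3)]
  by (simp add: diff_frac_eq) (simp add: algebra_simps)

text \<open>The Euclidean distance and the two factors 1 - |z|^2, 1 - |w|^2 all scale by the
  determinant \<open>k\<close> over moduli of the denominators, and these factors cancel in the
  quotient.\<close>

lemma cosh_hdist_su_act:
  assumes "cmod b < cmod a" "cmod z < 1" "cmod w < 1"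
  shows "cosh_hdist (su_act a b z) (su_act a b w) = cosh_hdist z w"
proof -
  define k where "k = (cmod a)\<^sup>2 - (cmod b)\<^sup>2"
  define P Q where "P = (cmod (cnj b * z + cnj a))\<^sup>2" and "Q = (cmod (cnj b * w + cnj a))\<^sup>2"
  have nz: "P \<noteq> 0" "Q \<noteq> 0"
    unfolding P_def Q_def using su_act_denominator assms by auto
  have "(cmod b)\<^sup>2 < (cmod a)\<^sup>2"
    using assms(1) by (simp add: power_strict_mono)
  then have k: "k \<noteq> 0" unfolding k_def by linarith
  have "a * cnj a - b * cnj b = of_real k"
    unfolding k_def of_real_diff complex_norm_square ..
  then have "(cmod (su_act a b z - su_act a b w))\<^sup>2 = k\<^sup>2 * (cmod (z - w))\<^sup>2 / (P * Q)"
    unfolding su_act_diff[OF assms] P_def Q_def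
    by (simp add: norm_divide norm_mult power_divide power_mult_distrib)
  then have "cosh_hdist (su_act a b z) (su_act a b w) =
     1 + 2 * (k\<^sup>2 * (cmod (z - w))\<^sup>2 / (P * Q)) / ((k * (1 - (cmod z)\<^sup>2) / P) * (k * (1 - (cmod w)\<^sup>2) / Q))"
    unfolding cosh_hdist_def su_act_norm[OF assms(1,2)] su_act_norm[OF assms(1,3)]
    by (simp add: k_def P_def Q_def)
  also have "\<dots> = cosh_hdist z w"
  proof -
    have "2 * (k\<^sup>2 * m / (P * Q)) / ((k * S / P) * (k * R / Q)) = 2 * m / (S * R)" for m S R :: real
      using nz k by (cases "S * R = 0") (auto simp: field_simps power2_eq_square)
    then show ?thesis unfolding cosh_hdist_def by simp
  qed
  finally show ?thesis .
qed

text \<open>The new coefficients are the first row of the product of the two matrices.\<close>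

lemma su_act_compose:
  assumes "cmod b < cmod a" "cmod d < cmod c" "cmod z < 1"
  shows "su_act a b (su_act c d z) = su_act (a * c + b * cnj d) (a * d + b * cnj c) z"
proof -
  have n: "cnj d * z + cnj c \<noteq> 0"
    using su_act_denominator assms by blast
  have "su_act a b (su_act c d z) =
     ((a * (c * z + d) + b * (cnj d * z + cnj c)) / (cnj d * z + cnj c)) /
     ((cnj b * (c * z + d) + cnj a * (cnj d * z + cnj c)) / (cnj d * z + cnj c))"
    unfolding su_act_def using n by (intro arg_cong2[where f = "(/)"]) (simp_all add: field_simps)
  also have "\<dots> = (a * (c * z + d) + b * (cnj d * z + cnj c)) /
     (cnj b * (c * z + d) + cnj a * (cnj d * z + cnj c))"
    using n by simp
  also have "\<dots> = su_act (a * c + b * cnj d) (a * d + b * cnj c) z"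
    unfolding su_act_def by (simp add: algebra_simps)
  finally show ?thesis .
qed

text \<open>The orientation-preserving isometries in explicit form. The coefficients are not
  normalised, so products and adjugates of matrices can be used without rescaling.\<close>

definition direct :: "(hyperbolic_plane \<Rightarrow> hyperbolic_plane) \<Rightarrow> bool" where
  "direct f \<longleftrightarrow> (\<exists>a b. cmod b < cmod a \<and> (\<forall>x. disc_coord (f x) = su_act a b (disc_coord x)))"

lemma disc_coord_of_disc [simp]: "cmod z < 1 \<Longrightarrow> disc_coord (of_disc z) = z"
  by (simp add: of_disc_inverse)

lemma of_disc_disc_coord [simp]: "of_disc (disc_coord x) = x"
  by (simp add: disc_coord_inverse)

lemma dist_eq_iff_cosh_hdist:
  "dist x y = dist z w \<longleftrightarrow>
     cosh_hdist (disc_coord x) (disc_coord y) = cosh_hdist (disc_coord z) (disc_coord w)"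
  unfolding dist_hyperbolic_plane_def
  by (metis cosh_arcosh_real cosh_hdist_ge_1 disc_coord_less_1)

lemma direct_dist: "direct f \<Longrightarrow> dist (f x) (f y) = dist x y"
  unfolding direct_def dist_eq_iff_cosh_hdist by (auto simp: cosh_hdist_su_act)

lemma direct_id: "direct id"
  unfolding direct_def by (rule exI[of _ 1], rule exI[of _ 0]) (simp add: su_act_def)

lemma direct_comp:
  assumes "direct f" "direct g"
  shows "direct (f \<circ> g)"
proof -
  obtain a b where ab: "cmod b < cmod a" "\<And>x. disc_coord (f x) = su_act a b (disc_coord x)"
    using assms(1) unfolding direct_def by blast
  obtain c d where cd: "cmod d < cmod c" "\<And>x. disc_coord (g x) = su_act c d (disc_coord x)"
    using assms(2) unfolding direct_def by blast
  \<comment> \<open>Multiplicativity of the determinant; its positivity is the condition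
    \<open>cmod b < cmod a\<close>.\<close>
  have "(cmod (a * c + b * cnj d))\<^sup>2 - (cmod (a * d + b * cnj c))\<^sup>2
      = ((cmod a)\<^sup>2 - (cmod b)\<^sup>2) * ((cmod c)\<^sup>2 - (cmod d)\<^sup>2)"
    unfolding cmod_power2 by (simp add: power2_eq_square algebra_simps)
  also have "\<dots> > 0"
    using ab(1) cd(1) by (simp add: power_strict_mono)
  finally have "cmod (a * d + b * cnj c) < cmod (a * c + b * cnj d)"
    by (simp add: power2_less_imp_less)
  then show ?thesis
    unfolding direct_def using ab cd by (metis comp_apply disc_coord_less_1 su_act_compose)
qed

lemma direct_inverse_ex:
  assumes "direct f"
  shows "\<exists>g. direct g \<and> g \<circ> f = id \<and> f \<circ> g = id"
proof -
  obtain a b where ab: "cmod b < cmod a" "\<And>x. disc_coord (f x) = su_act a b (disc_coord x)"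
    using assms(1) unfolding direct_def by blast
  \<comment> \<open>The coefficients come from the adjugate matrix. Its product with the original
    one is the determinant times the identity, which acts trivially by \<open>scal\<close>.\<close>
  define g where "g x = of_disc (su_act (cnj a) (- b) (disc_coord x))" for x
  have g: "disc_coord (g x) = su_act (cnj a) (- b) (disc_coord x)" for x
    unfolding g_def using ab su_act_disc[of "- b" "cnj a"] by simp
  have k: "a * cnj a - b * cnj b \<noteq> 0"
    using ab by (metis complex_norm_square norm_ge_zero of_real_eq_iff power2_eq_iff_nonneg
        right_minus_eq less_irrefl)
  have scal: "su_act t 0 z = z" if "t = a * cnj a - b * cnj b" for t z
    unfolding su_act_def using k that by (simp add: mult.commute)
  have "g (f x) = x" for x
  proof -
    have "disc_coord (g (f x)) = su_act (a * cnj a - b * cnj b) 0 (disc_coord x)"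
      unfolding g ab(2) using ab(1) by (subst su_act_compose) (auto simp: algebra_simps)
    then show ?thesis using scal by (simp add: disc_coord_inject)
  qed
  moreover have "f (g x) = x" for x
  proof -
    have "disc_coord (f (g x)) = su_act (a * cnj a - b * cnj b) 0 (disc_coord x)"
      unfolding g ab(2) using ab(1) by (subst su_act_compose) (auto simp: algebra_simps)
    then show ?thesis using scal by (simp add: disc_coord_inject)
  qed
  moreover have "direct g"
    unfolding direct_def using ab(1) g by (intro exI[of _ "cnj a"] exI[of _ "- b"]) auto
  ultimately show ?thesis by (auto simp: fun_eq_iff)
qed

lemma direct_bij: "direct f \<Longrightarrow> bij f"
  using direct_inverse_ex o_bij by blast

lemma direct_inv: "direct f \<Longrightarrow> direct (inv_into UNIV f)"
  using direct_inverse_ex[of f] by (metis inv_unique_comp)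

lemma direct_hyp_isometry: "direct f \<Longrightarrow> hyp_isometry f"
  unfolding hyp_isometry_def using direct_bij direct_dist bij_is_surj by blast

lemma direct_to_origin: "\<exists>f. direct f \<and> f x = of_disc 0"
proof -
  define z where "z = disc_coord x"
  have z: "cmod z < 1" by (simp add: z_def)
  define f where "f y = of_disc (su_act 1 (- z) (disc_coord y))" for y
  have "disc_coord (f y) = su_act 1 (- z) (disc_coord y)" for y
    unfolding f_def using su_act_disc[of "- z" 1] z by simp
  then have "direct f"
    unfolding direct_def using z by (intro exI[of _ 1] exI[of _ "- z"]) simp
  moreover have "f x = of_disc 0"
    by (simp add: f_def su_act_def z_def)
  ultimately show ?thesis by blast
qed

lemma direct_rotation:
  assumes "cmod c = 1"
  shows "\<exists>f. direct f \<and> (\<forall>x. disc_coord (f x) = c * disc_coord x)"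
proof -
  \<comment> \<open>The diagonal matrix with entries u and \<open>cnj u\<close> acts as
    multiplication by u / \<open>cnj u\<close>, which is u^2 for a unit u; hence the square root of
    c.\<close>
  obtain u where u: "u\<^sup>2 = c" by (metis power2_csqrt)
  then have n: "cmod u = 1"
    using assms by (metis norm_power norm_ge_zero one_power2 power2_eq_iff_nonneg zero_le_one)
  have "su_act u 0 z = c * z" for z
  proof -
    have "u * cnj u = 1" using n by (simp add: complex_norm_square[symmetric])
    then have "cnj u = inverse u"
      by (metis inverse_unique mult.commute)
    then show ?thesis
      using u by (auto simp: su_act_def power2_eq_square divide_inverse)
  qed
  moreover have "cmod (c * disc_coord x) < 1" for x
    using assms by (simp add: norm_mult)
  ultimately show ?thesis
    unfolding direct_def using n
    by (intro exI[of _ "\<lambda>x. of_disc (c * disc_coord x)"] conjI exI[of _ u] exI[of _ 0]) auto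
qed

lemma cosh_hdist_0: "cosh_hdist 0 z = cosh_hdist 0 w \<longleftrightarrow> cmod z = cmod w" if "cmod z < 1" "cmod w < 1"
proof -
  have "(cmod z)\<^sup>2 < 1" "(cmod w)\<^sup>2 < 1" using that by (auto simp: abs_square_less_1)
  then have "cosh_hdist 0 z = cosh_hdist 0 w \<longleftrightarrow> (cmod z)\<^sup>2 = (cmod w)\<^sup>2"
    by (auto simp: cosh_hdist_def frac_eq_eq algebra_simps)
  then show ?thesis by (simp add: power2_eq_iff_nonneg)
qed

lemma direct_fixing_origin:
  assumes "direct f" "f (of_disc 0) = of_disc 0"
  shows "\<exists>c. cmod c = 1 \<and> (\<forall>x. disc_coord (f x) = c * disc_coord x)"
proof -
  obtain a b where ab: "cmod b < cmod a" "\<And>x. disc_coord (f x) = su_act a b (disc_coord x)"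
    using assms(1) unfolding direct_def by blast
  have "su_act a b 0 = 0"
    using ab(2)[of "of_disc 0"] assms(2) by simp
  then have "b = 0"
    unfolding su_act_def using ab(1) by auto
  then have "\<forall>x. disc_coord (f x) = (a / cnj a) * disc_coord x"
    using ab by (simp add: su_act_def)
  moreover have "cmod (a / cnj a) = 1"
    using ab(1) by (auto simp: norm_divide)
  ultimately show ?thesis by blast
qed

text \<open>Conjugation moves x to the origin, where the map becomes a rotation, and a rotation
  fixing a nonzero point is trivial. This rigidity makes a symmetry determined by its effect on one
  dart.\<close>

lemma direct_two_fixed_points:
  assumes "direct f" "f x = x" "f y = y" "x \<noteq> y"
  shows "f = id"
proof -
  obtain t where t: "direct t" "t x = of_disc 0" using direct_to_origin by blast
  obtain s where s: "direct s" "s \<circ> t = id" "t \<circ> s = id"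
    using direct_inverse_ex[OF t(1)] by blast
  define h where "h = t \<circ> f \<circ> s"
  have sx: "s (of_disc 0) = x" using s(2) t(2) by (metis comp_apply id_apply)
  have "direct h" unfolding h_def using t s assms direct_comp by blast
  moreover have "h (of_disc 0) = of_disc 0" by (simp add: h_def sx assms t)
  ultimately obtain c where c: "cmod c = 1" "\<And>x. disc_coord (h x) = c * disc_coord x"
    using direct_fixing_origin by blast
  have "h (t y) = t y" using s(2) assms(3) by (simp add: h_def) (metis comp_apply id_apply)
  moreover have "t y \<noteq> of_disc 0" using t assms(4) by (metis direct_bij bij_pointE)
  then have "disc_coord (t y) \<noteq> 0" by (metis of_disc_disc_coord)
  ultimately have "c = 1" using c(2)[of "t y"] by auto
  then have "h = id" using c(2) by (auto simp: fun_eq_iff disc_coord_inject)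
  have "f z = z" for z
  proof -
    have "t (f (s (t z))) = t z" using \<open>h = id\<close> by (metis h_def comp_apply id_apply)
    then have "t (f z) = t z" using s(2) by (metis comp_apply id_apply)
    then show ?thesis using s(2) by (metis comp_apply id_apply)
  qed
  then show ?thesis by (auto simp: fun_eq_iff)
qed

section \<open>Classification of isometries up to a reflection\<close>

definition hconj :: "hyperbolic_plane \<Rightarrow> hyperbolic_plane" where
  "hconj x = of_disc (cnj (disc_coord x))"

lemma disc_coord_hconj [simp]: "disc_coord (hconj x) = cnj (disc_coord x)"
  by (simp add: hconj_def)

lemma hconj_hconj [simp]: "hconj (hconj x) = x"
  by (simp add: hconj_def)

text \<open>Distances to the origin give Euclidean norms, so \<open>cosh_hdist\<close> then gives
  Euclidean distances and hence inner products. A map preserving inner products is known from the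
  images of 1/2 and i/2, the two axis points used as a basis inside the disc.\<close>

lemma isometry_fixing_origin:
  assumes "\<And>x y. dist (f x) (f y) = dist x y" "f (of_disc 0) = of_disc 0"
  shows "\<exists>c. cmod c = 1 \<and> ((\<forall>x. disc_coord (f x) = c * disc_coord x) \<or>
     (\<forall>x. disc_coord (f x) = c * cnj (disc_coord x)))"
proof -
  define F where "F z = disc_coord (f (of_disc z))" for z
  have F1: "cmod (F z) < 1" for z by (simp add: F_def)
  have F0: "F 0 = 0" using assms(2) by (simp add: F_def)
  have ch: "cosh_hdist (F z) (F w) = cosh_hdist z w" if "cmod z < 1" "cmod w < 1" for z w
    using assms(1)[of "of_disc z" "of_disc w"] that by (simp add: dist_eq_iff_cosh_hdist F_def)
  have n: "cmod (F z) = cmod z" if "cmod z < 1" for z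
    using ch[of 0 z] cosh_hdist_0[OF F1 that] that F0 by simp
  have d: "cmod (F z - F w) = cmod (z - w)" if "cmod z < 1" "cmod w < 1" for z w
  proof -
    have "(cmod z)\<^sup>2 < 1" "(cmod w)\<^sup>2 < 1" using that by (auto simp: abs_square_less_1)
    then have "(cmod (F z - F w))\<^sup>2 = (cmod (z - w))\<^sup>2"
      using ch[OF that] that by (simp add: cosh_hdist_def n)
    then show ?thesis by (simp add: power2_eq_iff_nonneg)
  qed
  have ip: "Re (F z * cnj (F w)) = Re (z * cnj w)" if "cmod z < 1" "cmod w < 1" for z w
  proof -
    have e: "2 * Re (u * cnj v) = (cmod u)\<^sup>2 + (cmod v)\<^sup>2 - (cmod (u - v))\<^sup>2" for u v
      unfolding cmod_power2 by (simp add: power2_eq_square algebra_simps)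
    show ?thesis using e[of "F z" "F w"] e[of z w] d[OF that] n that by simp
  qed
  \<comment> \<open>The rotation by c takes 1/2 to \<open>F (1/2)\<close>; below, \<open>G\<close>
    is \<open>F\<close> with this rotation undone, and the sign \<open>s\<close> decides between
    identity and conjugation.\<close>
  define c where "c = 2 * F (1/2)"
  have c1: "cmod c = 1" using n[of "1/2"] by (simp add: c_def norm_mult)
  then have cc: "c * cnj c = 1" by (simp add: complex_norm_square[symmetric])
  define G where "G z = cnj c * F z" for z
  have FG: "F z = c * G z" for z using cc by (simp add: G_def mult.assoc[symmetric])
  have GG: "Re (G z * cnj (G w)) = Re (z * cnj w)" if "cmod z < 1" "cmod w < 1" for z w
  proof -
    have "F z * cnj (F w) = (c * cnj c) * (G z * cnj (G w))" by (simp add: FG)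
    then show ?thesis using ip[OF that] cc by simp
  qed
  have Ghalf: "G (1/2) = 1/2"
    using cc by (simp add: G_def c_def mult.commute)
  have ReG: "Re (G z) = Re z" if "cmod z < 1" for z
    using GG[of z "1/2"] that Ghalf by simp
  define s where "s = 2 * Im (G (\<i>/2))"
  have ReGi: "Re (G (\<i>/2)) = 0" using ReG[of "\<i>/2"] by (simp add: norm_divide)
  have "Re (G (\<i>/2) * cnj (G (\<i>/2))) = 1/4"
    using GG[of "\<i>/2" "\<i>/2"] by (simp add: norm_divide)
  then have "s * s = 1" using ReGi by (simp add: s_def)
  then have s: "s = 1 \<or> s = -1" by (simp add: square_eq_1_iff)
  have ImG: "Im z = s * Im (G z)" if "cmod z < 1" for z
    using GG[of z "\<i>/2"] that ReGi by (simp add: norm_divide s_def mult_ac)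
  have "(\<forall>z. cmod z < 1 \<longrightarrow> F z = c * z) \<or> (\<forall>z. cmod z < 1 \<longrightarrow> F z = c * cnj z)"
    using s
  proof
    assume "s = 1"
    then show ?thesis using ReG ImG by (auto simp: FG complex_eq_iff)
  next
    assume "s = -1"
    then have "G z = cnj z" if "cmod z < 1" for z
      using ReG[OF that] ImG[OF that] by (simp add: complex_eq_iff)
    then show ?thesis by (auto simp: FG)
  qed
  moreover have "disc_coord (f x) = F (disc_coord x)" for x by (simp add: F_def)
  ultimately show ?thesis using c1 by auto
qed

lemma isometry_cases:
  assumes "hyp_isometry f"
  shows "direct f \<or> direct (f \<circ> hconj)"
proof -
  obtain t where t: "direct t" "t (f (of_disc 0)) = of_disc 0" using direct_to_origin by blast
  obtain s where s: "direct s" "s \<circ> t = id" using direct_inverse_ex[OF t(1)] by blast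
  have "\<exists>c. cmod c = 1 \<and> ((\<forall>x. disc_coord ((t \<circ> f) x) = c * disc_coord x) \<or>
     (\<forall>x. disc_coord ((t \<circ> f) x) = c * cnj (disc_coord x)))"
    using assms t by (intro isometry_fixing_origin) (auto simp: hyp_isometry_def direct_dist)
  then obtain c where c: "cmod c = 1" "(\<forall>x. disc_coord ((t \<circ> f) x) = c * disc_coord x) \<or>
     (\<forall>x. disc_coord ((t \<circ> f) x) = c * cnj (disc_coord x))" by blast
  obtain r where r: "direct r" "\<And>x. disc_coord (r x) = c * disc_coord x"
    using direct_rotation[OF c(1)] by blast
  have st: "s (t x) = x" for x using s(2) by (metis comp_apply id_apply)
  show ?thesis
    using c(2)
  proof
    assume "\<forall>x. disc_coord ((t \<circ> f) x) = c * disc_coord x"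
    then have "t (f x) = r x" for x by (simp add: disc_coord_inject[symmetric] r)
    then have "f = s \<circ> r" by (metis comp_apply ext st)
    then show ?thesis using direct_comp s r by blast
  next
    assume "\<forall>x. disc_coord ((t \<circ> f) x) = c * cnj (disc_coord x)"
    then have "t ((f \<circ> hconj) x) = r x" for x by (simp add: disc_coord_inject[symmetric] r)
    then have "f \<circ> hconj = s \<circ> r" by (metis comp_apply ext st)
    then show ?thesis using direct_comp s r by metis
  qed
qed

section \<open>Orientation and derivatives\<close>

lemma su_act_has_field_derivative:
  assumes "cmod b < cmod a" "cmod z < 1"
  shows "(su_act a b has_field_derivative
     (a * cnj a - b * cnj b) / (cnj b * z + cnj a)\<^sup>2) (at z)"
  unfolding su_act_def[abs_def] using su_act_denominator[OF assms]
  by (auto intro!: derivative_eq_intros simp: power2_eq_square) (simp add: algebra_simps)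

lemma direct_derivative:
  assumes "cmod b < cmod a" "\<And>x. disc_coord (f x) = su_act a b (disc_coord x)" "cmod z < 1"
  shows "((\<lambda>w. disc_coord (f (of_disc w))) has_derivative
     (*) ((a * cnj a - b * cnj b) / (cnj b * z + cnj a)\<^sup>2)) (at z)"
proof -
  have "(su_act a b has_derivative
     (*) ((a * cnj a - b * cnj b) / (cnj b * z + cnj a)\<^sup>2)) (at z)"
    using su_act_has_field_derivative[OF assms(1,3)] by (simp add: has_field_derivative_def)
  moreover have "z \<in> ball 0 1" using assms(3) by simp
  ultimately show ?thesis
    by (rule has_derivative_transform_within_open[OF _ open_ball])
      (use assms(2) in simp)
qed

lemma direct_orientation_preserving:
  assumes "direct f"
  shows "orientation_preserving f"
  unfolding orientation_preserving_def
proof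
  fix z :: complex assume z: "z \<in> ball 0 1"
  obtain a b where ab: "cmod b < cmod a" "\<And>x. disc_coord (f x) = su_act a b (disc_coord x)"
    using assms(1) unfolding direct_def by blast
  define D where "D = (a * cnj a - b * cnj b) / (cnj b * z + cnj a)\<^sup>2"
  have "a * cnj a - b * cnj b \<noteq> 0"
    using ab by (metis complex_norm_square norm_ge_zero of_real_eq_iff power2_eq_iff_nonneg
        right_minus_eq less_irrefl)
  then have "D \<noteq> 0" using su_act_denominator[OF ab(1)] z by (simp add: D_def)
  then have "0 < (cmod D)\<^sup>2" by simp
  then have "0 < Im (cnj (D * 1) * (D * \<i>))"
    unfolding cmod_power2 by (simp add: power2_eq_square algebra_simps)
  then show "\<exists>D. ((\<lambda>w. disc_coord (f (of_disc w))) has_derivative D) (at z) \<and>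
      0 < Im (cnj (D 1) * D \<i>)"
    using direct_derivative[OF ab, of z, folded D_def] z by (intro exI[of _ "(*) D"] conjI) auto
qed

text \<open>Otherwise f is a Moebius map after a reflection, so its derivative at the origin is
  antilinear, w mapping to e * \<open>cnj w\<close>, with the nonpositive Jacobian -|e|^2.\<close>

lemma orientation_preserving_isometry_direct:
  assumes "hyp_isometry f" "orientation_preserving f"
  shows "direct f"
proof (rule ccontr)
  assume "\<not> direct f"
  then have "direct (f \<circ> hconj)" using isometry_cases assms(1) by blast
  then obtain a b where ab: "cmod b < cmod a"
     "\<And>x. disc_coord ((f \<circ> hconj) x) = su_act a b (disc_coord x)"
    unfolding direct_def by blast
  define e where "e = (a * cnj a - b * cnj b) / (cnj b * 0 + cnj a)\<^sup>2"
  have "((\<lambda>w. disc_coord ((f \<circ> hconj) (of_disc w))) has_derivative (*) e) (at 0)"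
    unfolding e_def by (rule direct_derivative[OF ab]) simp
  then have "((\<lambda>w. disc_coord ((f \<circ> hconj) (of_disc w))) has_derivative (*) e) (at (cnj 0))"
    by simp
  moreover have "(cnj has_derivative cnj) (at 0)"
    using bounded_linear_cnj bounded_linear_imp_has_derivative by blast
  ultimately have "((\<lambda>w. disc_coord ((f \<circ> hconj) (of_disc (cnj w)))) has_derivative (\<lambda>w. e * cnj w)) (at 0)"
    using has_derivative_compose by fastforce
  then have 1: "((\<lambda>w. disc_coord (f (of_disc w))) has_derivative (\<lambda>w. e * cnj w)) (at 0)"
  proof (rule has_derivative_transform_within_open[OF _ open_ball])
    show "(0::complex) \<in> ball 0 1" by simp
  qed (simp add: hconj_def)
  obtain D where D: "((\<lambda>w. disc_coord (f (of_disc w))) has_derivative D) (at 0)"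
     "0 < Im (cnj (D 1) * D \<i>)"
    using assms(2) unfolding orientation_preserving_def
    by (metis centre_in_ball zero_less_one)
  have "D = (\<lambda>w. e * cnj w)" using has_derivative_unique[OF D(1) 1] .
  then have "0 < Im (cnj (e * cnj 1) * (e * cnj \<i>))" using D(2) by simp
  also have "Im (cnj (e * cnj 1) * (e * cnj \<i>)) = - (cmod e)\<^sup>2"
    unfolding cmod_power2 by (simp add: power2_eq_square algebra_simps)
  finally show False by simp
qed

section \<open>The Klein model\<close>

text \<open>\<open>hyp_time\<close> and \<open>hyp_space\<close> are the coordinates on the hyperboloid in Minkowski space.\<close>

definition hyp_time :: "hyperbolic_plane \<Rightarrow> real" where
  "hyp_time x = (1 + (cmod (disc_coord x))\<^sup>2) / (1 - (cmod (disc_coord x))\<^sup>2)"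

definition hyp_space :: "hyperbolic_plane \<Rightarrow> complex" where
  "hyp_space x = 2 * disc_coord x / of_real (1 - (cmod (disc_coord x))\<^sup>2)"

text \<open>The Beltrami-Klein model, the central projection of the hyperboloid (see
  \<open>klein_eq\<close>). Geodesic segments become Euclidean ones there, so hulls, extreme points
  and half-planes can be taken from Euclidean convexity.\<close>

definition klein :: "hyperbolic_plane \<Rightarrow> complex" where
  "klein x = 2 * disc_coord x / of_real (1 + (cmod (disc_coord x))\<^sup>2)"

text \<open>Inverting \<open>klein\<close> means solving a quadratic equation for the modulus of the
  disc coordinate; this is the root inside the disc, written without dividing by |w|.\<close>

definition klein_inv :: "complex \<Rightarrow> hyperbolic_plane" where
  "klein_inv w = of_disc (w / of_real (1 + sqrt (1 - (cmod w)\<^sup>2)))"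

lemma disc_coord_norm_square: "(cmod (disc_coord x))\<^sup>2 < 1"
  by (simp add: abs_square_less_1)

lemma hyp_time_ge_1: "1 \<le> hyp_time x"
  unfolding hyp_time_def using disc_coord_norm_square[of x] by (simp add: field_simps)

lemma hyp_time_square: "(hyp_time x)\<^sup>2 = 1 + hyp_space x \<bullet> hyp_space x"
proof -
  define m where "m = (cmod (disc_coord x))\<^sup>2"
  have m: "m < 1" "m \<ge> 0" using disc_coord_norm_square[of x] by (auto simp: m_def)
  have "hyp_space x \<bullet> hyp_space x = 4 * m / (1 - m)\<^sup>2"
  proof -
    have "cmod (hyp_space x) = 2 * cmod (disc_coord x) / (1 - m)"
      using m unfolding hyp_space_def m_def[symmetric] norm_divide norm_of_real norm_mult by simp
    then have "(cmod (hyp_space x))\<^sup>2 = 4 * m / (1 - m)\<^sup>2"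
      by (simp add: power_divide power_mult_distrib m_def)
    then show ?thesis by (simp add: power2_norm_eq_inner)
  qed
  moreover have "(hyp_time x)\<^sup>2 = (1 + m)\<^sup>2 / (1 - m)\<^sup>2"
    by (simp add: hyp_time_def m_def power_divide)
  moreover have "(1 + m)\<^sup>2 / (1 - m)\<^sup>2 = 1 + 4 * m / (1 - m)\<^sup>2"
  proof -
    have "(1 + m)\<^sup>2 = (1 - m)\<^sup>2 + 4 * m" by (simp add: power2_eq_square algebra_simps)
    moreover have "(1 - m)\<^sup>2 \<noteq> 0" using m by simp
    ultimately show ?thesis by (simp add: add_divide_distrib)
  qed
  ultimately show ?thesis by simp
qed

lemma klein_eq: "klein x = hyp_space x /\<^sub>R hyp_time x"
proof -
  define m where "m = (cmod (disc_coord x))\<^sup>2"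
  have m: "m < 1" "m \<ge> 0" using disc_coord_norm_square[of x] by (auto simp: m_def)
  have "klein x = (inverse ((1 + m) / (1 - m))) *\<^sub>R (2 * disc_coord x / of_real (1 - m))"
  proof -
    have "inverse ((1 + m) / (1 - m)) *\<^sub>R (2 * disc_coord x / of_real (1 - m))
       = of_real ((1 - m) / (1 + m) / (1 - m)) * (2 * disc_coord x)"
      by (simp add: scaleR_conv_of_real)
    also have "(1 - m) / (1 + m) / (1 - m) = 1 / (1 + m)" using m by simp
    finally show ?thesis by (simp add: klein_def m_def)
  qed
  then show ?thesis by (simp add: hyp_space_def hyp_time_def m_def)
qed

lemma cosh_dist: "cosh (dist x y) = hyp_time x * hyp_time y - hyp_space x \<bullet> hyp_space y"
proof -
  have "cosh (dist x y) = cosh_hdist (disc_coord x) (disc_coord y)"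
    by (simp add: dist_hyperbolic_plane_def cosh_hdist_ge_1)
  also have "\<dots> = hyp_time x * hyp_time y - hyp_space x \<bullet> hyp_space y"
    by (simp add: cosh_hdist_hyperboloid hyp_time_def hyp_space_def inner_complex_def)
  finally show ?thesis .
qed

lemma hyp_space_eqI: "hyp_time x = hyp_time y \<Longrightarrow> hyp_space x = hyp_space y \<Longrightarrow> x = y"
proof -
  assume a: "hyp_time x = hyp_time y" "hyp_space x = hyp_space y"
  then have "cosh (dist x y) = 1"
    using hyp_time_square[of y] by (simp add: cosh_dist power2_eq_square)
  then have "dist x y = 0" by (metis cosh_0 cosh_real_strict_mono dist_not_less_zero less_irrefl
        linorder_cases zero_le_dist order_refl)
  then show ?thesis by simp
qed

text \<open>The Lorentz complement of a timelike vector is definite, so it contains no nonzero null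
  vector; this is Cauchy-Schwarz.\<close>

lemma lorentz_orthogonal_null:
  fixes X W :: "'a::real_inner" and x w :: real
  assumes "x\<^sup>2 = 1 + X \<bullet> X" "x * w = X \<bullet> W" "w\<^sup>2 = W \<bullet> W"
  shows "w = 0 \<and> W = 0"
proof -
  have "(X \<bullet> W)\<^sup>2 \<le> (X \<bullet> X) * (W \<bullet> W)" by (rule Cauchy_Schwarz_ineq)
  moreover have "(X \<bullet> W)\<^sup>2 = (1 + X \<bullet> X) * (W \<bullet> W)"
    using assms by (metis power_mult_distrib)
  ultimately have "W \<bullet> W \<le> 0" by (simp add: algebra_simps)
  then have "W = 0" using inner_ge_zero[of W] inner_eq_zero_iff[of W] by linarith
  then show ?thesis using assms by simp
qed

text \<open>The coefficients are those of geodesic interpolation, sinh of the opposite part over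
  sinh of the whole. By the addition theorems for A + B = C the difference (w, W) between z and this
  combination is Lorentz orthogonal to x, y and z. Being itself a combination of these, it is null,
  and so it vanishes.\<close>

lemma hyp_segment_cone:
  assumes z: "z \<in> hyp_segment x y" and "x \<noteq> y"
  shows "\<exists>s t. 0 \<le> s \<and> 0 \<le> t \<and> hyp_time z = s * hyp_time x + t * hyp_time y \<and>
     hyp_space z = s *\<^sub>R hyp_space x + t *\<^sub>R hyp_space y"
proof -
  define A B C where "A = dist x z" and "B = dist z y" and "C = dist x y"
  have C: "C = A + B" "C > 0" "A \<ge> 0" "B \<ge> 0"
    using assms by (auto simp: hyp_segment_def A_def B_def C_def)
  have sC: "sinh C > 0" using C by simp
  define s t where "s = sinh B / sinh C" and "t = sinh A / sinh C"
  have st: "0 \<le> s" "0 \<le> t" using C sC by (auto simp: s_def t_def)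
  have sq: "sinh u ^ 2 = cosh u ^ 2 - 1" for u :: real
    using cosh_square_eq[of u] by simp
  have BA: "cosh B = cosh (C - A)" "sinh B = sinh (C - A)" using C by auto
  have Aeq: "cosh A = s + t * cosh C"
  proof -
    have "sinh B + sinh A * cosh C = cosh A * sinh C"
      unfolding BA sinh_diff by simp
    then show ?thesis using sC by (simp add: s_def t_def field_simps)
  qed
  have Beq: "cosh B = s * cosh C + t"
  proof -
    have "sinh B * cosh C + sinh A = cosh B * sinh C"
    proof -
      have "sinh B * cosh C + sinh A = cosh B * sinh C + sinh A * (1 - ((cosh C)\<^sup>2 - (sinh C)\<^sup>2))"
        unfolding BA sinh_diff cosh_diff by (simp add: power2_eq_square algebra_simps)
      then show ?thesis unfolding sq by simp
    qed
    then show ?thesis using sC by (simp add: s_def t_def field_simps)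
  qed
  have "1 = s * cosh A + t * cosh B"
  proof -
    have "sinh B * cosh A + sinh A * cosh B = sinh C"
      unfolding C(1) by (simp add: sinh_add)
    then show ?thesis using sC by (simp add: s_def t_def field_simps)
  qed
  note eqs = Aeq Beq this
  define w W where "w = hyp_time z - s * hyp_time x - t * hyp_time y"
    and "W = hyp_space z - s *\<^sub>R hyp_space x - t *\<^sub>R hyp_space y"
  have X: "hyp_time x * hyp_time z - hyp_space x \<bullet> hyp_space z = cosh A"
    and Y: "hyp_time z * hyp_time y - hyp_space z \<bullet> hyp_space y = cosh B"
    and XY: "hyp_time x * hyp_time y - hyp_space x \<bullet> hyp_space y = cosh C"
    by (simp_all add: A_def B_def C_def cosh_dist)
  have 1: "hyp_time x * w - hyp_space x \<bullet> W = 0"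
  proof -
    have "hyp_time x * w - hyp_space x \<bullet> W = cosh A - s * ((hyp_time x)\<^sup>2 - hyp_space x \<bullet> hyp_space x)
       - t * cosh C"
      unfolding w_def W_def X[symmetric] XY[symmetric]
      by (simp add: inner_diff_right algebra_simps power2_eq_square)
    then show ?thesis using eqs hyp_time_square[of x] by simp
  qed
  have 2: "hyp_time y * w - hyp_space y \<bullet> W = 0"
  proof -
    have "hyp_time y * w - hyp_space y \<bullet> W = cosh B - s * cosh C
       - t * ((hyp_time y)\<^sup>2 - hyp_space y \<bullet> hyp_space y)"
      unfolding w_def W_def Y[symmetric] XY[symmetric]
      by (simp add: inner_diff_right algebra_simps power2_eq_square inner_commute)
    then show ?thesis using eqs hyp_time_square[of y] by simp
  qed
  have 3: "hyp_time z * w - hyp_space z \<bullet> W = 0"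
  proof -
    have "hyp_time z * w - hyp_space z \<bullet> W =
       ((hyp_time z)\<^sup>2 - hyp_space z \<bullet> hyp_space z) - s * cosh A - t * cosh B"
      unfolding w_def W_def X[symmetric] Y[symmetric]
      by (simp add: inner_diff_right algebra_simps power2_eq_square inner_commute)
    then show ?thesis using eqs hyp_time_square[of z] by simp
  qed
  have "w * w - W \<bullet> W = (hyp_time z * w - hyp_space z \<bullet> W)
      - s * (hyp_time x * w - hyp_space x \<bullet> W) - t * (hyp_time y * w - hyp_space y \<bullet> W)"
    unfolding w_def W_def by (simp add: inner_diff_left algebra_simps)
  then have "w\<^sup>2 = W \<bullet> W" using 1 2 3 by (simp add: power2_eq_square)
  then have "w = 0 \<and> W = 0"
    using 1 by (intro lorentz_orthogonal_null[OF hyp_time_square[of x]]) auto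
  then show ?thesis
    using st unfolding w_def W_def by (intro exI[of _ s] exI[of _ t]) (auto simp: algebra_simps)
qed

text \<open>\<open>one'\<close> expresses that z lies on the hyperboloid. It makes the sinh of the
  two partial distances equal to t and s times the sinh of the whole, and the addition theorem for
  cosh finishes.\<close>

lemma cone_hyp_segment:
  assumes st: "0 \<le> s" "0 \<le> t" and e: "hyp_time z = s * hyp_time x + t * hyp_time y"
     "hyp_space z = s *\<^sub>R hyp_space x + t *\<^sub>R hyp_space y"
  shows "z \<in> hyp_segment x y"
proof -
  define a b c where "a = cosh (dist x z)" and "b = cosh (dist z y)" and "c = cosh (dist x y)"
  have aeq: "a = s + t * c"
  proof -
    have "a = s * ((hyp_time x)\<^sup>2 - hyp_space x \<bullet> hyp_space x) + t * c"
      unfolding a_def c_def cosh_dist e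
      by (simp add: inner_add_right algebra_simps power2_eq_square)
    then show ?thesis by (simp add: hyp_time_square)
  qed
  have beq: "b = s * c + t"
  proof -
    have "b = s * c + t * ((hyp_time y)\<^sup>2 - hyp_space y \<bullet> hyp_space y)"
      unfolding b_def c_def cosh_dist e
      by (simp add: inner_add_left algebra_simps power2_eq_square)
    then show ?thesis by (simp add: hyp_time_square)
  qed
  have one: "1 = s * a + t * b"
  proof -
    have "s * a + t * b = (hyp_time z)\<^sup>2 - hyp_space z \<bullet> hyp_space z"
      unfolding a_def b_def cosh_dist e
      by (simp add: inner_add_left inner_add_right algebra_simps power2_eq_square inner_commute)
    then show ?thesis using hyp_time_square[of z] by simp
  qed
  then have one': "s\<^sup>2 + t\<^sup>2 + 2 * s * t * c = 1"
    unfolding aeq beq by (simp add: power2_eq_square algebra_simps)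
  have c1: "c \<ge> 1" by (simp add: c_def cosh_real_ge_1)
  have sinh_eq: "sinh (dist u v) = sqrt ((cosh (dist u v))\<^sup>2 - 1)" for u v :: hyperbolic_plane
    by (simp add: sinh_square_eq[symmetric])
  have "a\<^sup>2 - 1 = t\<^sup>2 * (c\<^sup>2 - 1)"
    using one' unfolding aeq by (simp add: power2_eq_square algebra_simps)
  moreover have "b\<^sup>2 - 1 = s\<^sup>2 * (c\<^sup>2 - 1)"
    using one' unfolding beq by (simp add: power2_eq_square algebra_simps)
  ultimately have sh: "sinh (dist x z) * sinh (dist z y) = s * t * (c\<^sup>2 - 1)"
    unfolding sinh_eq a_def[symmetric] b_def[symmetric] using st c1
    by (simp add: real_sqrt_mult power2_eq_square)
       (simp add: algebra_simps flip: power2_eq_square)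
  have "cosh (dist x z + dist z y) = a * b + s * t * (c\<^sup>2 - 1)"
    unfolding cosh_add sh a_def b_def by simp
  also have "\<dots> = c * (s\<^sup>2 + t\<^sup>2 + 2 * s * t * c)"
    unfolding aeq beq by (simp add: power2_eq_square algebra_simps)
  also have "\<dots> = cosh (dist x y)" using one' by (simp add: c_def)
  finally have "arcosh (cosh (dist x z + dist z y)) = arcosh (cosh (dist x y))" by simp
  then show ?thesis by (simp add: hyp_segment_def arcosh_cosh_real)
qed

text \<open>The time coordinate is recovered from the Klein point, as its square times 1 - |klein|^2
  is 1; the space coordinates follow.\<close>

lemma klein_inj: "klein x = klein y \<Longrightarrow> x = y"
proof -
  assume a: "klein x = klein y"
  define u v where "u = hyp_time x" and "v = hyp_time y"
  have uv: "u \<ge> 1" "v \<ge> 1" by (auto simp: u_def v_def hyp_time_ge_1)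
  have s: "hyp_space z = hyp_time z *\<^sub>R klein z" for z
    using hyp_time_ge_1[of z] by (simp add: klein_eq)
  have "(hyp_time z)\<^sup>2 * (1 - klein z \<bullet> klein z) = 1" for z
  proof -
    have "(hyp_time z)\<^sup>2 * (1 - klein z \<bullet> klein z) = (hyp_time z)\<^sup>2 - hyp_space z \<bullet> hyp_space z"
      unfolding s by (simp add: power2_eq_square algebra_simps)
    then show ?thesis by (simp add: hyp_time_square)
  qed
  then have "u\<^sup>2 * (1 - klein x \<bullet> klein x) = 1" "v\<^sup>2 * (1 - klein x \<bullet> klein x) = 1"
    unfolding u_def v_def using a by metis+
  then have "u\<^sup>2 = v\<^sup>2"
    by (metis mult_cancel_right mult_zero_right zero_neq_one)
  then have "u = v" using uv by (simp add: power2_eq_iff_nonneg)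
  then show ?thesis using s a by (intro hyp_space_eqI) (auto simp: u_def v_def)
qed

lemma hyp_segment_klein: "z \<in> hyp_segment x y \<longleftrightarrow> klein z \<in> closed_segment (klein x) (klein y)"
proof
  assume z: "z \<in> hyp_segment x y"
  show "klein z \<in> closed_segment (klein x) (klein y)"
  proof (cases "x = y")
    case True
    then show ?thesis using z by (simp add: hyp_segment_def dist_commute)
  next
    case False
    then obtain s t where st: "0 \<le> s" "0 \<le> t" "hyp_time z = s * hyp_time x + t * hyp_time y"
      "hyp_space z = s *\<^sub>R hyp_space x + t *\<^sub>R hyp_space y"
      using hyp_segment_cone[OF z] by blast
    \<comment> \<open>Dividing the cone combination by \<open>hyp_time z\<close> turns s and t into
      barycentric weights; u is the one belonging to y.\<close>
    define u where "u = t * hyp_time y / hyp_time z"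
    have n: "hyp_time x > 0" "hyp_time y > 0" "hyp_time z > 0"
      using hyp_time_ge_1 less_le_trans zero_less_one by blast+
    have u: "1 - u = s * hyp_time x / hyp_time z"
      using n st(3) by (simp add: u_def field_simps)
    have "0 \<le> 1 - u" "0 \<le> u" unfolding u using n st by (auto simp: u_def)
    moreover have "klein z = (1 - u) *\<^sub>R klein x + u *\<^sub>R klein y"
    proof -
      have "(1 - u) *\<^sub>R klein x + u *\<^sub>R klein y
         = (s / hyp_time z) *\<^sub>R hyp_space x + (t / hyp_time z) *\<^sub>R hyp_space y"
      proof -
        have "s * hyp_time x / hyp_time z * inverse (hyp_time x) = s / hyp_time z"
          "u * inverse (hyp_time y) = t / hyp_time z"
          using n by (simp_all add: u_def)
        then show ?thesis unfolding klein_eq u scaleR_scaleR by simp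
      qed
      also have "\<dots> = klein z" unfolding klein_eq st(4)
        by (simp add: scaleR_add_right divide_inverse mult_ac)
      finally show ?thesis ..
    qed
    ultimately show ?thesis by (auto simp: closed_segment_def intro!: exI[of _ u])
  qed
next
  assume "klein z \<in> closed_segment (klein x) (klein y)"
  then obtain u where u: "0 \<le> u" "u \<le> 1" "klein z = (1 - u) *\<^sub>R klein x + u *\<^sub>R klein y"
    by (auto simp: closed_segment_def)
  have n: "hyp_time x > 0" "hyp_time y > 0" "hyp_time z > 0"
    using hyp_time_ge_1 less_le_trans zero_less_one by blast+
  define s t where "s = (1 - u) * hyp_time z / hyp_time x" and "t = u * hyp_time z / hyp_time y"
  have "s * hyp_time x + t * hyp_time y = hyp_time z"
    using n by (simp add: s_def t_def field_simps)
  moreover have "hyp_space z = s *\<^sub>R hyp_space x + t *\<^sub>R hyp_space y"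
  proof -
    have "hyp_space z = hyp_time z *\<^sub>R klein z" using n by (simp add: klein_eq)
    also have "\<dots> = s *\<^sub>R hyp_space x + t *\<^sub>R hyp_space y"
      unfolding u(3) unfolding klein_eq s_def t_def
      by (simp add: scaleR_add_right divide_inverse mult_ac)
    finally show ?thesis .
  qed
  moreover have "0 \<le> s" "0 \<le> t" using n u by (auto simp: s_def t_def)
  ultimately show "z \<in> hyp_segment x y" using cone_hyp_segment by metis
qed

lemma klein_in_ball: "klein x \<in> ball 0 1"
proof -
  have "(hyp_time x)\<^sup>2 * (1 - klein x \<bullet> klein x) = 1"
  proof -
    have "hyp_space x = hyp_time x *\<^sub>R klein x"
      using hyp_time_ge_1[of x] by (simp add: klein_eq)
    then have "(hyp_time x)\<^sup>2 * (1 - klein x \<bullet> klein x) = (hyp_time x)\<^sup>2 - hyp_space x \<bullet> hyp_space x"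
      by (simp add: power2_eq_square algebra_simps)
    then show ?thesis by (simp add: hyp_time_square)
  qed
  then have "0 < (hyp_time x)\<^sup>2 * (1 - klein x \<bullet> klein x)" by simp
  then have "1 - klein x \<bullet> klein x > 0"
    by (metis zero_less_mult_pos hyp_time_ge_1 zero_less_power less_le_trans zero_less_one)
  then show ?thesis by (simp add: dot_square_norm abs_square_less_1)
qed

lemma klein_inv_disc:
  assumes "cmod w < 1"
  shows "cmod (w / of_real (1 + sqrt (1 - (cmod w)\<^sup>2))) < 1"
proof -
  have "(cmod w)\<^sup>2 < 1" using assms by (simp add: abs_square_less_1)
  then have s: "sqrt (1 - (cmod w)\<^sup>2) > 0" by simp
  then have "cmod (of_real (1 + sqrt (1 - (cmod w)\<^sup>2)) :: complex) = 1 + sqrt (1 - (cmod w)\<^sup>2)"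
    by (simp only: norm_of_real)
  then have "cmod (w / of_real (1 + sqrt (1 - (cmod w)\<^sup>2))) = cmod w / (1 + sqrt (1 - (cmod w)\<^sup>2))"
    by (simp only: norm_divide)
  also have "\<dots> < 1" using assms s by (subst divide_less_eq_1_pos) linarith+
  finally show ?thesis .
qed

lemma klein_klein_inv:
  assumes "w \<in> ball 0 1"
  shows "klein (klein_inv w) = w"
proof -
  define c where "c = sqrt (1 - (cmod w)\<^sup>2)"
  have w: "cmod w < 1" using assms by simp
  then have "(cmod w)\<^sup>2 < 1" by (simp add: abs_square_less_1)
  then have c: "c > 0" "c\<^sup>2 = 1 - (cmod w)\<^sup>2" by (auto simp: c_def)
  have d: "disc_coord (klein_inv w) = w / of_real (1 + c)"
    unfolding klein_inv_def c_def using klein_inv_disc[OF w] by simp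
  have "(cmod (w / of_real (1 + c)))\<^sup>2 = (1 - c\<^sup>2) / (1 + c)\<^sup>2"
    using c by (simp only: norm_divide norm_of_real power_divide) simp
  also have "\<dots> = (1 - c) / (1 + c)"
  proof -
    have "1 - c\<^sup>2 = (1 - c) * (1 + c)" by (simp add: power2_eq_square algebra_simps)
    then show ?thesis using c(1) by (simp add: power2_eq_square)
  qed
  finally have e: "1 + (cmod (w / of_real (1 + c)))\<^sup>2 = 2 / (1 + c)"
    using c(1) by (simp only:) (simp add: field_simps)
  show ?thesis
  proof -
    have "(of_real (1 + c) :: complex) \<noteq> 0" using c(1) by (simp only: of_real_eq_0_iff)
    then have "2 * (w / of_real (1 + c)) / of_real (2 / (1 + c)) = w"
      unfolding of_real_divide by (simp del: of_real_add)
    then show ?thesis unfolding klein_def d e .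
  qed
qed

lemma klein_inv_klein [simp]: "klein_inv (klein x) = x"
  using klein_klein_inv[OF klein_in_ball] klein_inj by blast

lemma range_klein: "range klein = ball 0 1"
  using klein_in_ball klein_klein_inv by (metis image_subset_iff rangeI subset_antisym subsetI)

section \<open>Continuity of the coordinate maps\<close>

lemma continuous_disc_coord: "continuous_on S disc_coord"
proof -
  have "continuous (at x) disc_coord" for x
    unfolding continuous_at_eps_delta
  proof (intro allI impI)
    fix e :: real assume e: "e > 0"
    have "isCont (cosh :: real \<Rightarrow> real) 0" by (intro continuous_intros)
    then obtain d where d: "d > 0" "\<And>t::real. \<bar>t\<bar> < d \<Longrightarrow> \<bar>cosh t - 1\<bar> < e\<^sup>2"
    proof -
      have "0 < e\<^sup>2" using e by simp
      then show ?thesis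
        using that \<open>isCont cosh 0\<close> unfolding continuous_at_eps_delta dist_real_def cosh_0 diff_0_right
        by blast
    qed
    show "\<exists>d>0. \<forall>x'. dist x' x < d \<longrightarrow> dist (disc_coord x') (disc_coord x) < e"
    proof (intro exI[of _ d] conjI allI impI d(1))
      fix y assume "dist y x < d"
      then have l: "cosh (dist y x) - 1 < e\<^sup>2" using d(2)[of "dist y x"] by simp
      \<comment> \<open>Since this factor is at most 1, the squared Euclidean distance is bounded by
        cosh of the hyperbolic distance minus 1.\<close>
      define k where "k = (1 - (cmod (disc_coord y))\<^sup>2) * (1 - (cmod (disc_coord x))\<^sup>2)"
      have k: "0 < k" "k \<le> 1"
        using disc_coord_norm_square[of x] disc_coord_norm_square[of y]
        by (auto simp: k_def intro!: mult_le_one)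
      have "cosh (dist y x) - 1 = 2 * (cmod (disc_coord y - disc_coord x))\<^sup>2 / k"
        by (simp add: dist_hyperbolic_plane_def cosh_hdist_ge_1) (simp add: cosh_hdist_def k_def)
      also have "\<dots> \<ge> 2 * (cmod (disc_coord y - disc_coord x))\<^sup>2 / 1"
        using k by (intro divide_left_mono) auto
      finally have "2 * (cmod (disc_coord y - disc_coord x))\<^sup>2 < e\<^sup>2" using l by simp
      then have "(cmod (disc_coord y - disc_coord x))\<^sup>2 < e\<^sup>2"
        using zero_le_power2[of "cmod (disc_coord y - disc_coord x)"] by linarith
      then show "dist (disc_coord y) (disc_coord x) < e"
        using e by (simp add: dist_norm power2_less_imp_less)
    qed
  qed
  then show ?thesis by (simp add: continuous_at_imp_continuous_on)
qed

lemma continuous_klein: "continuous_on S klein"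
proof -
  have "1 + (cmod z)\<^sup>2 \<noteq> 0" for z
    using zero_le_power2[of "cmod z"] by linarith
  then have "(of_real (1 + (cmod z)\<^sup>2) :: complex) \<noteq> 0" for z
    by (simp only: of_real_eq_0_iff not_False_eq_True)
  then show ?thesis
    unfolding klein_def[abs_def] by (intro continuous_intros continuous_disc_coord) auto
qed

lemma continuous_of_disc: "continuous_on (ball 0 1) of_disc"
  unfolding continuous_on_def
proof
  fix z :: complex assume z: "z \<in> ball 0 1"
  then have z1: "(cmod z)\<^sup>2 < 1" by (simp add: abs_square_less_1)
  have ev: "eventually (\<lambda>w. w \<in> ball 0 1) (at z within ball 0 1)"
    by (simp add: eventually_at_topological) blast
  have "((\<lambda>w. cosh_hdist w z) \<longlongrightarrow> cosh_hdist z z) (at z within ball 0 1)"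
    unfolding cosh_hdist_def using z1 by (intro tendsto_intros) auto
  moreover have "continuous_on {1..} (arcosh :: real \<Rightarrow> real)"
    by (intro continuous_intros) auto
  ultimately have "((\<lambda>w. arcosh (cosh_hdist w z)) \<longlongrightarrow> arcosh (cosh_hdist z z)) (at z within ball 0 1)"
    using z by (intro continuous_on_tendsto_compose[where s = "{1..}" and f = arcosh])
      (auto simp: cosh_hdist_eq_1_iff eventually_at_topological intro!: exI[of _ UNIV] cosh_hdist_ge_1)
  then have "((\<lambda>w. arcosh (cosh_hdist w z)) \<longlongrightarrow> 0) (at z within ball 0 1)"
    by (simp add: cosh_hdist_def)
  moreover have "eventually (\<lambda>w. arcosh (cosh_hdist w z) = dist (of_disc w) (of_disc z))
     (at z within ball 0 1)"
    using ev by eventually_elim (use z in \<open>simp add: dist_hyperbolic_plane_def\<close>)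
  ultimately have "((\<lambda>w. dist (of_disc w) (of_disc z)) \<longlongrightarrow> 0) (at z within ball 0 1)"
    using tendsto_cong by force
  then show "(of_disc \<longlongrightarrow> of_disc z) (at z within ball 0 1)"
    by (rule tendsto_dist_iff[THEN iffD2])
qed

lemma continuous_klein_inv: "continuous_on (ball 0 1) klein_inv"
  unfolding klein_inv_def[abs_def]
proof (rule continuous_on_compose2[OF continuous_of_disc])
  have "(of_real (1 + sqrt (1 - (cmod w)\<^sup>2)) :: complex) \<noteq> 0" if "w \<in> ball 0 1" for w
  proof -
    have "(cmod w)\<^sup>2 \<le> 1" using that by (simp add: abs_square_le_1)
    then have "1 + sqrt (1 - (cmod w)\<^sup>2) \<noteq> 0"
      by (smt (verit) real_sqrt_ge_zero)
    then show ?thesis by (simp only: of_real_eq_0_iff not_False_eq_True)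
  qed
  then show "continuous_on (ball 0 1) (\<lambda>w. w / of_real (1 + sqrt (1 - (cmod w)\<^sup>2)) :: complex)"
    by (intro continuous_intros) auto
qed (use klein_inv_disc in \<open>auto simp del: of_real_add\<close>)

section \<open>Convexity and hulls through the Klein model\<close>

lemma klein_segment: "klein ` hyp_segment x y = closed_segment (klein x) (klein y)"
proof
  show "klein ` hyp_segment x y \<subseteq> closed_segment (klein x) (klein y)"
    using hyp_segment_klein by blast
  show "closed_segment (klein x) (klein y) \<subseteq> klein ` hyp_segment x y"
  proof
    fix w assume w: "w \<in> closed_segment (klein x) (klein y)"
    moreover have "closed_segment (klein x) (klein y) \<subseteq> ball 0 1"
      by (rule closed_segment_subset[OF klein_in_ball klein_in_ball convex_ball])
    ultimately have "klein (klein_inv w) = w" using klein_klein_inv by blast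
    then show "w \<in> klein ` hyp_segment x y"
      using w hyp_segment_klein by (metis image_eqI)
  qed
qed

lemma hyp_convex_klein: "hyp_convex S \<longleftrightarrow> convex (klein ` S)"
proof -
  have "hyp_segment x y \<subseteq> S \<longleftrightarrow> closed_segment (klein x) (klein y) \<subseteq> klein ` S" for x y
    unfolding klein_segment[symmetric] by (auto dest!: klein_inj)
  then show ?thesis
    unfolding hyp_convex_def convex_contains_segment by auto
qed

lemma hyp_convex_Inter: "(\<And>S. S \<in> \<A> \<Longrightarrow> hyp_convex S) \<Longrightarrow> hyp_convex (\<Inter>\<A>)"
  unfolding hyp_convex_def by blast

lemma hyp_convex_hull: "hyp_convex (hyp_convex hull A)"
  by (rule hull_in) (auto intro: hyp_convex_Inter)

lemma klein_hull: "klein ` (hyp_convex hull A) = convex hull (klein ` A)"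
proof
  have "convex (klein ` (hyp_convex hull A))"
    using hyp_convex_hull hyp_convex_klein by blast
  then show "convex hull (klein ` A) \<subseteq> klein ` (hyp_convex hull A)"
    by (intro hull_minimal image_mono hull_subset) auto
  let ?C = "klein -` (convex hull (klein ` A))"
  have "klein ` ?C = convex hull (klein ` A) \<inter> ball 0 1"
    by (simp add: image_vimage_eq range_klein)
  then have "hyp_convex ?C"
    unfolding hyp_convex_klein by (metis convex_Int convex_ball convex_convex_hull)
  then have "hyp_convex hull A \<subseteq> ?C"
    by (intro hull_minimal) (auto simp: hull_inc)
  then show "klein ` (hyp_convex hull A) \<subseteq> convex hull (klein ` A)" by blast
qed

lemma hyp_hull_iff: "x \<in> hyp_convex hull A \<longleftrightarrow> klein x \<in> convex hull (klein ` A)"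
  unfolding klein_hull[symmetric] by (auto dest!: klein_inj)

lemma hyp_segment_endpoints [simp]: "x \<in> hyp_segment x y" "y \<in> hyp_segment x y"
  by (auto simp: hyp_segment_def)

lemma hyp_segment_commute: "hyp_segment x y = hyp_segment y x"
  by (auto simp: hyp_segment_def dist_commute add.commute)

lemma hyp_segment_subset_hull:
  assumes "x \<in> hyp_convex hull A" "y \<in> hyp_convex hull A"
  shows "hyp_segment x y \<subseteq> hyp_convex hull A"
proof -
  show ?thesis using hyp_convex_hull assms unfolding hyp_convex_def by blast
qed

lemma hyp_segment_eq_iff: "hyp_segment a b = hyp_segment c d \<longleftrightarrow> {a, b} = {c, d}"
proof
  assume "hyp_segment a b = hyp_segment c d"
  then have "closed_segment (klein a) (klein b) = closed_segment (klein c) (klein d)"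
    by (metis klein_segment)
  then have "{klein a, klein b} = {klein c, klein d}" by (simp add: closed_segment_eq)
  then show "{a, b} = {c, d}" by (auto simp: doubleton_eq_iff dest: klein_inj)
next
  assume "{a, b} = {c, d}"
  then show "hyp_segment a b = hyp_segment c d"
    by (auto simp: doubleton_eq_iff hyp_segment_commute)
qed

lemma finite_hyp_hull_closed:
  assumes "finite A"
  shows "closed (hyp_convex hull A)"
proof -
  have "hyp_convex hull A = klein -` (convex hull (klein ` A))"
    using hyp_hull_iff by blast
  moreover have "closed (convex hull (klein ` A))"
    using assms by (simp add: compact_imp_closed finite_imp_compact_convex_hull)
  ultimately show ?thesis
    using continuous_klein[of UNIV] by (simp add: closed_vimage)
qed

lemma hyp_hull_connected: "connected (hyp_convex hull A)"
proof -
  have "hyp_convex hull A = klein_inv ` (klein ` (hyp_convex hull A))"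
    by (simp add: image_comp comp_def)
  moreover have "connected (klein ` (hyp_convex hull A))"
    unfolding klein_hull by (simp add: convex_connected)
  moreover have "continuous_on (klein ` (hyp_convex hull A)) klein_inv"
    using continuous_klein_inv klein_in_ball by (meson continuous_on_subset image_subsetI)
  ultimately show ?thesis by (metis connected_continuous_image)
qed

lemma isometry_hyp_segment:
  assumes "\<And>x y. dist (f x) (f y) = dist x y" "surj f"
  shows "f ` hyp_segment x y = hyp_segment (f x) (f y)"
proof
  show "f ` hyp_segment x y \<subseteq> hyp_segment (f x) (f y)"
    using assms by (auto simp: hyp_segment_def)
  show "hyp_segment (f x) (f y) \<subseteq> f ` hyp_segment x y"
  proof
    fix z assume z: "z \<in> hyp_segment (f x) (f y)"
    obtain w where "z = f w" using assms(2) by blast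
    then show "z \<in> f ` hyp_segment x y" using z assms by (auto simp: hyp_segment_def)
  qed
qed

lemma isometry_hyp_hull:
  assumes "direct f"
  shows "f ` (hyp_convex hull A) = hyp_convex hull (f ` A)"
proof -
  have sub: "hyp_convex hull (f ` A) \<subseteq> f ` (hyp_convex hull A)" if "direct f" for f A
  proof (rule hull_minimal)
    show "hyp_convex (f ` (hyp_convex hull A))"
      using hyp_convex_hull[of A] unfolding hyp_convex_def
      by (auto simp flip: isometry_hyp_segment[OF direct_dist[OF that] bij_is_surj[OF direct_bij[OF that]]])
  qed (simp add: hull_subset image_mono)
  obtain g where g: "direct g" "g \<circ> f = id" "f \<circ> g = id"
    using direct_inverse_ex[OF assms] by blast
  have "hyp_convex hull A \<subseteq> g ` (hyp_convex hull (f ` A))"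
    using sub[OF g(1), of "f ` A"] by (simp add: image_comp g(2))
  then have "f ` (hyp_convex hull A) \<subseteq> f ` g ` (hyp_convex hull (f ` A))"
    by (rule image_mono)
  then have "f ` (hyp_convex hull A) \<subseteq> hyp_convex hull (f ` A)"
    by (simp add: image_comp g(3))
  then show ?thesis using sub[OF assms, of A] by blast
qed

section \<open>Regular polygons\<close>

definition circle_vertex :: "nat \<Rightarrow> real \<Rightarrow> nat \<Rightarrow> hyperbolic_plane" where
  "circle_vertex p r k = of_disc (of_real r * cis (2 * pi * real k / real p))"

definition ccw_vertices :: "nat \<Rightarrow> (nat \<Rightarrow> hyperbolic_plane) \<Rightarrow> bool" where
  "ccw_vertices p v \<longleftrightarrow> (\<exists>g r. direct g \<and> 0 < r \<and> r < 1 \<and> v = g \<circ> circle_vertex p r)"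

text \<open>The hull of the whole range, so that shifting the enumeration leaves the polygon visibly
  unchanged; by \<open>ccw_range\<close> only p points occur.\<close>

definition polygon :: "(nat \<Rightarrow> hyperbolic_plane) \<Rightarrow> hyperbolic_plane set" where
  "polygon v = hyp_convex hull range v"

lemma disc_coord_circle_vertex:
  "0 < r \<Longrightarrow> r < 1 \<Longrightarrow> disc_coord (circle_vertex p r k) = of_real r * cis (2 * pi * real k / real p)"
  by (simp add: circle_vertex_def norm_mult)

lemma cis_root_mod:
  assumes "0 < p"
  shows "cis (2 * pi * real (k mod p) / real p) = cis (2 * pi * real k / real p)"
proof -
  have "cis (2 * pi * real (j + p * m) / real p) = cis (2 * pi * real j / real p)" for j m
  proof -
    have "2 * pi * real (j + p * m) / real p = 2 * pi * real j / real p + 2 * pi * real m"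
      using assms by (simp add: field_simps)
    moreover have "cis (2 * pi * real m) = 1" by (rule cis_multiple_2pi) simp
    ultimately show ?thesis by (simp add: cis_mult[symmetric] del: of_nat_add of_nat_mult)
  qed
  from this[of "k mod p" "k div p"] show ?thesis by simp
qed

lemma cis_root_eq_iff:
  assumes "0 < p"
  shows "cis (2 * pi * real i / real p) = cis (2 * pi * real j / real p) \<longleftrightarrow> i mod p = j mod p"
proof
  assume "cis (2 * pi * real i / real p) = cis (2 * pi * real j / real p)"
  then have "cis (2 * pi * real (i mod p) / real p) = cis (2 * pi * real (j mod p) / real p)"
    using assms by (simp add: cis_root_mod)
  moreover have "inj_on (\<lambda>k. cis (2 * pi * real k / real p)) {..<p}"
    using Complex.bij_betw_roots_unity[OF assms] bij_betw_imp_inj_on by blast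
  ultimately show "i mod p = j mod p"
    using assms by (auto dest!: inj_onD)
next
  assume "i mod p = j mod p"
  then show "cis (2 * pi * real i / real p) = cis (2 * pi * real j / real p)"
    using cis_root_mod[OF assms] by metis
qed

lemma ccw_eq_iff:
  assumes "ccw_vertices p v" "0 < p"
  shows "v i = v j \<longleftrightarrow> i mod p = j mod p"
proof -
  obtain g r where g: "direct g" "0 < r" "r < 1" "v = g \<circ> circle_vertex p r"
    using assms(1) unfolding ccw_vertices_def by blast
  have "v i = v j \<longleftrightarrow> circle_vertex p r i = circle_vertex p r j"
    using direct_bij[OF g(1)] by (auto simp: g(4) bij_def inj_eq)
  also have "\<dots> \<longleftrightarrow> cis (2 * pi * real i / real p) = cis (2 * pi * real j / real p)"
    using g by (simp add: disc_coord_inject[symmetric] disc_coord_circle_vertex)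
  finally show ?thesis using cis_root_eq_iff[OF assms(2)] by simp
qed

lemma ccw_range:
  assumes "ccw_vertices p v" "0 < p"
  shows "range v = v ` {..<p}"
proof -
  have "v k = v (k mod p)" for k using ccw_eq_iff[OF assms] by simp
  then show ?thesis using assms(2) by (metis (no_types, lifting) image_subsetI imageI lessThan_iff
        mod_less_divisor subset_UNIV image_mono subset_antisym)
qed

lemma ccw_direct:
  assumes "ccw_vertices p v" "direct h"
  shows "ccw_vertices p (h \<circ> v)"
  using assms direct_comp unfolding ccw_vertices_def by (metis comp_assoc)

lemma polygon_direct: "direct h \<Longrightarrow> polygon (h \<circ> v) = h ` polygon v"
  by (simp add: polygon_def isometry_hyp_hull image_comp)

lemma ccw_shift_direct:
  assumes "ccw_vertices p v" "0 < p"
  shows "\<exists>h. direct h \<and> (\<lambda>k. v (k + m)) = h \<circ> v"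
proof -
  obtain g r where g: "direct g" "0 < r" "r < 1" "v = g \<circ> circle_vertex p r"
    using assms(1) unfolding ccw_vertices_def by blast
  \<comment> \<open>The rotation about the centre by m steps, still to be conjugated by g.\<close>
  obtain s where s: "direct s" "\<And>x. disc_coord (s x) = cis (2 * pi * real m / real p) * disc_coord x"
    using direct_rotation[of "cis (2 * pi * real m / real p)"] by auto
  obtain g' where g': "direct g'" "g' \<circ> g = id" using direct_inverse_ex[OF g(1)] by blast
  have "s (circle_vertex p r k) = circle_vertex p r (k + m)" for k
    by (simp add: disc_coord_inject[symmetric] s disc_coord_circle_vertex g cis_mult
        add_divide_distrib distrib_left add.commute mult.left_commute)
  then have "(\<lambda>k. v (k + m)) = (g \<circ> s \<circ> g') \<circ> v"
    using g'(2) by (auto simp: g(4) fun_eq_iff pointfree_idE)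
  moreover have "direct (g \<circ> s \<circ> g')" using direct_comp g s g' by blast
  ultimately show ?thesis by blast
qed

lemma ccw_shift: "ccw_vertices p v \<Longrightarrow> 0 < p \<Longrightarrow> ccw_vertices p (\<lambda>k. v (k + m))"
  using ccw_shift_direct ccw_direct by metis

lemma ccw_range_shift:
  assumes "ccw_vertices p v" "0 < p"
  shows "range (\<lambda>k. v (k + m)) = range v"
proof
  show "range v \<subseteq> range (\<lambda>k. v (k + m))"
  proof
    fix x assume "x \<in> range v"
    then obtain k where k: "x = v k" by blast
    \<comment> \<open>The index \<open>m * (p - 1)\<close> represents -m modulo p within the natural
      numbers.\<close>
    have "v (k + m * (p - 1) + m) = v k"
    proof -
      have "k + m * (p - 1) + m = k + m * p" using assms(2) by (cases p) auto
      then have "(k + m * (p - 1) + m) mod p = k mod p" by (simp only: mod_mult_self1)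
      then show ?thesis using ccw_eq_iff[OF assms] by blast
    qed
    then show "x \<in> range (\<lambda>k. v (k + m))" unfolding k by (metis rangeI)
  qed
qed auto

lemma polygon_shift: "ccw_vertices p v \<Longrightarrow> 0 < p \<Longrightarrow> polygon (\<lambda>k. v (k + m)) = polygon v"
  by (simp add: polygon_def ccw_range_shift)

lemma ccw_side_length:
  assumes "ccw_vertices p v" "0 < p"
  shows "dist (v k) (v (Suc k)) = dist (v 0) (v 1)"
proof -
  obtain h where h: "direct h" "(\<lambda>j. v (j + k)) = h \<circ> v" using ccw_shift_direct[OF assms] by blast
  have "v k = h (v 0)" "v (Suc k) = h (v 1)"
    using fun_cong[OF h(2), of 0] fun_cong[OF h(2), of 1] by auto
  then show ?thesis using direct_dist[OF h(1)] by simp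
qed

text \<open>The side length depends on the Euclidean circumradius t through t / (1 - t^2), which is
  injective on (0, 1).\<close>

lemma circle_side_length_inj:
  assumes "2 \<le> p" "0 < r" "r < 1" "0 < s" "s < 1"
    and "dist (circle_vertex p r 0) (circle_vertex p r 1) = dist (circle_vertex p s 0) (circle_vertex p s 1)"
  shows "r = s"
proof -
  define K where "K = (cmod (1 - cis (2 * pi / real p)))\<^sup>2"
  have "cis (2 * pi * real 0 / real p) \<noteq> cis (2 * pi * real 1 / real p)"
    using cis_root_eq_iff[of p 0 1] assms(1) by simp
  then have K: "K \<noteq> 0" by (simp add: K_def)
  have f: "cosh_hdist (disc_coord (circle_vertex p t 0)) (disc_coord (circle_vertex p t 1))
      = 1 + 2 * K * (t / (1 - t\<^sup>2))\<^sup>2" if "0 < t" "t < 1" for t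
  proof -
    have "(of_real t - of_real t * cis (2 * pi / real p)) = of_real t * (1 - cis (2 * pi / real p))"
      by (simp add: algebra_simps)
    then have "(cmod (of_real t - of_real t * cis (2 * pi / real p)))\<^sup>2 = t\<^sup>2 * K"
      by (simp add: norm_mult power_mult_distrib K_def)
    then show ?thesis using that
      by (simp add: disc_coord_circle_vertex cosh_hdist_def norm_mult power_divide power2_eq_square)
  qed
  have "(r / (1 - r\<^sup>2))\<^sup>2 = (s / (1 - s\<^sup>2))\<^sup>2"
    using assms(6) f[OF assms(2,3)] f[OF assms(4,5)] K unfolding dist_eq_iff_cosh_hdist by simp
  moreover have n: "1 - r\<^sup>2 > 0" "1 - s\<^sup>2 > 0" using assms by (simp_all add: abs_square_less_1)
  ultimately have "r / (1 - r\<^sup>2) = s / (1 - s\<^sup>2)"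
    using assms by (subst (asm) power2_eq_iff_nonneg) auto
  then have "r * (1 - s\<^sup>2) = s * (1 - r\<^sup>2)"
    using n by (simp add: frac_eq_eq)
  then have "(r - s) * (1 + r * s) = 0" by (simp add: algebra_simps power2_eq_square)
  moreover have "1 + r * s > 0" using assms by (simp add: add_pos_pos)
  ultimately show ?thesis by simp
qed

lemma ccw_congruent:
  assumes "ccw_vertices p v" "ccw_vertices p w" "2 \<le> p" "dist (v 0) (v 1) = dist (w 0) (w 1)"
  shows "\<exists>h. direct h \<and> w = h \<circ> v"
proof -
  obtain g r where g: "direct g" "0 < r" "r < 1" "v = g \<circ> circle_vertex p r"
    using assms(1) unfolding ccw_vertices_def by blast
  obtain f s where f: "direct f" "0 < s" "s < 1" "w = f \<circ> circle_vertex p s"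
    using assms(2) unfolding ccw_vertices_def by blast
  have "r = s"
    by (rule circle_side_length_inj[OF assms(3) g(2,3) f(2,3)])
      (use assms(4) direct_dist g f in simp)
  obtain g' where g': "direct g'" "g' \<circ> g = id" using direct_inverse_ex[OF g(1)] by blast
  have "w = (f \<circ> g') \<circ> v"
    using g'(2) \<open>r = s\<close> by (auto simp: g(4) f(4) fun_eq_iff pointfree_idE)
  then show ?thesis using direct_comp f g' by blast
qed

text \<open>Equal side lengths give a direct isometry between the polygons, and it fixes two points.
  Orientation is essential: the mirror image in the common side also contains both points.\<close>

lemma ccw_unique:
  assumes "ccw_vertices p v" "ccw_vertices p w" "2 \<le> p" "v 0 = w 0" "v 1 = w 1"
  shows "v = w"
proof -
  obtain h where h: "direct h" "w = h \<circ> v" using ccw_congruent[OF assms(1-3)] assms by auto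
  have "v 0 \<noteq> v 1" using ccw_eq_iff[OF assms(1), of 0 1] assms(3) by simp
  then have "h = id" using direct_two_fixed_points[OF h(1)] h(2) assms by (metis comp_apply)
  then show ?thesis using h by simp
qed

lemma regular_polygon_with_ccw:
  assumes "ccw_vertices p v" "0 < p"
  shows "regular_polygon_with p v (polygon v)"
proof -
  obtain g r where "direct g" "0 < r" "r < 1" "v = g \<circ> circle_vertex p r"
    using assms(1) unfolding ccw_vertices_def by blast
  then have "regular_vertices p v"
    unfolding regular_vertices_def using direct_hyp_isometry
    by (intro exI[of _ g] exI[of _ r]) (simp add: circle_vertex_def)
  then show ?thesis
    using ccw_range[OF assms] by (simp add: regular_polygon_with_def polygon_def)
qed

text \<open>An enumeration by an orientation-reversing isometry runs clockwise. The multiplier p - 1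
  stands for -1 modulo p, so it is the reversal of a counterclockwise one with the same starting
  vertex.\<close>

lemma regular_polygon_with_cases:
  assumes "regular_polygon_with p v F" "0 < p"
  shows "\<exists>w. ccw_vertices p w \<and> F = polygon w \<and> (v = w \<or> v = (\<lambda>k. w ((p - 1) * k)))"
proof -
  obtain g r where g: "hyp_isometry g" "0 < r" "r < 1"
    and v': "\<And>k. v k = g (of_disc (of_real r * cis (2 * pi * real k / real p)))"
    using assms(1) unfolding regular_polygon_with_def regular_vertices_def by blast
  have v: "v = g \<circ> circle_vertex p r" using v' by (auto simp: circle_vertex_def fun_eq_iff)
  have F: "F = hyp_convex hull (v ` {..<p})" using assms(1) by (simp add: regular_polygon_with_def)
  show ?thesis
    using isometry_cases[OF g(1)]
  proof
    assume "direct g"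
    then have "ccw_vertices p v" using v g unfolding ccw_vertices_def by blast
    then show ?thesis using F ccw_range[OF _ assms(2)] by (auto simp: polygon_def)
  next
    assume d: "direct (g \<circ> hconj)"
    define w where "w = (g \<circ> hconj) \<circ> circle_vertex p r"
    have w: "ccw_vertices p w" using d g unfolding ccw_vertices_def w_def by blast
    have "cnj (cis (2 * pi * real k / real p)) = cis (2 * pi * real ((p - 1) * k) / real p)" for k
    proof -
      have "2 * pi * real ((p - 1) * k) / real p = 2 * pi * real k + (- (2 * pi * real k / real p))"
        using assms(2) by (simp add: of_nat_diff field_simps)
      moreover have "cis (2 * pi * real k) = 1" by (rule cis_multiple_2pi) simp
      ultimately show ?thesis
        by (simp only: cis_mult[symmetric] cis_cnj mult_1)
    qed
    then have "hconj (circle_vertex p r k) = circle_vertex p r ((p - 1) * k)" for k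
      using g by (simp add: disc_coord_inject[symmetric] disc_coord_circle_vertex)
    then have vk: "circle_vertex p r k = hconj (circle_vertex p r ((p - 1) * k))" for k
      by (metis hconj_hconj)
    have "v k = w ((p - 1) * k)" for k
      unfolding v w_def comp_def by (subst vk) (rule refl)
    then have vw: "v = (\<lambda>k. w ((p - 1) * k))" by (rule ext)
    have "v ` {..<p} = range w"
    proof
      show "range w \<subseteq> v ` {..<p}"
      proof
        fix x assume "x \<in> range w"
        then obtain k where k: "x = w k" "k < p" using ccw_range[OF w assms(2)] by auto
        \<comment> \<open>This is -k modulo p; reversing twice gives back k because (p - 1)^2 is 1
          modulo p.\<close>
        define j where "j = (p - 1) * k mod p"
        have "v j = w k"
        proof -
          have "((p - 1) * j) mod p = ((p - 1) * ((p - 1) * k)) mod p"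
            unfolding j_def by (simp add: mod_mult_right_eq)
          also have "(p - 1) * ((p - 1) * k) = k + (p * ((p - 2) * k))" if p2: "p \<ge> 2"
          proof -
            obtain n where "p = n + 2" using le_Suc_ex[OF p2] by auto
            then show ?thesis by (simp add: algebra_simps)
          qed
          then have "((p - 1) * ((p - 1) * k)) mod p = k mod p"
            using assms(2) k(2) by (cases "p \<ge> 2") (auto simp: not_le)
          finally show ?thesis using ccw_eq_iff[OF w assms(2)] by (simp add: vw)
        qed
        moreover have "j < p" using assms(2) by (simp add: j_def)
        ultimately show "x \<in> v ` {..<p}" unfolding k(1) by (metis imageI lessThan_iff)
      qed
    qed (auto simp: vw)
    then show ?thesis using w vw F by (auto simp: polygon_def)
  qed
qed

section \<open>The circumscribed disc of a regular polygon\<close>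

lemma sum_cis_roots:
  assumes "2 \<le> p"
  shows "(\<Sum>k<p. cis (2 * pi * real k / real p)) = 0"
proof -
  define z where "z = cis (2 * pi / real p)"
  have zk: "cis (2 * pi * real k / real p) = z ^ k" for k
    by (simp add: z_def Complex.DeMoivre mult.commute)
  have "z \<noteq> 1" using cis_root_eq_iff[of p 1 0] assms by (simp add: z_def)
  moreover have "z ^ p = 1" unfolding zk[symmetric] using assms by simp
  ultimately show ?thesis unfolding zk by (simp add: geometric_sum)
qed

text \<open>The directions of the vertices sum to zero, so some vertex makes no acute angle with x,
  and its Euclidean distance from x is at least r. The factor 1 - |c|^2 < 1 makes the hyperbolic
  inequality strict. Hence only the centre attains the smallest circumradius.\<close>

lemma circle_vertex_far:
  assumes "2 \<le> p" "0 < r" "r < 1" "x \<noteq> of_disc 0"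
  shows "\<exists>k. dist (of_disc 0) (circle_vertex p r 0) < dist x (circle_vertex p r k)"
proof -
  define c where "c = disc_coord x"
  have c: "c \<noteq> 0" "cmod c < 1" using assms(4) by (auto simp: c_def) (metis of_disc_disc_coord)
  have "\<exists>k<p. Re (c * cnj (cis (2 * pi * real k / real p))) \<le> 0"
  proof (rule ccontr)
    assume "\<not> ?thesis"
    then have "0 < (\<Sum>k<p. Re (c * cnj (cis (2 * pi * real k / real p))))"
      using assms(1) by (intro sum_pos) (auto simp: not_le lessThan_empty_iff)
    also have "\<dots> = Re (c * cnj (\<Sum>k<p. cis (2 * pi * real k / real p)))"
      by (simp only: Re_sum[symmetric] sum_distrib_left cnj_sum)
    finally show False using sum_cis_roots[OF assms(1)] by simp
  qed
  then obtain k where k: "Re (c * cnj (cis (2 * pi * real k / real p))) \<le> 0" by blast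
  define w where "w = of_real r * cis (2 * pi * real k / real p)"
  have w: "cmod w = r" using assms by (simp add: w_def norm_mult)
  have "Re (c * cnj w) = r * Re (c * cnj (cis (2 * pi * real k / real p)))"
    by (simp add: w_def algebra_simps)
  then have "Re (c * cnj w) \<le> 0" using k assms by (simp add: mult_nonneg_nonpos)
  moreover have "(cmod (c - w))\<^sup>2 = (cmod c)\<^sup>2 + (cmod w)\<^sup>2 - 2 * Re (c * cnj w)"
    unfolding cmod_power2 by (simp add: power2_eq_square algebra_simps)
  ultimately have *: "r\<^sup>2 \<le> (cmod (c - w))\<^sup>2" unfolding w using zero_le_power2[of "cmod c"] by linarith
  have r2: "1 - r\<^sup>2 > 0" using assms by (simp add: abs_square_less_1)
  have "(cmod c)\<^sup>2 < 1" "(cmod c)\<^sup>2 > 0" using c by (auto simp: abs_square_less_1)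
  then have m: "0 < (1 - (cmod c)\<^sup>2) * (1 - r\<^sup>2)" "(1 - (cmod c)\<^sup>2) * (1 - r\<^sup>2) < 1 - r\<^sup>2"
    using r2 by auto
  have "cosh_hdist 0 (of_real r) = 1 + 2 * r\<^sup>2 / (1 - r\<^sup>2)"
    using assms by (simp add: cosh_hdist_def)
  also have "\<dots> < 1 + 2 * r\<^sup>2 / ((1 - (cmod c)\<^sup>2) * (1 - r\<^sup>2))"
    using m assms by (simp add: divide_strict_left_mono)
  also have "\<dots> \<le> cosh_hdist c w"
    unfolding cosh_hdist_def w using m * by (intro add_left_mono divide_right_mono) auto
  finally have "cosh_hdist 0 (of_real r) < cosh_hdist c w" .
  moreover have "1 \<le> cosh_hdist 0 (of_real r)" by (rule cosh_hdist_ge_1) (use assms in auto)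
  ultimately have "arcosh (cosh_hdist 0 (of_real r)) < arcosh (cosh_hdist c w)"
    by (simp add: arcosh_less_iff_real)
  then show ?thesis
    using assms by (intro exI[of _ k]) (simp add: dist_hyperbolic_plane_def disc_coord_circle_vertex c_def w_def)
qed

lemma norm_klein: "cmod (klein x) = 2 * cmod (disc_coord x) / (1 + (cmod (disc_coord x))\<^sup>2)"
proof -
  have "0 < 1 + (cmod (disc_coord x))\<^sup>2"
    by (simp add: add_pos_nonneg)
  then show ?thesis unfolding klein_def norm_divide norm_of_real norm_mult by simp
qed

lemma norm_klein_le_iff: "cmod (klein x) \<le> cmod (klein y) \<longleftrightarrow> cmod (disc_coord x) \<le> cmod (disc_coord y)"
proof -
  define a b where "a = cmod (disc_coord x)" and "b = cmod (disc_coord y)"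
  have ab: "0 \<le> a" "a < 1" "0 \<le> b" "b < 1" by (auto simp: a_def b_def)
  have "a * b < 1" using ab by (metis mult.right_neutral mult_less_cancel_left_disj mult_strict_mono
        mult_zero_left not_less zero_less_one le_less)
  have pos: "1 + a\<^sup>2 > 0" "1 + b\<^sup>2 > 0" by (simp_all add: add_pos_nonneg)
  have "cmod (klein x) \<le> cmod (klein y) \<longleftrightarrow> 2 * a * (1 + b\<^sup>2) \<le> 2 * b * (1 + a\<^sup>2)"
    unfolding norm_klein a_def[symmetric] b_def[symmetric] using pos by (simp add: frac_le_eq divide_le_0_iff field_simps)
  also have "\<dots> \<longleftrightarrow> (a - b) * (1 - a * b) \<le> 0"
  proof -
    have "2 * a * (1 + b\<^sup>2) - 2 * b * (1 + a\<^sup>2) = 2 * ((a - b) * (1 - a * b))"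
      by (simp add: algebra_simps power2_eq_square)
    then show ?thesis by linarith
  qed
  also have "\<dots> \<longleftrightarrow> a \<le> b" using \<open>a * b < 1\<close> by (simp add: mult_le_0_iff)
  finally show ?thesis by (simp add: a_def b_def)
qed

lemma dist_origin_le_iff:
  "dist (of_disc 0) x \<le> dist (of_disc 0) y \<longleftrightarrow> cmod (disc_coord x) \<le> cmod (disc_coord y)"
proof -
  define a b where "a = (cmod (disc_coord x))\<^sup>2" and "b = (cmod (disc_coord y))\<^sup>2"
  have ab: "a < 1" "b < 1" using disc_coord_norm_square by (auto simp: a_def b_def)
  have "dist (of_disc 0) x \<le> dist (of_disc 0) y \<longleftrightarrow>
     cosh_hdist 0 (disc_coord x) \<le> cosh_hdist 0 (disc_coord y)"
    unfolding dist_hyperbolic_plane_def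
    by (subst linorder_not_less[symmetric], subst arcosh_less_iff_real)
       (auto simp: cosh_hdist_ge_1)
  also have "\<dots> \<longleftrightarrow> a / (1 - a) \<le> b / (1 - b)"
    by (simp add: cosh_hdist_def a_def b_def) (metis mult_le_cancel_left_pos times_divide_eq_right zero_less_numeral)
  also have "\<dots> \<longleftrightarrow> a * (1 - b) \<le> b * (1 - a)" using ab by (simp add: divide_le_eq le_divide_eq mult.commute)
  also have "\<dots> \<longleftrightarrow> a \<le> b" by (simp add: algebra_simps)
  also have "\<dots> \<longleftrightarrow> cmod (disc_coord x) \<le> cmod (disc_coord y)"
    by (simp add: a_def b_def abs_le_square_iff[symmetric])
  finally show ?thesis .
qed

lemma dist_circle_vertex:
  assumes "0 < r" "r < 1"
  shows "dist (of_disc 0) (circle_vertex p r k) = dist (of_disc 0) (circle_vertex p r 0)"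
  by (rule antisym) (use assms in \<open>simp_all add: dist_origin_le_iff disc_coord_circle_vertex norm_mult\<close>)

text \<open>In the Klein model the polygon lies in the Euclidean disc through its vertices. By
  strict convexity of the disc, a point on its boundary is an extreme point of the hull, hence one
  of the generating points.\<close>

lemma circle_polygon_norm:
  assumes "0 < r" "r < 1" "x \<in> polygon (circle_vertex p r)"
  shows "cmod (disc_coord x) \<le> r \<and> (cmod (disc_coord x) = r \<longrightarrow> x \<in> range (circle_vertex p r))"
proof -
  let ?y = "circle_vertex p r 0"
  have n: "cmod (disc_coord (circle_vertex p r k)) = r" for k
    using assms by (simp add: disc_coord_circle_vertex norm_mult)
  have eqn: "cmod (klein z) = cmod (klein ?y) \<longleftrightarrow> cmod (disc_coord z) = r" for z
    using norm_klein_le_iff[of z ?y] norm_klein_le_iff[of ?y z] n by auto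
  have "convex hull (klein ` range (circle_vertex p r)) \<subseteq> cball 0 (cmod (klein ?y))"
  proof (intro hull_minimal image_subsetI)
    fix z assume "z \<in> range (circle_vertex p r)"
    then have "cmod (klein z) = cmod (klein ?y)" using eqn n by blast
    then show "klein z \<in> cball 0 (cmod (klein ?y))" by simp
  qed simp
  then have le: "cmod w \<le> cmod (klein ?y)" if "w \<in> convex hull (klein ` range (circle_vertex p r))" for w
    using that by auto
  have x: "klein x \<in> convex hull (klein ` range (circle_vertex p r))"
    using assms(3) by (simp add: polygon_def hyp_hull_iff)
  then have 1: "cmod (disc_coord x) \<le> r" using le norm_klein_le_iff[of x ?y] n by simp
  have "x \<in> range (circle_vertex p r)" if "cmod (disc_coord x) = r"
  proof -
    have xe: "cmod (klein x) = cmod (klein ?y)" using eqn that by blast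
    have "klein x extreme_point_of (convex hull (klein ` range (circle_vertex p r)))"
      unfolding extreme_point_of_def
    proof (intro conjI x ballI notI)
      fix a b assume a: "a \<in> convex hull (klein ` range (circle_vertex p r))"
        and b: "b \<in> convex hull (klein ` range (circle_vertex p r))" and "klein x \<in> open_segment a b"
      then have "dist 0 (klein x) < dist 0 a \<or> dist 0 (klein x) < dist 0 b"
        using dist_decreases_open_segment by blast
      then show False using le[OF a] le[OF b] xe by auto
    qed
    then have "klein x \<in> klein ` range (circle_vertex p r)"
      by (rule extreme_point_of_convex_hull)
    then show ?thesis using klein_inj by blast
  qed
  then show ?thesis using 1 by blast
qed

lemma polygon_vertex: "v k \<in> polygon v"
  by (simp add: polygon_def hull_inc)

lemma polygon_segment: "hyp_segment (v i) (v j) \<subseteq> polygon v"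
  unfolding polygon_def by (intro hyp_segment_subset_hull) (simp_all add: hull_inc)

text \<open>The centre and the circumradius are those of the smallest disc containing the polygon,
  and the vertices are the points of the polygon on the boundary of this disc.\<close>

lemma polygon_determines_vertices:
  assumes "ccw_vertices p v" "ccw_vertices p w" "2 \<le> p" "polygon v = polygon w"
  shows "\<exists>m<p. w = (\<lambda>k. v (k + m))"
proof -
  obtain g r where g: "direct g" "0 < r" "r < 1" "v = g \<circ> circle_vertex p r"
    using assms(1) unfolding ccw_vertices_def by blast
  obtain f s where f: "direct f" "0 < s" "s < 1" "w = f \<circ> circle_vertex p s"
    using assms(2) unfolding ccw_vertices_def by blast
  let ?o = "of_disc 0"
  have o: "disc_coord ?o = 0" by simp
  have inside: "dist (g ?o) x \<le> dist ?o (circle_vertex p r 0)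
      \<and> (dist (g ?o) x = dist ?o (circle_vertex p r 0) \<longrightarrow> x \<in> range (g \<circ> circle_vertex p r))"
    if h: "direct g" "0 < r" "r < 1" "x \<in> polygon (g \<circ> circle_vertex p r)" for g r x
  proof -
    obtain y where y: "y \<in> polygon (circle_vertex p r)" "x = g y"
      using h(4) unfolding polygon_direct[OF h(1)] by blast
    have d: "dist (g ?o) x = dist ?o y" using y direct_dist[OF h(1)] by simp
    have n: "cmod (disc_coord (circle_vertex p r 0)) = r"
      using h by (simp add: disc_coord_circle_vertex)
    show ?thesis
    proof
      note * = circle_polygon_norm[OF h(2,3) y(1)]
      show "dist (g ?o) x \<le> dist ?o (circle_vertex p r 0)"
        unfolding d dist_origin_le_iff n using * by blast
      show "dist (g ?o) x = dist ?o (circle_vertex p r 0) \<longrightarrow> x \<in> range (g \<circ> circle_vertex p r)"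
      proof
        assume "dist (g ?o) x = dist ?o (circle_vertex p r 0)"
        then have "cmod (disc_coord y) = r"
          using dist_origin_le_iff[of y "circle_vertex p r 0"] dist_origin_le_iff[of "circle_vertex p r 0" y]
          unfolding d n by simp
        then have "y \<in> range (circle_vertex p r)" using * by blast
        then show "x \<in> range (g \<circ> circle_vertex p r)" unfolding y(2) by (metis imageI image_comp)
      qed
    qed
  qed
  have far: "\<exists>k. dist ?o (circle_vertex p r 0) < dist c ((g \<circ> circle_vertex p r) k)"
    if h: "direct g" "0 < r" "r < 1" "c \<noteq> g ?o" for g r c
  proof -
    obtain y where y: "c = g y" using direct_bij[OF h(1)] by (metis bij_pointE)
    then have "y \<noteq> ?o" using h by blast
    then show ?thesis using circle_vertex_far[OF assms(3) h(2,3)] y direct_dist[OF h(1)] by simp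
  qed
  define R S where "R = dist ?o (circle_vertex p r 0)" and "S = dist ?o (circle_vertex p s 0)"
  have in1: "dist (g ?o) x \<le> R" if "x \<in> polygon v" for x
    using inside[OF g(1-3)] that unfolding R_def g(4) by blast
  have in2: "dist (f ?o) x \<le> S" if "x \<in> polygon v" for x
    using inside[OF f(1-3)] that unfolding S_def assms(4) f(4) by blast
  have wv: "w k \<in> polygon v" for k using assms(4) polygon_vertex by metis
  have dv: "dist (g ?o) (v k) = R" for k
  proof -
    have "dist (g ?o) (v k) = dist ?o (circle_vertex p r k)" by (simp add: g direct_dist[OF g(1)])
    then show ?thesis unfolding R_def using dist_circle_vertex[OF g(2,3)] by simp
  qed
  have dw: "dist (f ?o) (w k) = S" for k
  proof -
    have "dist (f ?o) (w k) = dist ?o (circle_vertex p s k)" by (simp add: f direct_dist[OF f(1)])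
    then show ?thesis unfolding S_def using dist_circle_vertex[OF f(2,3)] by simp
  qed
  \<comment> \<open>If the centres differed, \<open>far\<close> for f together with
    \<open>in1\<close> would give S < R, and \<open>far\<close> for g together with
    \<open>in2\<close> would give R < S.\<close>
  have centre: "f ?o = g ?o"
  proof (rule ccontr)
    assume ne: "f ?o \<noteq> g ?o"
    obtain k where "S < dist (g ?o) (w k)"
      using far[OF f(1-3) ne[symmetric]] unfolding S_def f(4) by blast
    moreover obtain j where "R < dist (f ?o) (v j)"
      using far[OF g(1-3) ne] unfolding R_def g(4) by blast
    ultimately show False using in1[OF wv[of k]] in2[OF polygon_vertex[of v j]] by linarith
  qed
  then have "R = S"
    using in1[OF wv[of 0]] in2[OF polygon_vertex[of v 0]] dv[of 0] dw[of 0] by simp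
  then have rs: "r = s"
    using dist_origin_le_iff[of "circle_vertex p r 0" "circle_vertex p s 0"]
      dist_origin_le_iff[of "circle_vertex p s 0" "circle_vertex p r 0"] g f
    unfolding R_def S_def by (simp add: disc_coord_circle_vertex)
  have "w 0 \<in> range v"
    using inside[OF g(1-3), of "w 0"] wv[of 0] dw[of 0] centre \<open>R = S\<close> g(4) unfolding R_def S_def by metis
  then obtain m where m: "w 0 = v m" "m < p" using ccw_range[OF assms(1)] assms(3) by auto
  obtain g' where g': "direct g'" "g' \<circ> g = id" "g \<circ> g' = id" using direct_inverse_ex[OF g(1)] by blast
  \<comment> \<open>With a common centre the two positions differ by a rotation, whose angle is read
    off from the image of vertex 0.\<close>
  have "(g' \<circ> f) ?o = ?o" using centre g'(2) by (simp add: pointfree_idE)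
  then obtain c where c: "\<And>x. disc_coord ((g' \<circ> f) x) = c * disc_coord x"
    using direct_fixing_origin[OF direct_comp[OF g'(1) f(1)]] by blast
  have "g' (w 0) = circle_vertex p r m" using m g'(2) by (simp add: g(4) pointfree_idE)
  then have "c * of_real r = of_real r * cis (2 * pi * real m / real p)"
    using c[of "circle_vertex p r 0"] f g rs by (simp add: disc_coord_circle_vertex)
  then have cm: "c = cis (2 * pi * real m / real p)" using g(2) by simp
  have "w k = v (k + m)" for k
  proof -
    have "disc_coord (g' (w k)) = disc_coord (circle_vertex p r (k + m))"
      using c[of "circle_vertex p r k"] g rs cm
      by (simp add: f(4) disc_coord_circle_vertex cis_mult add_divide_distrib distrib_left add.commute)
    then have "g' (w k) = circle_vertex p r (k + m)" by (simp add: disc_coord_inject)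
    then show ?thesis using g'(3) by (metis comp_apply g(4) id_apply)
  qed
  then show ?thesis using m(2) by auto
qed

section \<open>Supporting lines along the sides\<close>

lemma cos_circle_vertex:
  assumes "3 \<le> p" "k < p"
  shows "cos (2 * pi * real k / real p - pi / real p) \<le> cos (pi / real p) \<and>
    (cos (2 * pi * real k / real p - pi / real p) = cos (pi / real p) \<longrightarrow> k = 0 \<or> k = 1)"
proof -
  consider "k = 0" | "k = 1" | "k \<ge> 2" by linarith
  then show ?thesis
  proof cases
    case 3
    \<comment> \<open>The angle is measured from pi/p, the direction of the midpoint of the first
      side. Vertices 0 and 1 lie at distance pi/p from it, all others farther away on the circle of
      directions.\<close>
    define t where "t = 2 * pi * real k / real p - pi / real p"
    have p: "real p \<ge> 3" using assms by simp
    have a: "0 \<le> pi / real p" "pi / real p < t" "pi / real p < 2 * pi - t"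
    proof -
      have "t - pi / real p = 2 * pi * (real k - 1) / real p" using p
        by (simp add: t_def diff_divide_distrib right_diff_distrib)
      also have "\<dots> > 0" using 3 p by simp
      finally show "pi / real p < t" by simp
      have "2 * pi - t - pi / real p = 2 * pi * (real p - real k) / real p"
        using p by (simp add: t_def field_simps)
      also have "\<dots> > 0" using assms p by simp
      finally show "pi / real p < 2 * pi - t" by simp
    qed simp
    have "cos t < cos (pi / real p)"
    proof (cases "t \<le> pi")
      case True
      then show ?thesis using a by (intro cos_monotone_0_pi) auto
    next
      case False
      then have "cos (2 * pi - t) < cos (pi / real p)" using a by (intro cos_monotone_0_pi) auto
      then show ?thesis by (simp add: cos_diff)
    qed
    then show ?thesis by (simp add: t_def)
  qed auto
qed

text \<open>The strict bounds on the weight at points other than the ends are what lets a maximum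
  inside a segment propagate to both ends.\<close>

definition affine_on_segments :: "(hyperbolic_plane \<Rightarrow> real) \<Rightarrow> bool" where
  "affine_on_segments f \<longleftrightarrow> (\<forall>x y. \<forall>z\<in>hyp_segment x y. \<exists>u. 0 \<le> u \<and> u \<le> 1 \<and>
     f z = (1 - u) * f x + u * f y \<and> (z \<noteq> x \<longrightarrow> 0 < u) \<and> (z \<noteq> y \<longrightarrow> u < 1))"

lemmas affine_on_segmentsD = affine_on_segments_def[THEN iffD1, rule_format]

text \<open>In the Klein model the line through a side bounds a Euclidean half-plane.\<close>

lemma polygon_supporting_line:
  assumes "ccw_vertices p v" "3 \<le> p"
  obtains f :: "hyperbolic_plane \<Rightarrow> real" and M
  where "\<And>k. f (v k) \<le> M" "\<And>k. f (v k) = M \<longleftrightarrow> k mod p \<in> {0, 1}"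
    and "affine_on_segments f"
    and "\<And>z U. f z = M \<Longrightarrow> open U \<Longrightarrow> z \<in> U \<Longrightarrow> \<exists>y\<in>U. M < f y"
proof -
  obtain g r where g: "direct g" "0 < r" "r < 1" "v = g \<circ> circle_vertex p r"
    using assms(1) unfolding ccw_vertices_def by blast
  obtain h where h: "direct h" "h \<circ> g = id" "g \<circ> h = id" using direct_inverse_ex[OF g(1)] by blast
  have hg: "h (g x) = x" "g (h x) = x" for x using h by (simp_all add: pointfree_idE)
  \<comment> \<open>Multiplication by c turns the outward normal of the first side into the positive
    real direction; \<open>\<rho>\<close> below is the Klein radius of the vertices.\<close>
  define c where "c = cis (- (pi / real p))"
  define \<rho> where "\<rho> = 2 * r / (1 + r\<^sup>2)"
  have \<rho>: "\<rho> > 0" using g by (simp add: \<rho>_def add_pos_nonneg)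
  define f where "f x = Re (klein (h x) * c)" for x
  define M where "M = \<rho> * cos (pi / real p)"
  have kl: "klein (circle_vertex p r k) = of_real \<rho> * cis (2 * pi * real k / real p)" for k
  proof -
    have "cmod (disc_coord (circle_vertex p r k)) = r"
      using g by (simp add: disc_coord_circle_vertex norm_mult)
    then show ?thesis
      unfolding klein_def using g by (simp add: disc_coord_circle_vertex \<rho>_def)
  qed
  have fv: "f (v k) = \<rho> * cos (2 * pi * real (k mod p) / real p - pi / real p)" for k
  proof -
    have "v k = v (k mod p)" using ccw_eq_iff[OF assms(1)] assms(2) by simp
    then have "f (v k) = Re (klein (circle_vertex p r (k mod p)) * c)"
      by (simp add: f_def g(4) hg)
    then show ?thesis by (simp add: kl c_def cis_mult mult.assoc)
  qed
  show thesis
  proof (rule that[of f M])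
    fix k
    have k: "k mod p < p" using assms(2) by simp
    show "f (v k) \<le> M" using cos_circle_vertex[OF assms(2) k] \<rho> by (simp add: fv M_def)
    show "f (v k) = M \<longleftrightarrow> k mod p \<in> {0, 1}"
      using cos_circle_vertex[OF assms(2) k] \<rho> by (auto simp: fv M_def)
  next
    show "affine_on_segments f"
      unfolding affine_on_segments_def
    proof (intro allI ballI)
      fix x y z assume z: "z \<in> hyp_segment x y"
      have "h z \<in> hyp_segment (h x) (h y)"
        using z direct_dist[OF h(1)] by (simp add: hyp_segment_def)
      then obtain u where u: "0 \<le> u" "u \<le> 1" "klein (h z) = (1 - u) *\<^sub>R klein (h x) + u *\<^sub>R klein (h y)"
        by (auto simp: hyp_segment_klein closed_segment_def)
      have "f z = (1 - u) * f x + u * f y"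
        unfolding f_def u(3) by (simp add: algebra_simps)
      moreover have "u \<noteq> 0" if "z \<noteq> x"
        using u(3) that klein_inj hg by (metis add.right_neutral diff_zero scaleR_one scaleR_zero_left)
      moreover have "u \<noteq> 1" if "z \<noteq> y"
        using u(3) that klein_inj hg by (metis add.left_neutral diff_self scaleR_one scaleR_zero_left)
      ultimately show "\<exists>u. 0 \<le> u \<and> u \<le> 1 \<and> f z = (1 - u) * f x + u * f y \<and> (z \<noteq> x \<longrightarrow> 0 < u) \<and> (z \<noteq> y \<longrightarrow> u < 1)"
        using u by (intro exI[of _ u]) auto
    qed
  next
    fix z U assume z: "f z = M" "open U" "z \<in> U"
    define w where "w = klein (h z)"
    have "continuous_on (ball 0 1) (\<lambda>u. g (klein_inv u))"
    proof (rule continuous_on_compose2[OF _ continuous_klein_inv])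
      have "isCont g x" for x
        unfolding continuous_at_eps_delta using direct_dist[OF g(1)] by metis
      then show "continuous_on UNIV g" by (simp add: continuous_at_imp_continuous_on)
    qed auto
    then have op: "open ((\<lambda>u. g (klein_inv u)) -` U \<inter> ball 0 1)"
      using z(2) continuous_on_open_vimage[OF open_ball] by blast
    have "w \<in> (\<lambda>u. g (klein_inv u)) -` U \<inter> ball 0 1"
      using z(3) klein_in_ball by (simp add: w_def hg)
    then obtain e where e: "e > 0" "ball w e \<subseteq> (\<lambda>u. g (klein_inv u)) -` U \<inter> ball 0 1"
      using op unfolding open_contains_ball by blast
    \<comment> \<open>A step along the outward normal raises the functional by e / 2 and stays
      within the ball.\<close>
    define w' where "w' = w + of_real (e / 2) * cis (pi / real p)"
    have "dist w w' = e / 2" using e by (simp add: w'_def dist_norm norm_mult)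
    then have w': "w' \<in> ball w e" using e by simp
    have "f (g (klein_inv w')) = Re (w' * c)"
      using w' e(2) klein_klein_inv by (simp add: f_def hg subset_iff)
    also have "\<dots> = Re (w * c) + e / 2"
      by (simp add: w'_def c_def distrib_right cis_mult mult.assoc)
    also have "\<dots> > M" using z(1) e by (simp add: f_def w_def)
    finally show "\<exists>y\<in>U. M < f y" using w' e(2) by (intro bexI[of _ "g (klein_inv w')"]) auto
  qed
qed

text \<open>The polygon lies in the half-plane where \<open>f\<close> is at most M, while every
  neighbourhood of a point with \<open>f\<close> = M leaves it.\<close>

lemma side_not_interior:
  assumes "ccw_vertices p v" "3 \<le> p" "z \<in> hyp_segment (v 0) (v 1)"
  shows "z \<notin> interior (polygon v)"
proof
  assume z: "z \<in> interior (polygon v)"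
  obtain f :: "hyperbolic_plane \<Rightarrow> real" and M
  where f: "\<And>k. f (v k) \<le> M" "\<And>k. f (v k) = M \<longleftrightarrow> k mod p \<in> {0, 1}"
    and seg: "affine_on_segments f"
    and nbh: "\<And>z U. f z = M \<Longrightarrow> open U \<Longrightarrow> z \<in> U \<Longrightarrow> \<exists>y\<in>U. M < f y"
    using polygon_supporting_line[OF assms(1,2)] by blast
  have "hyp_convex {x. f x \<le> M}"
    unfolding hyp_convex_def
  proof (intro ballI subsetI)
    fix x y z assume "x \<in> {x. f x \<le> M}" "y \<in> {x. f x \<le> M}" "z \<in> hyp_segment x y"
    then obtain u where u: "0 \<le> u" "u \<le> 1" "f z = (1 - u) * f x + u * f y" "f x \<le> M" "f y \<le> M"
      using affine_on_segmentsD[OF seg] by blast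
    then have "f z \<le> (1 - u) * M + u * M" by (simp add: add_mono mult_left_mono)
    then show "z \<in> {x. f x \<le> M}" by (simp add: algebra_simps)
  qed
  then have "polygon v \<subseteq> {x. f x \<le> M}"
    unfolding polygon_def using f by (intro hull_minimal) auto
  moreover have "f (v 0) = M" "f (v 1) = M" using f(2)[of 0] f(2)[of 1] assms(2) by auto
  then have "f z = M" using affine_on_segmentsD[OF seg assms(3)] by (auto simp: algebra_simps)
  ultimately show False
    using nbh[OF _ open_interior z] interior_subset by (metis (mono_tags) mem_Collect_eq not_le subsetD)
qed

lemma vertex_on_side:
  assumes "ccw_vertices p v" "3 \<le> p" "v k \<in> hyp_segment (v 0) (v 1)"
  shows "k mod p = 0 \<or> k mod p = 1"
proof -
  obtain f :: "hyperbolic_plane \<Rightarrow> real" and M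
  where f: "\<And>k. f (v k) \<le> M" "\<And>k. f (v k) = M \<longleftrightarrow> k mod p \<in> {0, 1}"
    and seg: "affine_on_segments f"
    and "\<And>z U. f z = M \<Longrightarrow> open U \<Longrightarrow> z \<in> U \<Longrightarrow> \<exists>y\<in>U. M < f y"
    using polygon_supporting_line[OF assms(1,2)] by blast
  have "f (v 0) = M" "f (v 1) = M" using f(2)[of 0] f(2)[of 1] assms(2) by auto
  then have "f (v k) = M" using affine_on_segmentsD[OF seg assms(3)] by (auto simp: algebra_simps)
  then show ?thesis using f(2) by auto
qed

text \<open>At z the functional attains its bound M, and z has positive weight at both ends of side
  k, so both ends attain M as well. For p \<ge> 3 only k = 0 modulo p puts both k and k + 1 into {0,
  1}.\<close>

lemma sides_meet_in_vertex:
  assumes "ccw_vertices p v" "3 \<le> p" "z \<in> hyp_segment (v 0) (v 1)"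
    "z \<in> hyp_segment (v k) (v (Suc k))" "z \<notin> range v"
  shows "k mod p = 0"
proof -
  obtain f :: "hyperbolic_plane \<Rightarrow> real" and M
  where f: "\<And>k. f (v k) \<le> M" "\<And>k. f (v k) = M \<longleftrightarrow> k mod p \<in> {0, 1}"
    and seg: "affine_on_segments f"
    and "\<And>z U. f z = M \<Longrightarrow> open U \<Longrightarrow> z \<in> U \<Longrightarrow> \<exists>y\<in>U. M < f y"
    using polygon_supporting_line[OF assms(1,2)] by blast
  have "f (v 0) = M" "f (v 1) = M" using f(2)[of 0] f(2)[of 1] assms(2) by auto
  then have fz: "f z = M" using affine_on_segmentsD[OF seg assms(3)] by (auto simp: algebra_simps)
  obtain u where u: "f z = (1 - u) * f (v k) + u * f (v (Suc k))" "0 < u" "u < 1"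
    using affine_on_segmentsD[OF seg assms(4)] assms(5) by blast
  have "(1 - u) * (M - f (v k)) + u * (M - f (v (Suc k))) = 0"
    using u fz by (simp add: algebra_simps)
  moreover have "(1 - u) * (M - f (v k)) \<ge> 0" "u * (M - f (v (Suc k))) \<ge> 0"
    using u f(1) by auto
  ultimately have "(1 - u) * (M - f (v k)) = 0" "u * (M - f (v (Suc k))) = 0" by linarith+
  then have "f (v k) = M" "f (v (Suc k)) = M" using u by auto
  then have "k mod p \<in> {0, 1}" "Suc k mod p \<in> {0, 1}" using f(2) by auto
  then show ?thesis using assms(2) by (auto simp: mod_Suc split: if_splits)
qed

lemma polygon_closed: "ccw_vertices p v \<Longrightarrow> 0 < p \<Longrightarrow> closed (polygon v)"
  by (simp add: polygon_def ccw_range finite_hyp_hull_closed)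

lemma polygon_connected: "connected (polygon v)"
  by (simp add: polygon_def hyp_hull_connected)

section \<open>Cyclic permutations\<close>

locale cyclic_permutation =
  fixes L :: "'a set" and f :: "'a \<Rightarrow> 'a"
  assumes finite_L: "finite L" and maps: "x \<in> L \<Longrightarrow> f x \<in> L" and inj: "inj_on f L"
    and transitive: "x \<in> L \<Longrightarrow> y \<in> L \<Longrightarrow> \<exists>i. y = (f ^^ i) x"
begin

lemma funpow_mem: "x \<in> L \<Longrightarrow> (f ^^ i) x \<in> L"
  by (induction i) (auto intro: maps)

lemma funpow_inj: "x \<in> L \<Longrightarrow> y \<in> L \<Longrightarrow> (f ^^ i) x = (f ^^ i) y \<Longrightarrow> x = y"
  by (induction i) (auto dest: inj_onD[OF inj] intro: funpow_mem)

text \<open>A return after j - i steps confines the orbit, which is all of \<open>L\<close>, to that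
  many elements.\<close>

lemma funpow_card_eq_less:
  assumes "x \<in> L" "i < j" "(f ^^ i) x = (f ^^ j) x"
  shows "card L \<le> j - i"
proof -
  let ?n = "j - i"
  have "(f ^^ i) x = (f ^^ i) ((f ^^ ?n) x)"
    using assms by (simp flip: funpow_add comp_apply[of "f ^^ i"])
  then have n: "(f ^^ ?n) x = x" using funpow_inj funpow_mem assms(1) by metis
  have "L \<subseteq> (\<lambda>k. (f ^^ k) x) ` {..<?n}"
  proof
    fix y assume "y \<in> L"
    then obtain k where "y = (f ^^ k) x" using transitive assms(1) by blast
    then have "y = (f ^^ (k mod ?n)) x" using funpow_mod_eq[OF n] by metis
    then show "y \<in> (\<lambda>k. (f ^^ k) x) ` {..<?n}" using assms(2) by auto
  qed
  then have "card L \<le> card ((\<lambda>k. (f ^^ k) x) ` {..<?n})" by (intro card_mono) auto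
  also have "\<dots> \<le> ?n" using card_image_le[of "{..<?n}"] by simp
  finally show ?thesis .
qed

lemma funpow_card:
  assumes "x \<in> L"
  shows "(f ^^ card L) x = x"
proof -
  have "\<not> inj_on (\<lambda>i. (f ^^ i) x) {..card L}"
  proof
    assume "inj_on (\<lambda>i. (f ^^ i) x) {..card L}"
    then have "card {..card L} \<le> card L"
      by (rule card_inj_on_le) (use funpow_mem assms finite_L in auto)
    then show False by simp
  qed
  then obtain i j where ij: "i < j" "j \<le> card L" "(f ^^ i) x = (f ^^ j) x"
    unfolding inj_on_def by (metis atMost_iff linorder_neqE_nat)
  have "card L \<le> j - i" using funpow_card_eq_less[OF assms ij(1,3)] .
  then have "i = 0" "j = card L" using ij by auto
  then show ?thesis using ij by simp
qed

lemma funpow_eq_iff_mod: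
  assumes "x \<in> L"
  shows "(f ^^ i) x = (f ^^ j) x \<longleftrightarrow> i mod card L = j mod card L"
proof
  have m: "(f ^^ i) x = (f ^^ (i mod card L)) x" for i
    using funpow_mod_eq[OF funpow_card[OF assms]] by simp
  have c: "card L > 0" using assms finite_L by (auto simp: card_gt_0_iff)
  {
    fix i j :: nat assume ij: "i < card L" "j < card L" "(f ^^ i) x = (f ^^ j) x"
    have "i = j"
      using funpow_card_eq_less[OF assms, of i j] funpow_card_eq_less[OF assms, of j i] ij
      by (cases i j rule: linorder_cases) auto
  }
  then show "(f ^^ i) x = (f ^^ j) x \<Longrightarrow> i mod card L = j mod card L"
    using m c by (metis mod_less_divisor)
  show "i mod card L = j mod card L \<Longrightarrow> (f ^^ i) x = (f ^^ j) x"
    using m by metis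
qed

end

text \<open>Reaching everything from one base point is enough: by finiteness a recurs with period n
  - m, so a point i steps after a gets back to a by going on to the i-th multiple of the
  period.\<close>

lemma cyclic_permutationI:
  assumes "finite L" "\<And>x. x \<in> L \<Longrightarrow> f x \<in> L" "inj_on f L" "a \<in> L"
    and "\<And>y. y \<in> L \<Longrightarrow> \<exists>i. y = (f ^^ i) a"
  shows "cyclic_permutation L f"
proof
  fix x y assume x: "x \<in> L" and y: "y \<in> L"
  have mem: "(f ^^ i) z \<in> L" if "z \<in> L" for i z
    using that by (induction i) (auto intro: assms(2))
  have injn: "(f ^^ i) u = (f ^^ i) v \<Longrightarrow> u = v" if "u \<in> L" "v \<in> L" for i u v
    using that by (induction i) (auto dest: inj_onD[OF assms(3)] intro: mem)
  obtain i where i: "x = (f ^^ i) a" using assms(5) x by blast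
  obtain j where j: "y = (f ^^ j) a" using assms(5) y by blast
  have "\<not> inj (\<lambda>k. (f ^^ k) a)"
    using assms(1) mem[OF assms(4)] by (metis finite_subset image_subsetI range_inj_infinite)
  then obtain m n where "m < n" "(f ^^ m) a = (f ^^ n) a"
    unfolding inj_def by (metis linorder_neqE_nat)
  then have "(f ^^ m) a = (f ^^ m) ((f ^^ (n - m)) a)"
    by (simp flip: funpow_add comp_apply[of "f ^^ m"])
  then have per: "(f ^^ (n - m)) a = a" using injn assms(4) mem by metis
  have per': "(f ^^ (k * (n - m))) a = a" for k
    by (induction k) (simp_all add: funpow_add per)
  have "(f ^^ (i * (n - m) - i)) x = a"
  proof -
    have "0 < n - m" using \<open>m < n\<close> by simp
    then have "i \<le> i * (n - m)" by (cases "n - m") auto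
    then have "(f ^^ (i * (n - m) - i)) x = (f ^^ (i * (n - m))) a"
      unfolding i by (simp flip: funpow_add comp_apply[of _ "f ^^ i"])
    then show ?thesis using per' by simp
  qed
  then have "y = (f ^^ (j + (i * (n - m) - i))) x" by (simp add: j funpow_add)
  then show "\<exists>i. y = (f ^^ i) x" by blast
qed (use assms in auto)

text \<open>The permutation \<open>\<sigma>\<close> encodes a side pairing of a polygon, \<open>\<rho>\<close> the cyclic order of its sides
  and \<open>\<rho> \<circ> \<sigma>\<close> the vertex cycles.\<close>

definition side_pairing :: "nat \<Rightarrow> 'a set \<Rightarrow> ('a \<Rightarrow> 'a) \<Rightarrow> ('a \<Rightarrow> 'a) \<Rightarrow> bool" where
  "side_pairing q L \<rho> \<sigma> \<longleftrightarrow> cyclic_permutation L \<rho> \<and>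
     (\<forall>x\<in>L. \<sigma> x \<in> L \<and> \<sigma> (\<sigma> x) = x \<and> ((\<rho> \<circ> \<sigma>) ^^ q) x = x)"

section \<open>Construction of side pairings\<close>

lemma Suc_mod_funpow:
  assumes "i < (k::nat)"
  shows "((\<lambda>i. Suc i mod k) ^^ j) i = (i + j) mod k"
  using assms by (induction j) (auto simp: mod_Suc_eq)

text \<open>Every side is paired with itself, so all vertices form a single cycle of length
  k.\<close>

lemma side_pairing_single:
  assumes "0 < k"
  shows "side_pairing k {..<k} (\<lambda>i. Suc i mod k) id"
proof -
  have "cyclic_permutation {..<k} (\<lambda>i. Suc i mod k)"
  proof (rule cyclic_permutationI[of _ _ 0])
    show "inj_on (\<lambda>i. Suc i mod k) {..<k}"
      using assms by (auto simp: inj_on_def mod_Suc split: if_splits)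
    fix y assume "y \<in> {..<k}"
    then show "\<exists>i. y = ((\<lambda>i. Suc i mod k) ^^ i) 0"
      by (intro exI[of _ y]) (simp add: Suc_mod_funpow)
  qed (use assms in auto)
  then show ?thesis by (auto simp: side_pairing_def Suc_mod_funpow)
qed

text \<open>A \<open>k\<close>-cycle on new points is added to \<open>\<rho> \<circ> \<sigma>\<close>, and \<open>\<sigma>\<close> is changed by a transposition
  of the new point \<open>n\<close> with a fixed point \<open>a\<close> of \<open>\<sigma>\<close>; this merges the two cycles.\<close>

lemma side_pairing_extend:
  fixes n k q :: nat
  assumes sp: "side_pairing q {..<n} \<rho> \<sigma>" and "0 < k" "k dvd q" and q: "0 < q" and a: "a < n" "\<sigma> a = a"
  shows "\<exists>\<rho>' \<sigma>'. side_pairing q {..<n + k} \<rho>' \<sigma>' \<and>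
    {x. x < n + k \<and> \<sigma>' x = x} = {x. x < n \<and> \<sigma> x = x} - {a} \<union> {n<..<n + k}"
proof -
  interpret \<rho>: cyclic_permutation "{..<n}" \<rho> using sp by (simp add: side_pairing_def)
  have \<sigma>: "\<sigma> x < n" "\<sigma> (\<sigma> x) = x" "((\<rho> \<circ> \<sigma>) ^^ q) x = x" if "x < n" for x
    using sp that by (auto simp: side_pairing_def)
  have \<rho>: "\<rho> x < n" if "x < n" for x using \<rho>.maps that by auto
  \<comment> \<open>The intended product \<rho>'\<sigma>': the old product on the old points and a
    k-cycle on the new ones. Since \<sigma>' is an involution, putting \<rho>' = \<tau>\<sigma>'
    achieves it.\<close>
  define \<tau> where "\<tau> x = (if x < n then \<rho> (\<sigma> x) else n + Suc (x - n) mod k)" for x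
  define \<sigma>' where "\<sigma>' x = (if x = a then n else if x = n then a else if x < n then \<sigma> x else x)" for x
  define \<rho>' where "\<rho>' x = \<tau> (\<sigma>' x)" for x
  have \<sigma>a: "\<sigma> x \<noteq> a" if "x < n" "x \<noteq> a" for x using \<sigma>[of x] a that by metis
  have \<sigma>'2: "\<sigma>' (\<sigma>' x) = x" for x
    using a \<sigma>[of x] \<sigma>a[of x] by (auto simp: \<sigma>'_def)
  have \<sigma>'m: "\<sigma>' x < n + k" if "x < n + k" for x
    using that a \<sigma>[of x] assms(2) by (auto simp: \<sigma>'_def)
  have \<tau>m: "\<tau> x < n + k" if "x < n + k" for x
    using that \<sigma>[of x] \<rho>[of "\<sigma> x"] assms(2) by (auto simp: \<tau>_def)
  have \<tau>old: "(\<tau> ^^ j) x = ((\<rho> \<circ> \<sigma>) ^^ j) x \<and> (\<tau> ^^ j) x < n" if "x < n" for j x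
    by (induction j) (use that \<sigma> \<rho> in \<open>auto simp: \<tau>_def\<close>)
  have \<tau>new: "(\<tau> ^^ j) (n + i) = n + (i + j) mod k" if "i < k" for i j
    by (induction j) (use that in \<open>auto simp: \<tau>_def mod_Suc_eq\<close>)
  have \<tau>q: "(\<tau> ^^ q) x = x" if "x < n + k" for x
  proof (cases "x < n")
    case True
    then show ?thesis using \<tau>old \<sigma> by simp
  next
    case False
    then have "x - n < k" using that by simp
    then have "(\<tau> ^^ q) (n + (x - n)) = n + (x - n + q) mod k" by (rule \<tau>new)
    also have "(x - n + q) mod k = x - n"
      using assms(3) \<open>x - n < k\<close> by (metis dvd_def mod_less mod_mult_self2)
    finally show ?thesis using False by simp
  qed
  have inj_\<tau>: "inj_on \<tau> {..<n + k}"
  \<comment> \<open>As \<tau>^q is the identity, \<tau>^(q-1) is a left inverse.\<close>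
  proof (rule inj_on_inverseI[where g = "\<tau> ^^ (q - 1)"])
    fix x assume x: "x \<in> {..<n + k}"
    show "(\<tau> ^^ (q - 1)) (\<tau> x) = x"
    proof -
      obtain m where "q = Suc m" using q by (cases q) auto
      then show ?thesis using \<tau>q[of x] x by (simp add: funpow_swap1)
    qed
  qed
  have "inj_on \<rho>' {..<n + k}"
  proof (rule inj_onI)
    fix x y assume "x \<in> {..<n + k}" "y \<in> {..<n + k}" "\<rho>' x = \<rho>' y"
    then have "\<sigma>' x = \<sigma>' y"
      using inj_onD[OF inj_\<tau>, of "\<sigma>' x" "\<sigma>' y"] \<sigma>'m[of x] \<sigma>'m[of y] by (simp add: \<rho>'_def)
    then have "\<sigma>' (\<sigma>' x) = \<sigma>' (\<sigma>' y)" by (rule arg_cong)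
    then show "x = y" unfolding \<sigma>'2 .
  qed
  moreover have "\<exists>i. y = (\<rho>' ^^ i) a" if y: "y \<in> {..<n + k}" for y
  proof -
    define R where "R = range (\<lambda>i. (\<rho>' ^^ i) a)"
    have Ra: "a \<in> R" unfolding R_def by (metis funpow_0 rangeI)
    have RS: "\<rho>' x \<in> R" if "x \<in> R" for x
    proof -
      obtain i where "x = (\<rho>' ^^ i) a" using \<open>x \<in> R\<close> unfolding R_def by blast
      then have "\<rho>' x = (\<rho>' ^^ Suc i) a" by simp
      then show ?thesis unfolding R_def by blast
    qed
    \<comment> \<open>The cycle of \<rho>' leaves a for the new points n + 1, ..., n + k - 1, n and
      then resumes the old cycle at \<rho> a; for k = 1 only n is inserted.\<close>
    have \<rho>'a: "\<rho>' a = n + Suc 0 mod k" by (simp add: \<rho>'_def \<sigma>'_def \<tau>_def)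
    have \<rho>'n: "\<rho>' n = \<rho> a" using a by (auto simp: \<rho>'_def \<sigma>'_def \<tau>_def)
    have \<rho>'new: "\<rho>' (n + i) = n + Suc i mod k" if "0 < i" for i
      using that a by (simp add: \<rho>'_def \<sigma>'_def \<tau>_def)
    have \<rho>'old: "\<rho>' x = \<rho> x" if "x < n" "x \<noteq> a" for x
      using that \<sigma>[of x] by (simp add: \<rho>'_def \<sigma>'_def \<tau>_def)
    have new: "n + Suc i mod k \<in> R" if "i < k" for i
      using that
    proof (induction i)
      case 0
      then show ?case using RS[OF Ra] \<rho>'a by simp
    next
      case (Suc i)
      then have "n + Suc i \<in> R" by simp
      then show ?case using RS \<rho>'new[of "Suc i"] by fastforce
    qed
    have nR: "n \<in> R" using new[of "k - 1"] assms(2) by simp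
    have old: "(\<rho> ^^ i) a \<in> R" for i
    proof (induction i)
      case 0
      then show ?case using Ra by simp
    next
      case (Suc i)
      have "(\<rho> ^^ i) a < n" using \<rho>.funpow_mem a by auto
      then show ?case
        using RS[OF Suc] RS[OF nR] \<rho>'n \<rho>'old[of "(\<rho> ^^ i) a"] by (cases "(\<rho> ^^ i) a = a") auto
    qed
    have "y \<in> R"
    proof (cases "y < n")
      case True
      then obtain i where "y = (\<rho> ^^ i) a" using \<rho>.transitive[of a y] a by auto
      then show ?thesis using old by simp
    next
      case False
      show ?thesis
      proof (cases "y = n")
        case True
        then show ?thesis using nR by simp
      next
        case ne: False
        have "n + Suc (y - n - 1) mod k \<in> R" by (rule new) (use y False ne in auto)
        moreover have "n + Suc (y - n - 1) mod k = y" using y False ne by auto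
        ultimately show ?thesis by simp
      qed
    qed
    then show ?thesis by (auto simp: R_def)
  qed
  ultimately have "cyclic_permutation {..<n + k} \<rho>'"
    using a \<tau>m \<sigma>'m by (intro cyclic_permutationI[of _ _ a]) (auto simp: \<rho>'_def)
  moreover have "\<rho>' \<circ> \<sigma>' = \<tau>" using \<sigma>'2 by (auto simp: \<rho>'_def)
  ultimately have "side_pairing q {..<n + k} \<rho>' \<sigma>'"
    using \<sigma>'m \<sigma>'2 \<tau>q by (auto simp: side_pairing_def)
  moreover have "{x. x < n + k \<and> \<sigma>' x = x} = {x. x < n \<and> \<sigma> x = x} - {a} \<union> {n<..<n + k}"
    using a assms(2) by (auto simp: \<sigma>'_def split: if_splits)
  ultimately show ?thesis by blast
qed

text \<open>Fixed points of \<sigma> are the places where a further cycle can be attached. Attaching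
  a k-cycle consumes one and supplies k - 1 new ones.\<close>

lemma side_pairing_extend_card:
  fixes n k q :: nat
  assumes "side_pairing q {..<n} \<rho> \<sigma>" "0 < k" "k dvd q" "0 < q" and c: "0 < card {x. x < n \<and> \<sigma> x = x}"
  shows "\<exists>\<rho>' \<sigma>'. side_pairing q {..<n + k} \<rho>' \<sigma>' \<and>
    card {x. x < n + k \<and> \<sigma>' x = x} = card {x. x < n \<and> \<sigma> x = x} - 1 + (k - 1)"
proof -
  obtain a where a: "a < n" "\<sigma> a = a" using c by (auto simp: card_gt_0_iff)
  obtain \<rho>' \<sigma>' where *: "side_pairing q {..<n + k} \<rho>' \<sigma>'"
    "{x. x < n + k \<and> \<sigma>' x = x} = {x. x < n \<and> \<sigma> x = x} - {a} \<union> {n<..<n + k}"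
    using side_pairing_extend[OF assms(1-4) a] by blast
  have "card {x. x < n + k \<and> \<sigma>' x = x} = card ({x. x < n \<and> \<sigma> x = x} - {a}) + card {n<..<n + k}"
    unfolding *(2) by (rule card_Un_disjoint) auto
  also have "\<dots> = card {x. x < n \<and> \<sigma> x = x} - 1 + (k - 1)"
    using a by simp
  finally show ?thesis using *(1) by blast
qed

lemma side_pairing_mult:
  assumes "side_pairing k L \<rho> \<sigma>" "k dvd q"
  shows "side_pairing q L \<rho> \<sigma>"
proof -
  obtain m where q: "q = m * k" using assms(2) by (metis dvd_def mult.commute)
  have "((\<rho> \<circ> \<sigma>) ^^ (m * k)) x = x" if "x \<in> L" for x
    using that assms(1) by (induction m) (auto simp: side_pairing_def funpow_add)
  then show ?thesis using assms(1) by (auto simp: side_pairing_def q)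
qed

text \<open>With \<open>p = (m + 1) r + l\<close> and \<open>l < r\<close>, the construction uses \<open>m + 1\<close> cycles of length \<open>r\<close>
  and \<open>l\<close> of length 1.\<close>

lemma side_pairing_exists:
  assumes "2 \<le> r" "r \<le> p" "r dvd q" "0 < q"
  shows "\<exists>\<rho> \<sigma>. side_pairing q {..<p::nat} \<rho> \<sigma>"
proof -
  \<comment> \<open>The supply of fixed points never falls below r, since every r-cycle uses one and
    adds r - 1 \<ge> 1.\<close>
  have 1: "\<exists>\<rho> \<sigma>. side_pairing q {..<r + m * r} \<rho> \<sigma> \<and> r \<le> card {x. x < r + m * r \<and> \<sigma> x = x}" for m
  proof (induction m)
    case 0
    have "{x. x < r \<and> id x = x} = {..<r}" by auto
    moreover have "side_pairing q {..<r} (\<lambda>i. Suc i mod r) id"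
      using side_pairing_mult[OF side_pairing_single assms(3)] assms(1) by simp
    ultimately have "side_pairing q {..<r + 0 * r} (\<lambda>i. Suc i mod r) id \<and>
        r \<le> card {x. x < r + 0 * r \<and> id x = x}" by simp
    then show ?case by blast
  next
    case (Suc m)
    then obtain \<rho> \<sigma> where *: "side_pairing q {..<r + m * r} \<rho> \<sigma>"
      "r \<le> card {x. x < r + m * r \<and> \<sigma> x = x}" by blast
    obtain \<rho>' \<sigma>' where "side_pairing q {..<r + m * r + r} \<rho>' \<sigma>'"
      "card {x. x < r + m * r + r \<and> \<sigma>' x = x} = card {x. x < r + m * r \<and> \<sigma> x = x} - 1 + (r - 1)"
      using side_pairing_extend_card[OF *(1) _ assms(3,4)] *(2) assms(1) by fastforce
    then show ?case using *(2) assms(1)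
      by (intro exI[of _ \<rho>'] exI[of _ \<sigma>']) (auto simp: algebra_simps)
  qed
  define m where "m = p div r - 1"
  have "p div r \<ge> 1" using assms by (simp add: div_greater_zero_iff Suc_le_eq)
  then have "r + m * r = (p div r) * r" by (simp add: m_def algebra_simps)
  then have pm: "p = r + m * r + p mod r" by simp
  \<comment> \<open>A 1-cycle uses up one fixed point and adds none, so a supply of r lasts for
    fewer than r of them.\<close>
  have 2: "\<exists>\<rho> \<sigma>. side_pairing q {..<r + m * r + l} \<rho> \<sigma> \<and> r - l \<le> card {x. x < r + m * r + l \<and> \<sigma> x = x}"
    if "l < r" for l
    using that
  proof (induction l)
    case 0
    then show ?case using 1 by simp
  next
    case (Suc l)
    then obtain \<rho> \<sigma> where *: "side_pairing q {..<r + m * r + l} \<rho> \<sigma>"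
      "r - l \<le> card {x. x < r + m * r + l \<and> \<sigma> x = x}" by auto
    obtain \<rho>' \<sigma>' where "side_pairing q {..<r + m * r + l + 1} \<rho>' \<sigma>'"
      "card {x. x < r + m * r + l + 1 \<and> \<sigma>' x = x} = card {x. x < r + m * r + l \<and> \<sigma> x = x} - 1 + (1 - 1)"
      using side_pairing_extend_card[OF *(1), of 1] assms(4) *(2) Suc.prems by fastforce
    then show ?case using *(2) by (intro exI[of _ \<rho>'] exI[of _ \<sigma>']) auto
  qed
  then show ?thesis using pm assms(1) by (metis mod_less_divisor less_le_trans zero_less_numeral)
qed

section \<open>Local systems on the plane\<close>

text \<open>The stalk at \<open>x\<close> is the set \<open>A x\<close> of functions on \<open>Dm x\<close>; the transport maps from \<open>x\<close>
  to nearby points are restrictions.\<close>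

locale local_system =
  fixes Dm :: "complex \<Rightarrow> 'd set" and A :: "complex \<Rightarrow> ('d \<Rightarrow> 'l) set"
  assumes local: "\<exists>U. open U \<and> x \<in> U \<and>
    (\<forall>y\<in>U. Dm y \<subseteq> Dm x \<and> bij_betw (\<lambda>e. restrict e (Dm y)) (A x) (A y))"
begin

definition flat_section :: "complex set \<Rightarrow> (complex \<Rightarrow> 'd \<Rightarrow> 'l) \<Rightarrow> bool" where
  "flat_section K s \<longleftrightarrow> (\<forall>x\<in>K. s x \<in> A x \<and>
     (\<exists>U. open U \<and> x \<in> U \<and> (\<forall>y\<in>U \<inter> K. s y = restrict (s x) (Dm y))))"

text \<open>Only existence of extensions is demanded; on connected sets uniqueness is automatic by
  \<open>flat_section_unique\<close>.\<close>

definition trivial_on :: "complex set \<Rightarrow> bool" where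
  "trivial_on K \<longleftrightarrow> (\<forall>x\<in>K. \<forall>e\<in>A x. \<exists>s. flat_section K s \<and> s x = e)"

lemma flat_sectionD:
  assumes "flat_section K s" "x \<in> K"
  shows "s x \<in> A x" "\<exists>U. open U \<and> x \<in> U \<and> (\<forall>y\<in>U \<inter> K. s y = restrict (s x) (Dm y))"
  using assms by (auto simp: flat_section_def)

lemma flat_section_subset: "flat_section K s \<Longrightarrow> K' \<subseteq> K \<Longrightarrow> flat_section K' s"
  unfolding flat_section_def by (meson Int_iff subsetD)

text \<open>Restriction to a nearby stalk is injective, so agreement of two sections at a point is
  equivalent to agreement nearby. Hence agreement is locally constant.\<close>

lemma flat_section_unique:
  assumes "connected K" and s: "flat_section K s" and t: "flat_section K t"
    and "x \<in> K" "s x = t x" "y \<in> K"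
  shows "s y = t y"
proof -
  have nbh: "\<exists>U. open U \<and> x \<in> U \<and> (\<forall>y\<in>U \<inter> K. s y = t y \<longleftrightarrow> s x = t x)" if x: "x \<in> K" for x
  proof -
    obtain U where U: "open U" "x \<in> U" "\<And>y. y \<in> U \<inter> K \<Longrightarrow> s y = restrict (s x) (Dm y)"
      using flat_sectionD(2)[OF s x] by blast
    obtain V where V: "open V" "x \<in> V" "\<And>y. y \<in> V \<inter> K \<Longrightarrow> t y = restrict (t x) (Dm y)"
      using flat_sectionD(2)[OF t x] by blast
    obtain W where W: "open W" "x \<in> W" "\<And>y. y \<in> W \<Longrightarrow> inj_on (\<lambda>e. restrict e (Dm y)) (A x)"
      using local[of x] unfolding bij_betw_def by blast
    have "s y = t y \<longleftrightarrow> s x = t x" if y: "y \<in> (U \<inter> V \<inter> W) \<inter> K" for y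
      using U(3)[of y] V(3)[of y] y
        inj_on_eq_iff[OF W(3) flat_sectionD(1)[OF s x] flat_sectionD(1)[OF t x], of y]
      by simp
    then show ?thesis using U V W by (intro exI[of _ "U \<inter> V \<inter> W"]) auto
  qed
  have "(\<lambda>y. s y = t y) constant_on K"
  proof (rule locally_constant_imp_constant[OF assms(1)])
    fix a assume a: "a \<in> K"
    obtain U where U: "open U" "a \<in> U" "\<forall>y\<in>U \<inter> K. s y = t y \<longleftrightarrow> s a = t a"
      using nbh[OF a] by blast
    show "\<exists>T. openin (top_of_set K) T \<and> a \<in> T \<and> (\<forall>y\<in>T. (s y = t y) = (s a = t a))"
    proof (intro exI conjI)
      show "openin (top_of_set K) (K \<inter> U)" using U(1) by (rule openin_open_Int)
    qed (use U a in blast)+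
  qed
  then obtain c where c: "\<And>y. y \<in> K \<Longrightarrow> (s y = t y) = c" unfolding constant_on_def by blast
  show ?thesis using c[OF assms(4)] c[OF assms(6)] assms(5) by blast
qed

text \<open>A section over one set is continued into the other from a common point. Connectedness of
  the intersection makes both agree on all of it, and closedness keeps either set away from the
  points outside it, so the glued section is flat.\<close>

lemma trivial_on_Un:
  assumes triv: "trivial_on K" "trivial_on L" and cl: "closed K" "closed L"
    and conn: "connected K" "connected L" "connected (K \<inter> L)" "K \<inter> L \<noteq> {}"
  shows "trivial_on (K \<union> L)"
proof -
  have main: "\<exists>s. flat_section (K \<union> L) s \<and> s x = e"
    if triv: "trivial_on K" "trivial_on L" and cl: "closed K" "closed L"
      and conn: "connected (K \<inter> L)" "K \<inter> L \<noteq> {}" and x: "x \<in> K" "e \<in> A x" for K L x e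
  proof -
    obtain s where s: "flat_section K s" "s x = e" using triv(1) x unfolding trivial_on_def by blast
    obtain z where z: "z \<in> K" "z \<in> L" using conn by blast
    obtain t where t: "flat_section L t" "t z = s z"
      using triv(2) z flat_sectionD(1)[OF s(1) z(1)] unfolding trivial_on_def by blast
    have st: "s y = t y" if "y \<in> K" "y \<in> L" for y
      by (rule flat_section_unique[OF conn(1), of s t z])
        (use s t z that in \<open>auto intro: flat_section_subset\<close>)
    define u where "u y = (if y \<in> K then s y else t y)" for y
    have ut: "u y = t y" if "y \<in> L" for y using that st by (simp add: u_def)
    have us: "u y = s y" if "y \<in> K" for y using that by (simp add: u_def)
    have "flat_section (K \<union> L) u"
      unfolding flat_section_def
    proof
      fix y assume y: "y \<in> K \<union> L"
      have K: "\<exists>U. open U \<and> y \<in> U \<and> (\<forall>w\<in>U \<inter> K. u w = restrict (u y) (Dm w))"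
      proof (cases "y \<in> K")
        case True
        then show ?thesis using flat_sectionD(2)[OF s(1) True] us by auto
      next
        case False
        then show ?thesis using cl by (intro exI[of _ "- K"]) auto
      qed
      have L: "\<exists>U. open U \<and> y \<in> U \<and> (\<forall>w\<in>U \<inter> L. u w = restrict (u y) (Dm w))"
      proof (cases "y \<in> L")
        case True
        then show ?thesis using flat_sectionD(2)[OF t(1) True] ut by auto
      next
        case False
        then show ?thesis using cl by (intro exI[of _ "- L"]) auto
      qed
      from K L obtain U V where "open U" "y \<in> U" "open V" "y \<in> V"
        "\<forall>w\<in>U \<inter> K. u w = restrict (u y) (Dm w)" "\<forall>w\<in>V \<inter> L. u w = restrict (u y) (Dm w)" by blast
      then have "\<exists>U. open U \<and> y \<in> U \<and> (\<forall>w\<in>U \<inter> (K \<union> L). u w = restrict (u y) (Dm w))"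
        by (intro exI[of _ "U \<inter> V"]) auto
      moreover have "u y \<in> A y"
        using y flat_sectionD(1)[OF s(1)] flat_sectionD(1)[OF t(1)] us ut by auto
      ultimately show "u y \<in> A y \<and>
        (\<exists>U. open U \<and> y \<in> U \<and> (\<forall>w\<in>U \<inter> (K \<union> L). u w = restrict (u y) (Dm w)))" by blast
    qed
    then show ?thesis using us[OF x(1)] s(2) by blast
  qed
  show ?thesis
    unfolding trivial_on_def
  proof (intro ballI)
    fix x e assume x: "x \<in> K \<union> L" and e: "e \<in> A x"
    show "\<exists>s. flat_section (K \<union> L) s \<and> s x = e"
    proof (cases "x \<in> K")
      case True
      then show ?thesis using main[OF triv cl conn(3,4) True e] by blast
    next
      case False
      then have "x \<in> L" using x by blast
      then show ?thesis
        using main[OF triv(2,1) cl(2,1) _ _ _ e] conn by (simp add: Int_commute Un_commute)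
    qed
  qed
qed

text \<open>Near x every stalk is a restriction of the stalk at x, so each germ comes from a germ at
  x, whose restrictions form the section.\<close>

lemma trivial_on_small: "\<exists>U. open U \<and> x \<in> U \<and> (\<forall>K\<subseteq>U. trivial_on K)"
proof -
  obtain U where U: "open U" "x \<in> U" "\<And>y. y \<in> U \<Longrightarrow> Dm y \<subseteq> Dm x"
     "\<And>y. y \<in> U \<Longrightarrow> bij_betw (\<lambda>e. restrict e (Dm y)) (A x) (A y)"
    using local[of x] by blast
  have "trivial_on K" if K: "K \<subseteq> U" for K
    unfolding trivial_on_def
  proof (intro ballI)
    fix y e assume y: "y \<in> K" "e \<in> A y"
    then obtain e0 where e0: "e0 \<in> A x" "e = restrict e0 (Dm y)"
      using U(4)[of y] K unfolding bij_betw_def by blast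
    have "flat_section K (\<lambda>z. restrict e0 (Dm z))"
      unfolding flat_section_def
    proof (intro ballI conjI)
      fix z assume z: "z \<in> K"
      show "restrict e0 (Dm z) \<in> A z"
        using U(4)[of z] e0(1) z K unfolding bij_betw_def by blast
      obtain V where "open V" "z \<in> V" "\<And>w. w \<in> V \<Longrightarrow> Dm w \<subseteq> Dm z"
        using local[of z] by blast
      then show "\<exists>V. open V \<and> z \<in> V \<and> (\<forall>w\<in>V \<inter> K. restrict e0 (Dm w) = restrict (restrict e0 (Dm z)) (Dm w))"
        by (intro exI[of _ V]) (auto simp: Int_absorb1 restrict_restrict)
    qed
    then show "\<exists>s. flat_section K s \<and> s y = e" using e0(2) by blast
  qed
  then show ?thesis using U by blast
qed

text \<open>Two nested bisections take the place of path lifting: small boxes are stacked into thin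
  vertical strips, and strips are joined side by side. Neighbouring rectangles meet in a common
  edge, which is connected and nonempty.\<close>

lemma trivial_on_rectangle:
  assumes "a \<le> b" "c \<le> d"
  shows "trivial_on (cbox (Complex a c) (Complex b d))"
proof -
  have box: "cbox (Complex a c) (Complex b d) = {z. a \<le> Re z \<and> Re z \<le> b \<and> c \<le> Im z \<and> Im z \<le> d}" for a b c d
    by (auto simp: in_cbox_complex_iff)
  have ne: "cbox (Complex a c) (Complex b d) \<noteq> {}" if "a \<le> b" "c \<le> d" for a b c d
    using that by (auto simp: box intro!: exI[of _ "Complex a c"])
  define P where "P a b c d = trivial_on (cbox (Complex a c) (Complex b d))" for a b c d
  have joinI: "P a b c e" if "P a b c d" "P a b d e" "a \<le> b" "c \<le> d" "d \<le> e" for a b c d e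
  proof -
    have "cbox (Complex a c) (Complex b d) \<union> cbox (Complex a d) (Complex b e) = cbox (Complex a c) (Complex b e)"
      using that by (auto simp: box)
    moreover have i: "cbox (Complex a c) (Complex b d) \<inter> cbox (Complex a d) (Complex b e) = cbox (Complex a d) (Complex b d)"
      using that by (auto simp: box)
    ultimately show ?thesis
      using trivial_on_Un[of "cbox (Complex a c) (Complex b d)" "cbox (Complex a d) (Complex b e)"] that ne[of a b d d]
      unfolding P_def i by (simp add: convex_connected closed_cbox)
  qed
  have joinR: "P a e c d" if "P a b c d" "P b e c d" "a \<le> b" "b \<le> e" "c \<le> d" for a b c d e
  proof -
    have "cbox (Complex a c) (Complex b d) \<union> cbox (Complex b c) (Complex e d) = cbox (Complex a c) (Complex e d)"
      using that by (auto simp: box)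
    moreover have i: "cbox (Complex a c) (Complex b d) \<inter> cbox (Complex b c) (Complex e d) = cbox (Complex b c) (Complex b d)"
      using that by (auto simp: box)
    ultimately show ?thesis
      using trivial_on_Un[of "cbox (Complex a c) (Complex b d)" "cbox (Complex b c) (Complex e d)"] that ne[of b b c d]
      unfolding P_def i by (simp add: convex_connected closed_cbox)
  qed
  \<comment> \<open>The width \<open>\<delta>\<close> may depend on x; stacking takes the minimum of
    two widths.\<close>
  have strip: "\<exists>\<delta>>0. \<forall>a b. a \<le> x \<and> x \<le> b \<and> b - a < \<delta> \<longrightarrow> P a b c d" for x
    using assms(2)
  proof (induction c d rule: Bolzano)
    case (trans c d e)
    obtain \<delta> where \<delta>: "\<delta> > 0" "\<And>a b. a \<le> x \<Longrightarrow> x \<le> b \<Longrightarrow> b - a < \<delta> \<Longrightarrow> P a b c d" using trans(1) by blast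
    obtain \<epsilon> where \<epsilon>: "\<epsilon> > 0" "\<And>a b. a \<le> x \<Longrightarrow> x \<le> b \<Longrightarrow> b - a < \<epsilon> \<Longrightarrow> P a b d e" using trans(2) by blast
    show ?case
    proof (intro exI[of _ "min \<delta> \<epsilon>"] conjI allI impI)
      fix a b assume "a \<le> x \<and> x \<le> b \<and> b - a < min \<delta> \<epsilon>"
      then show "P a b c e" using \<delta>(2) \<epsilon>(2) trans(3,4) by (intro joinI[of a b c d e]) auto
    qed (use \<delta> \<epsilon> in auto)
  next
    case (local y)
    obtain U where U: "open U" "Complex x y \<in> U" "\<And>K. K \<subseteq> U \<Longrightarrow> trivial_on K"
      using trivial_on_small by blast
    obtain e where e: "e > 0" "ball (Complex x y) e \<subseteq> U"
      using U(1,2) open_contains_ball by blast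
    \<comment> \<open>Sides below e / 2 suffice because the modulus is at most the sum of the
      coordinate moduli.\<close>
    have sub: "P a b c d" if "a \<le> x" "x \<le> b" "b - a < e / 2" "c \<le> y" "y \<le> d" "d - c < e / 2" for a b c d
      unfolding P_def
    proof (rule U(3), rule subset_trans[OF _ e(2)])
      show "cbox (Complex a c) (Complex b d) \<subseteq> ball (Complex x y) e"
      proof
        fix z assume "z \<in> cbox (Complex a c) (Complex b d)"
        then have z: "a \<le> Re z" "Re z \<le> b" "c \<le> Im z" "Im z \<le> d" by (auto simp: box)
        have "cmod (Complex x y - z) \<le> \<bar>Re (Complex x y - z)\<bar> + \<bar>Im (Complex x y - z)\<bar>"
          by (rule cmod_le)
        also have "\<dots> < e" using z that by auto
        finally show "z \<in> ball (Complex x y) e" by (simp add: dist_norm)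
      qed
    qed
    show ?case
    proof (rule exI[of _ "e / 2"], intro conjI allI impI)
      fix c d assume cd: "c \<le> y \<and> y \<le> d \<and> d - c < e / 2"
      show "\<exists>\<delta>>0. \<forall>a b. a \<le> x \<and> x \<le> b \<and> b - a < \<delta> \<longrightarrow> P a b c d"
        by (rule exI[of _ "e / 2"]) (use e(1) sub cd in simp)
    qed (use e in simp)
  qed
  have "P a b c d"
    using assms(1)
  proof (induction a b rule: Bolzano)
    case (trans a b e)
    then show ?case by (rule joinR[OF _ _ _ _ assms(2)])
  next
    case (local x)
    show ?case by (rule strip)
  qed
  then show ?thesis by (simp add: P_def)
qed

text \<open>The plane is exhausted by squares around 0. The sections with value e at 0 agree on
  smaller squares by uniqueness, so they fit together.\<close>

lemma global_flat_section:
  assumes "e \<in> A 0"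
  shows "\<exists>s. flat_section UNIV s \<and> s 0 = e"
proof -
  define Q where "Q n = cbox (Complex (- real n) (- real n)) (Complex (real n) (real n))" for n :: nat
  have Q: "z \<in> Q n \<longleftrightarrow> \<bar>Re z\<bar> \<le> real n \<and> \<bar>Im z\<bar> \<le> real n" for z n
    by (auto simp: Q_def in_cbox_complex_iff)
  have conn: "connected (Q n)" for n by (simp add: Q_def convex_connected)
  have "\<exists>s. flat_section (Q n) s \<and> s 0 = e" for n
    using trivial_on_rectangle[of "- real n" "real n" "- real n" "real n"] assms Q[of 0 n]
    unfolding trivial_on_def Q_def by simp
  then obtain s where s: "\<And>n. flat_section (Q n) (s n)" "\<And>n. s n 0 = e" by metis
  have le: "s m z = s n z" if "z \<in> Q m" "m \<le> n" for m n z
  proof (rule flat_section_unique[OF conn s(1), where x = 0])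
    have "Q m \<subseteq> Q n" using that(2) by (auto simp: Q)
    then show "flat_section (Q m) (s n)" using s(1) flat_section_subset by blast
  qed (use that in \<open>auto simp: Q s\<close>)
  have agree: "s m z = s n z" if "z \<in> Q m" "z \<in> Q n" for m n z
    using le[OF that(1), of n] le[OF that(2), of m] nat_le_linear[of m n] by argo
  define N where "N z = nat \<lceil>\<bar>Re z\<bar> + \<bar>Im z\<bar>\<rceil>" for z
  have N: "z \<in> Q (N z)" for z
  proof -
    have "\<bar>Re z\<bar> + \<bar>Im z\<bar> \<le> real (N z)" by (simp add: N_def)
    then show ?thesis by (auto simp: Q)
  qed
  define t where "t z = s (N z) z" for z
  have t: "t z = s n z" if "z \<in> Q n" for z n
    using agree[OF N that] by (simp add: t_def)
  have "flat_section UNIV t"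
    unfolding flat_section_def
  proof
    fix z :: complex
    \<comment> \<open>One square larger than the one containing z, so that the unit ball about z
      lies inside it.\<close>
    let ?n = "Suc (N z)"
    have b: "w \<in> Q ?n" if "w \<in> ball z 1" for w
    proof -
      have "\<bar>Re z - Re w\<bar> < 1" "\<bar>Im z - Im w\<bar> < 1"
        using that abs_Re_le_cmod[of "z - w"] abs_Im_le_cmod[of "z - w"]
        by (simp_all add: dist_norm)
      moreover have "\<bar>Re z\<bar> \<le> real (N z)" "\<bar>Im z\<bar> \<le> real (N z)" using N[of z] by (simp_all add: Q)
      ultimately have "\<bar>Re w\<bar> \<le> real ?n" "\<bar>Im w\<bar> \<le> real ?n" unfolding of_nat_Suc by linarith+
      then show ?thesis unfolding Q by blast
    qed
    then have z: "z \<in> Q ?n" by simp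
    obtain U where U: "open U" "z \<in> U" "\<And>w. w \<in> U \<inter> Q ?n \<Longrightarrow> s ?n w = restrict (s ?n z) (Dm w)"
      using flat_sectionD(2)[OF s(1) z] by blast
    have coh: "\<forall>w\<in>(U \<inter> ball z 1) \<inter> UNIV. t w = restrict (t z) (Dm w)"
    proof
      fix w assume w: "w \<in> (U \<inter> ball z 1) \<inter> UNIV"
      then have "w \<in> Q ?n" using b by blast
      then show "t w = restrict (t z) (Dm w)" using U(3)[of w] w t[of w ?n] t[OF z] by simp
    qed
    have "t z \<in> A z" using flat_sectionD(1)[OF s(1) z] t[OF z] by simp
    then show "t z \<in> A z \<and> (\<exists>U. open U \<and> z \<in> U \<and> (\<forall>w\<in>U \<inter> UNIV. t w = restrict (t z) (Dm w)))"
    proof (rule conjI)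
      have "open (U \<inter> ball z 1)" using U(1) by (simp add: open_Int)
      moreover have "z \<in> U \<inter> ball z 1" using U(2) by simp
      ultimately show "\<exists>U. open U \<and> z \<in> U \<and> (\<forall>w\<in>U \<inter> UNIV. t w = restrict (t z) (Dm w))"
        using coh by blast
    qed
  qed
  moreover have "t 0 = e" using t[of 0 0] s(2) by (simp add: Q)
  ultimately show ?thesis by blast
qed

end

section \<open>Darts of a tessellation\<close>

definition shift :: "(nat \<Rightarrow> 'a) \<Rightarrow> nat \<Rightarrow> 'a" where
  "shift v = (\<lambda>k. v (Suc k))"

lemma shift_funpow: "(shift ^^ m) v = (\<lambda>k. v (k + m))"
  by (induction m) (auto simp: shift_def)

lemma shift_comp: "shift (h \<circ> v) = h \<circ> shift v"
  by (auto simp: shift_def)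

lemma shift_0 [simp]: "shift v 0 = v (Suc 0)" and shift_1 [simp]: "shift v (Suc 0) = v (Suc (Suc 0))"
  by (simp_all add: shift_def)

lemma connected_hyperbolic_plane: "connected (UNIV :: hyperbolic_plane set)"
proof -
  have "UNIV = klein_inv ` ball 0 1"
    using klein_in_ball klein_inv_klein by (metis UNIV_eq_I imageI)
  then show ?thesis
    using connected_continuous_image[OF continuous_klein_inv] by (simp add: convex_connected)
qed

lemma hyp_segment_inner_point:
  assumes "x \<noteq> y"
  shows "\<exists>z. z \<in> hyp_segment x y \<and> z \<noteq> x \<and> z \<noteq> y"
proof -
  let ?m = "midpoint (klein x) (klein y)"
  have "?m \<in> klein ` hyp_segment x y" unfolding klein_segment by simp
  then obtain z where z: "z \<in> hyp_segment x y" "klein z = ?m" by (metis imageE)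
  have "klein x \<noteq> klein y" using klein_inj assms by blast
  then have "?m \<noteq> klein x" "?m \<noteq> klein y" by (simp_all add: midpoint_eq_endpoint)
  then show ?thesis using z by metis
qed

text \<open>A dart, i.e. a tile with a distinguished side traversed counterclockwise, is represented by
  the enumeration of the vertices of the tile that starts with this side.\<close>

locale tessellation =
  fixes p q :: nat and T :: "hyperbolic_plane set set"
  assumes p3: "3 \<le> p" and q3: "3 \<le> q" and tess: "tessellation_of_type p q T"
begin

definition darts :: "(nat \<Rightarrow> hyperbolic_plane) set" where
  "darts = {v. ccw_vertices p v \<and> polygon v \<in> T}"

text \<open>The neighbour across the first side sees this side reversed, as both tiles are traversed
  counterclockwise. The description makes sense by \<open>flip_exists\<close> and
  \<open>dart_unique\<close>.\<close>

definition flip :: "(nat \<Rightarrow> hyperbolic_plane) \<Rightarrow> nat \<Rightarrow> hyperbolic_plane" where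
  "flip v = (THE w. w \<in> darts \<and> w 0 = v 1 \<and> w 1 = v 0)"

text \<open>The side of the neighbour that follows the common one starts at \<open>v 0\<close>
  again, so this is one step of rotation about \<open>v 0\<close>.\<close>

definition turn :: "(nat \<Rightarrow> hyperbolic_plane) \<Rightarrow> nat \<Rightarrow> hyperbolic_plane" where
  "turn v = shift (flip v)"

definition darts_from :: "hyperbolic_plane \<Rightarrow> (nat \<Rightarrow> hyperbolic_plane) set" where
  "darts_from x = {v \<in> darts. v 0 = x}"

text \<open>Here x may be any point of the tile, not only a vertex; these sets index the stalks of
  the local system.\<close>

definition darts_at :: "hyperbolic_plane \<Rightarrow> (nat \<Rightarrow> hyperbolic_plane) set" where
  "darts_at x = {v \<in> darts. x \<in> polygon v}"

section \<open>Vertices, sides and neighbours in terms of darts\<close>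

lemma p_pos: "0 < p" "2 \<le> p"
  using p3 by auto

lemma dartD: "v \<in> darts \<Longrightarrow> ccw_vertices p v" "v \<in> darts \<Longrightarrow> polygon v \<in> T"
  by (auto simp: darts_def)

lemma dart_eq_iff: "v \<in> darts \<Longrightarrow> v i = v j \<longleftrightarrow> i mod p = j mod p"
  using ccw_eq_iff dartD p_pos by blast

lemma dart_neq: "v \<in> darts \<Longrightarrow> v 0 \<noteq> v 1"
  using dart_eq_iff[of v 0 1] p3 by simp

lemma dart_unique: "v \<in> darts \<Longrightarrow> w \<in> darts \<Longrightarrow> v 0 = w 0 \<Longrightarrow> v 1 = w 1 \<Longrightarrow> v = w"
  using ccw_unique dartD p_pos by blast

lemmas tess_conjuncts = tess[unfolded tessellation_of_type_def]

lemma tess_regular: "F \<in> T \<Longrightarrow> regular_polygon p F"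
  by (rule tess_conjuncts[THEN conjunct1, rule_format])

lemma tess_cover: "\<Union>T = UNIV"
  by (rule tess_conjuncts[THEN conjunct2, THEN conjunct2, THEN conjunct1])

lemma tess_locally_finite: "locally_finite_in euclidean T"
  by (rule tess_conjuncts[THEN conjunct2, THEN conjunct2, THEN conjunct2, THEN conjunct1])

lemma tess_meet: "F \<in> T \<Longrightarrow> F' \<in> T \<Longrightarrow> F \<noteq> F' \<Longrightarrow> F \<inter> F' = {} \<or>
        (\<exists>x. F \<inter> F' = {x} \<and> is_vertex_of p x F \<and> is_vertex_of p x F') \<or>
        (is_side_of p (F \<inter> F') F \<and> is_side_of p (F \<inter> F') F')"
  by (rule tess_conjuncts[THEN conjunct2, THEN conjunct2, THEN conjunct2, THEN conjunct2,
        THEN conjunct2, THEN conjunct1, rule_format])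

lemma tess_card: "F \<in> T \<Longrightarrow> is_vertex_of p x F \<Longrightarrow> card {F'\<in>T. x \<in> F'} = q"
  by (rule tess_conjuncts[THEN conjunct2, THEN conjunct2, THEN conjunct2, THEN conjunct2,
        THEN conjunct2, THEN conjunct2, rule_format])

lemma tile_dart:
  assumes "F \<in> T"
  shows "\<exists>v\<in>darts. polygon v = F"
proof -
  obtain v where "regular_polygon_with p v F"
    using tess_regular[OF assms] unfolding regular_polygon_def by blast
  then obtain w where "ccw_vertices p w" "F = polygon w"
    using regular_polygon_with_cases p_pos by blast
  then show ?thesis using assms by (auto simp: darts_def)
qed

lemma shift_funpow_dart:
  assumes "v \<in> darts"
  shows "(shift ^^ m) v \<in> darts" "polygon ((shift ^^ m) v) = polygon v"
  using assms ccw_shift polygon_shift p_pos by (auto simp: darts_def shift_funpow)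

lemma shift_dart:
  assumes "v \<in> darts"
  shows "shift v \<in> darts" "polygon (shift v) = polygon v"
  using shift_funpow_dart[OF assms, of 1] by auto

lemma shift_period: "v \<in> darts \<Longrightarrow> (shift ^^ m) v = (shift ^^ (m mod p)) v"
  unfolding shift_funpow using dart_eq_iff[of v] by (auto simp: mod_add_right_eq)

lemma same_tile:
  assumes "v \<in> darts" "w \<in> darts" "polygon v = polygon w"
  shows "\<exists>m<p. w = (shift ^^ m) v"
  using polygon_determines_vertices[OF dartD(1)[OF assms(1)] dartD(1)[OF assms(2)] p_pos(2) assms(3)]
  by (simp add: shift_funpow)

lemma same_tile_same_origin:
  assumes "v \<in> darts" "w \<in> darts" "polygon v = polygon w" "v 0 = w 0"
  shows "v = w"
proof -
  obtain m where m: "m < p" "w = (shift ^^ m) v" using same_tile[OF assms(1-3)] by blast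
  have "v m = v 0" using assms(4) m(2) by (simp add: shift_funpow)
  then have "m = 0" using dart_eq_iff[OF assms(1)] m(1) by simp
  then show ?thesis using m(2) by simp
qed

text \<open>\<open>is_vertex_of\<close> refers to an arbitrary enumeration of the tile. As the tile
  determines its vertices, that enumeration is a shift of v or the reversal of one.\<close>

lemma vertex_dart:
  assumes "v \<in> darts" "is_vertex_of p x (polygon v)"
  shows "\<exists>m. ((shift ^^ m) v) 0 = x"
proof -
  obtain u k where u: "regular_polygon_with p u (polygon v)" "x = u k"
    using assms(2) unfolding is_vertex_of_def by blast
  obtain w where w: "ccw_vertices p w" "polygon v = polygon w" "u = w \<or> u = (\<lambda>k. w ((p - 1) * k))"
    using regular_polygon_with_cases[OF u(1) p_pos(1)] by blast
  have "w \<in> darts" using w dartD(2)[OF assms(1)] by (auto simp: darts_def)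
  then obtain m where "w = (shift ^^ m) v" using same_tile[OF assms(1) _ w(2)] by blast
  then show ?thesis using w(3) u(2) by (auto simp: shift_funpow)
qed

lemma is_vertex_of_dart:
  assumes "v \<in> darts"
  shows "is_vertex_of p (v k) (polygon v)"
proof -
  have "v k = v (k mod p)" using dart_eq_iff[OF assms] by simp
  then show ?thesis
    unfolding is_vertex_of_def
    using regular_polygon_with_ccw[OF dartD(1)[OF assms] p_pos(1)] p_pos(1) mod_less_divisor by metis
qed

lemma side_dart:
  assumes "v \<in> darts" "is_side_of p s (polygon v)"
  shows "\<exists>m. s = hyp_segment (((shift ^^ m) v) 0) (((shift ^^ m) v) 1)"
proof -
  obtain u k where u: "regular_polygon_with p u (polygon v)" "s = hyp_segment (u k) (u (Suc k))"
    using assms(2) unfolding is_side_of_def by blast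
  obtain w where w: "ccw_vertices p w" "polygon v = polygon w" "u = w \<or> u = (\<lambda>k. w ((p - 1) * k))"
    using regular_polygon_with_cases[OF u(1) p_pos(1)] by blast
  have wd: "w \<in> darts" using w dartD(2)[OF assms(1)] by (auto simp: darts_def)
  then obtain m where m: "w = (shift ^^ m) v" using same_tile[OF assms(1) _ w(2)] by blast
  have "\<exists>j. s = hyp_segment (w j) (w (Suc j))"
    using w(3)
  proof
    assume "u = w"
    then show ?thesis using u(2) by blast
  next
    assume uw: "u = (\<lambda>k. w ((p - 1) * k))"
    \<comment> \<open>Side k of the reversed enumeration joins -k to -(k + 1), so it is the side of
      w that starts at index -(k + 1).\<close>
    have "Suc ((p - 1) * Suc k) = (p - 1) * k + p" using p_pos by simp
    then have "w (Suc ((p - 1) * Suc k)) = w ((p - 1) * k)" using dart_eq_iff[OF wd] by simp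
    then have "s = hyp_segment (w ((p - 1) * Suc k)) (w (Suc ((p - 1) * Suc k)))"
      using u(2) uw by (simp add: hyp_segment_commute)
    then show ?thesis by blast
  qed
  then obtain j where "s = hyp_segment (w j) (w (Suc j))" by blast
  then have "s = hyp_segment (((shift ^^ (j + m)) v) 0) (((shift ^^ (j + m)) v) 1)"
    by (simp add: m shift_funpow)
  then show ?thesis by blast
qed

text \<open>A common side has the same two ends in both tiles. If both traversed it in the same
  direction, \<open>dart_unique\<close> would make the tiles equal, so the directions are
  opposite.\<close>

lemma tiles_meet:
  assumes "v \<in> darts" "w \<in> darts" "polygon v \<noteq> polygon w" "x \<in> polygon v" "x \<in> polygon w"
  shows "(\<exists>m j. ((shift ^^ m) v) 0 = x \<and> ((shift ^^ j) w) 0 = x) \<or>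
    (\<exists>m j. ((shift ^^ j) w) 0 = ((shift ^^ m) v) 1 \<and> ((shift ^^ j) w) 1 = ((shift ^^ m) v) 0 \<and>
      polygon v \<inter> polygon w = hyp_segment (((shift ^^ m) v) 0) (((shift ^^ m) v) 1))"
proof -
  from tess_meet[OF dartD(2)[OF assms(1)] dartD(2)[OF assms(2)] assms(3)]
  consider y where "polygon v \<inter> polygon w = {y}" "is_vertex_of p y (polygon v)" "is_vertex_of p y (polygon w)"
    | "is_side_of p (polygon v \<inter> polygon w) (polygon v)" "is_side_of p (polygon v \<inter> polygon w) (polygon w)"
    using assms(4,5) by blast
  then show ?thesis
  proof cases
    case 1
    then have y: "is_vertex_of p x (polygon v)" "is_vertex_of p x (polygon w)" using assms(4,5) by auto
    obtain m j where "((shift ^^ m) v) 0 = x" "((shift ^^ j) w) 0 = x"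
      using vertex_dart[OF assms(1) y(1)] vertex_dart[OF assms(2) y(2)] by blast
    then show ?thesis by blast
  next
    case 2
    obtain m where m: "polygon v \<inter> polygon w = hyp_segment (((shift ^^ m) v) 0) (((shift ^^ m) v) 1)"
      using side_dart[OF assms(1) 2(1)] by blast
    obtain j where j: "polygon v \<inter> polygon w = hyp_segment (((shift ^^ j) w) 0) (((shift ^^ j) w) 1)"
      using side_dart[OF assms(2) 2(2)] by blast
    have "{((shift ^^ m) v) 0, ((shift ^^ m) v) 1} = {((shift ^^ j) w) 0, ((shift ^^ j) w) 1}"
      using m j hyp_segment_eq_iff by metis
    moreover have "\<not> (((shift ^^ m) v) 0 = ((shift ^^ j) w) 0 \<and> ((shift ^^ m) v) 1 = ((shift ^^ j) w) 1)"
      using dart_unique[OF shift_funpow_dart(1)[OF assms(1)] shift_funpow_dart(1)[OF assms(2)]]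
        shift_funpow_dart(2) assms by metis
    ultimately have "((shift ^^ j) w) 0 = ((shift ^^ m) v) 1 \<and> ((shift ^^ j) w) 1 = ((shift ^^ m) v) 0"
      by (auto simp: doubleton_eq_iff)
    then show ?thesis using m by blast
  qed
qed

lemma tile_closed:
  assumes "F \<in> T"
  shows "closed F"
proof -
  obtain v where "v \<in> darts" "polygon v = F" using tile_dart[OF assms] by blast
  then show ?thesis using polygon_closed[OF dartD(1) p_pos(1)] by blast
qed

lemma tiles_closed: "S \<subseteq> T \<Longrightarrow> closed (\<Union>S)"
  using closedin_locally_finite_Union[of S euclidean] tile_closed
    locally_finite_in_subset[OF tess_locally_finite, of S] by auto

lemma point_dart: "\<exists>v\<in>darts. x \<in> polygon v"
  using tess_cover tile_dart by (metis UNIV_I Union_iff)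

lemma vertex_on_side_dart:
  assumes "v \<in> darts" "v k \<in> hyp_segment (v 0) (v 1)"
  shows "v k = v 0 \<or> v k = v 1"
proof -
  have "k mod p = 0 \<or> k mod p = 1" using vertex_on_side[OF dartD(1)[OF assms(1)] p3 assms(2)] .
  then have "k mod p = 0 mod p \<or> k mod p = 1 mod p" using p3 by simp
  then show ?thesis using dart_eq_iff[OF assms(1)] by blast
qed

text \<open>The point z is no vertex, so the tiles share a full side through z; by
  \<open>sides_meet_in_vertex\<close> this can only be the first side of v.\<close>

lemma meet_in_side:
  assumes "v \<in> darts" "w \<in> darts" "polygon v \<noteq> polygon w"
    and "z \<in> polygon w" "z \<in> hyp_segment (v 0) (v 1)" "z \<noteq> v 0" "z \<noteq> v 1"
  shows "\<exists>j. ((shift ^^ j) w) 0 = v 1 \<and> ((shift ^^ j) w) 1 = v 0 \<and>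
     polygon v \<inter> polygon w = hyp_segment (v 0) (v 1)"
proof -
  have zv: "z \<in> polygon v" using assms(5) polygon_segment by blast
  have nv: "z \<notin> range v" using vertex_on_side_dart[OF assms(1)] assms(5-7) by blast
  from tiles_meet[OF assms(1-3) zv assms(4)] nv obtain m j where
    mj: "((shift ^^ j) w) 0 = ((shift ^^ m) v) 1" "((shift ^^ j) w) 1 = ((shift ^^ m) v) 0"
      "polygon v \<inter> polygon w = hyp_segment (((shift ^^ m) v) 0) (((shift ^^ m) v) 1)"
    by (auto simp: shift_funpow)
  have "z \<in> hyp_segment (v m) (v (Suc m))"
    using mj(3) zv assms(4) by (auto simp: shift_funpow)
  then have "m mod p = 0" using sides_meet_in_vertex[OF dartD(1)[OF assms(1)] p3 assms(5) _ nv] by blast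
  then have "(shift ^^ m) v = v" using shift_period[OF assms(1), of m] by simp
  then show ?thesis using mj by auto
qed

text \<open>The other tiles have a closed union. If it missed an inner point z of the side, its
  complement would be a neighbourhood of z inside the tile, contradicting
  \<open>side_not_interior\<close>.\<close>

lemma flip_exists:
  assumes "v \<in> darts"
  shows "\<exists>w\<in>darts. w 0 = v 1 \<and> w 1 = v 0 \<and> polygon w \<noteq> polygon v"
proof -
  obtain z where z: "z \<in> hyp_segment (v 0) (v 1)" "z \<noteq> v 0" "z \<noteq> v 1"
    using hyp_segment_inner_point[OF dart_neq[OF assms]] by blast
  let ?C = "\<Union>(T - {polygon v})"
  have "closed ?C" by (rule tiles_closed) blast
  then have op: "open (- ?C)" by (rule open_Compl)
  have sub: "- ?C \<subseteq> polygon v"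
  proof
    fix y assume y: "y \<in> - ?C"
    obtain F where "F \<in> T" "y \<in> F" using tess_cover by (metis UNIV_I UnionE)
    then show "y \<in> polygon v" using y by (cases "F = polygon v") auto
  qed
  have "z \<in> ?C"
  proof (rule ccontr)
    assume "z \<notin> ?C"
    then have "z \<in> interior (polygon v)" using interiorI[OF op _ sub] by simp
    then show False using side_not_interior[OF dartD(1)[OF assms] p3 z(1)] by simp
  qed
  then obtain F where F: "F \<in> T" "F \<noteq> polygon v" "z \<in> F" by blast
  then obtain w where w: "w \<in> darts" "polygon w = F" using tile_dart by blast
  obtain j where j: "((shift ^^ j) w) 0 = v 1" "((shift ^^ j) w) 1 = v 0"
    using meet_in_side[OF assms w(1) _ _ z] w(2) F by blast
  have "polygon ((shift ^^ j) w) \<noteq> polygon v"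
    using shift_funpow_dart(2)[OF w(1)] w(2) F(2) by simp
  then show ?thesis using j shift_funpow_dart(1)[OF w(1)] by blast
qed

lemma flip_eqI:
  assumes "w \<in> darts" "w 0 = v 1" "w 1 = v 0"
  shows "flip v = w"
  unfolding flip_def using assms dart_unique by (intro the_equality) auto

lemma flip:
  assumes "v \<in> darts"
  shows "flip v \<in> darts" "flip v 0 = v 1" "flip v 1 = v 0" "polygon (flip v) \<noteq> polygon v"
proof -
  obtain w where "w \<in> darts" "w 0 = v 1" "w 1 = v 0" "polygon w \<noteq> polygon v"
    using flip_exists[OF assms] by blast
  then show "flip v \<in> darts" "flip v 0 = v 1" "flip v 1 = v 0" "polygon (flip v) \<noteq> polygon v"
    using flip_eqI[of w v] by auto
qed

lemma flip_flip: "v \<in> darts \<Longrightarrow> flip (flip v) = v"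
  using flip by (intro flip_eqI) auto

lemma flip_meet:
  assumes "v \<in> darts"
  shows "polygon v \<inter> polygon (flip v) = hyp_segment (v 0) (v 1)"
proof -
  obtain z where z: "z \<in> hyp_segment (v 0) (v 1)" "z \<noteq> v 0" "z \<noteq> v 1"
    using hyp_segment_inner_point[OF dart_neq[OF assms]] by blast
  have "hyp_segment (v 0) (v 1) = hyp_segment (flip v 0) (flip v 1)"
    using flip[OF assms] by (simp add: hyp_segment_commute)
  then have "z \<in> polygon (flip v)" using z(1) polygon_segment by blast
  then show ?thesis using meet_in_side[OF assms flip(1)[OF assms] _ _ z] flip(4)[OF assms] by metis
qed

lemma tiles_meet_cases:
  assumes "v \<in> darts" "w \<in> darts" "polygon v \<noteq> polygon w" "x \<in> polygon v" "x \<in> polygon w"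
  obtains (vertex) m j where "((shift ^^ m) v) 0 = x" "((shift ^^ j) w) 0 = x"
  | (side) m j where "(shift ^^ j) w = flip ((shift ^^ m) v)"
      "polygon v \<inter> polygon w = hyp_segment (((shift ^^ m) v) 0) (((shift ^^ m) v) 1)"
  using tiles_meet[OF assms]
proof
  assume "\<exists>m j. ((shift ^^ m) v) 0 = x \<and> ((shift ^^ j) w) 0 = x"
  then show thesis using vertex by blast
next
  assume "\<exists>m j. ((shift ^^ j) w) 0 = ((shift ^^ m) v) 1 \<and> ((shift ^^ j) w) 1 = ((shift ^^ m) v) 0 \<and>
      polygon v \<inter> polygon w = hyp_segment (((shift ^^ m) v) 0) (((shift ^^ m) v) 1)"
  then obtain m j where mj: "((shift ^^ j) w) 0 = ((shift ^^ m) v) 1" "((shift ^^ j) w) 1 = ((shift ^^ m) v) 0"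
      "polygon v \<inter> polygon w = hyp_segment (((shift ^^ m) v) 0) (((shift ^^ m) v) 1)" by blast
  have "(shift ^^ j) w = flip ((shift ^^ m) v)"
    using flip_eqI[OF shift_funpow_dart(1)[OF assms(2)] mj(1,2)] by (rule sym)
  then show thesis using side mj(3) by blast
qed

section \<open>Rotation about a vertex\<close>

lemma shift_inj: "v \<in> darts \<Longrightarrow> w \<in> darts \<Longrightarrow> shift v = shift w \<Longrightarrow> v = w"
proof -
  assume v: "v \<in> darts" and w: "w \<in> darts" and e: "shift v = shift w"
  have "u = (shift ^^ (p - 1)) (shift u)" if "u \<in> darts" for u
  proof -
    have "(shift ^^ (p - 1)) (shift u) = (shift ^^ p) u"
      using p_pos funpow_swap1[of shift "p - 1" u] by (metis Suc_diff_1 comp_apply funpow.simps(2))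
    then show ?thesis using shift_period[OF that, of p] by simp
  qed
  then show "v = w" using v w e by metis
qed

lemma turn_from:
  assumes "v \<in> darts_from x"
  shows "turn v \<in> darts_from x"
  using assms flip shift_dart by (simp add: darts_from_def turn_def)

lemma turn_inj: "inj_on turn (darts_from x)"
proof (rule inj_onI)
  fix v w assume v: "v \<in> darts_from x" and w: "w \<in> darts_from x" and e: "turn v = turn w"
  have d: "v \<in> darts" "w \<in> darts" using v w by (auto simp: darts_from_def)
  have "flip v = flip w" using e shift_inj flip(1) d unfolding turn_def by blast
  then show "v = w" using flip_flip d by metis
qed

text \<open>Tiles meet edge to edge: a vertex of v that lies on a side shared with w is an end of
  that side, hence a vertex of w too.\<close>

lemma vertex_tile:
  assumes "v \<in> darts_from x" "w \<in> darts" "x \<in> polygon w"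
  shows "\<exists>u\<in>darts_from x. polygon u = polygon w"
proof -
  have v: "v \<in> darts" "v 0 = x" using assms(1) by (auto simp: darts_from_def)
  have xv: "x \<in> polygon v" using v polygon_vertex by metis
  show ?thesis
  proof (cases "polygon v = polygon w")
    case True
    then show ?thesis using assms(1) by blast
  next
    case False
    show ?thesis
      using v(1) assms(2) False xv assms(3)
    proof (cases rule: tiles_meet_cases)
      case (vertex m j)
      then show ?thesis using shift_funpow_dart[OF assms(2), of j] by (auto simp: darts_from_def)
    next
      case (side m j)
      define v' w' where "v' = (shift ^^ m) v" and "w' = (shift ^^ j) w"
      have d: "v' \<in> darts" "w' \<in> darts" "polygon w' = polygon w"
        using shift_funpow_dart v(1) assms(2) by (auto simp: v'_def w'_def)
      have w': "w' 0 = v' 1" "w' 1 = v' 0" using side(1) flip[OF d(1)] by (auto simp: v'_def w'_def)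
      have "range v' = range v" using ccw_range_shift[OF dartD(1)[OF v(1)] p_pos(1)]
        by (simp add: v'_def shift_funpow)
      then obtain k where k: "x = v' k" using v(2) by (metis rangeE rangeI)
      have "x \<in> hyp_segment (v' 0) (v' 1)" using side(2) xv assms(3) by (auto simp: v'_def)
      then have "x = v' 0 \<or> x = v' 1" using vertex_on_side_dart[OF d(1), of k] k by simp
      then have "x = w' 0 \<or> x = shift w' 0" using w' by auto
      then show ?thesis using d shift_dart[OF d(2)] by (auto simp: darts_from_def)
    qed
  qed
qed

lemma card_darts_from:
  assumes "v \<in> darts"
  shows "card (darts_from (v 0)) = q"
proof -
  let ?x = "v 0"
  have "bij_betw polygon (darts_from ?x) {F \<in> T. ?x \<in> F}"
    unfolding bij_betw_def
  proof
    show "inj_on polygon (darts_from ?x)"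
      using same_tile_same_origin by (auto simp: inj_on_def darts_from_def)
    show "polygon ` darts_from ?x = {F \<in> T. ?x \<in> F}"
    proof
      show "polygon ` darts_from ?x \<subseteq> {F \<in> T. ?x \<in> F}"
      proof (rule image_subsetI)
        fix u assume "u \<in> darts_from ?x"
        then have "u \<in> darts" "u 0 = ?x" by (auto simp: darts_from_def)
        then show "polygon u \<in> {F \<in> T. ?x \<in> F}" using dartD(2)[of u] polygon_vertex[of u 0] by simp
      qed
      show "{F \<in> T. ?x \<in> F} \<subseteq> polygon ` darts_from ?x"
      proof
        fix F assume F: "F \<in> {F \<in> T. ?x \<in> F}"
        then obtain w where "w \<in> darts" "polygon w = F" using tile_dart by blast
        moreover have "v \<in> darts_from ?x" using assms by (simp add: darts_from_def)
        ultimately show "F \<in> polygon ` darts_from ?x" using vertex_tile[of v ?x w] F by auto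
      qed
    qed
  qed
  then have "card (darts_from ?x) = card {F \<in> T. ?x \<in> F}" by (rule bij_betw_same_card)
  then show ?thesis using tess_card[OF dartD(2)[OF assms] is_vertex_of_dart[OF assms, of 0]] by simp
qed

lemma finite_darts_from: "v \<in> darts \<Longrightarrow> finite (darts_from (v 0))"
  using card_darts_from[of v] q3 by (intro card_ge_0_finite) simp

text \<open>By local finiteness the tiles near x that miss x have a closed union, which can be
  removed from a neighbourhood. So nearby points lie in fewer tiles, which makes restriction of
  germs possible.\<close>

lemma star_nbhd: "\<exists>W. open W \<and> x \<in> W \<and> (\<forall>y\<in>W. \<forall>F\<in>T. y \<in> F \<longrightarrow> x \<in> F)"
proof -
  obtain V where V: "open V" "x \<in> V" "finite {F \<in> T. F \<inter> V \<noteq> {}}"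
    using tess_locally_finite unfolding locally_finite_in_def
    by (simp only: topspace_euclidean open_openin[symmetric]) (metis UNIV_I)
  let ?C = "\<Union>{F \<in> T. F \<inter> V \<noteq> {} \<and> x \<notin> F}"
  have "closed ?C" by (rule tiles_closed) blast
  then have "open (V - ?C)" using V(1) by (simp add: open_Diff)
  then show ?thesis using V(2) by (intro exI[of _ "V - ?C"]) auto
qed

text \<open>The finitely many tiles at x have finitely many vertices, and those other than x can be
  removed too. This isolation of vertices serves both the vertex cycle and the discreteness of the
  group.\<close>

lemma vertex_nbhd:
  assumes v: "v \<in> darts" "v 0 = x"
  shows "\<exists>W. open W \<and> x \<in> W \<and> (\<forall>y\<in>W. \<forall>u\<in>darts. y \<in> polygon u \<longrightarrow> x \<in> polygon u \<and> (y \<in> range u \<longrightarrow> y = x))"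
proof -
  obtain W where W: "open W" "x \<in> W" "\<forall>y\<in>W. \<forall>F\<in>T. y \<in> F \<longrightarrow> x \<in> F" using star_nbhd by blast
  let ?V = "\<Union>u\<in>darts_from x. range u"
  have "finite (range u)" if "u \<in> darts" for u
    using ccw_range[OF dartD(1)[OF that] p_pos(1)] by simp
  then have fin: "finite (?V - {x})"
    using finite_darts_from[OF v(1)] v(2) by (auto simp: darts_from_def)
  have "open (W - (?V - {x}))" by (rule open_Diff[OF W(1) finite_imp_closed[OF fin]])
  moreover have "y = x" if y: "y \<in> W - (?V - {x})" "u \<in> darts" "y \<in> range u" "y \<in> polygon u" for y u
  proof -
    have "x \<in> polygon u" using W(3) y dartD(2) by blast
    then obtain u' where u': "u' \<in> darts_from x" "polygon u' = polygon u"
      using vertex_tile[of v x u] v y(2) by (auto simp: darts_from_def)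
    then obtain m where "u = (shift ^^ m) u'" using same_tile[of u' u] y(2) by (auto simp: darts_from_def)
    then have "y \<in> range u'" using y(3) by (auto simp: shift_funpow)
    then show ?thesis using u'(1) y(1) by blast
  qed
  ultimately show ?thesis using W dartD(2) by (intro exI[of _ "W - (?V - {x})"]) blast
qed

text \<open>The tiles around a vertex form a single cycle because a punctured disc is connected.\<close>

lemma turn_transitive:
  assumes v: "v \<in> darts_from x" and w: "w \<in> darts_from x"
  shows "\<exists>i. w = (turn ^^ i) v"
proof (rule ccontr)
  assume neg: "\<nexists>i. w = (turn ^^ i) v"
  define Orb where "Orb = range (\<lambda>i. (turn ^^ i) v)"
  define R where "R = darts_from x - Orb"
  have vd: "v \<in> darts" "v 0 = x" using v by (auto simp: darts_from_def)
  have fin: "finite (darts_from x)" using finite_darts_from vd by blast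
  have "(turn ^^ i) v \<in> darts_from x" for i by (induction i) (auto intro: v turn_from)
  then have Orb: "Orb \<subseteq> darts_from x" by (auto simp: Orb_def)
  have turn_Orb: "turn u \<in> Orb" if u: "u \<in> Orb" for u
  proof -
    obtain i where "u = (turn ^^ i) v" using u by (auto simp: Orb_def)
    then have "turn u = (turn ^^ Suc i) v" by simp
    then show ?thesis unfolding Orb_def by blast
  qed
  \<comment> \<open>On the finite orbit \<open>turn\<close> is also onto, so the orbit is closed
    under going backwards as well.\<close>
  have surj_Orb: "turn ` Orb = Orb"
    using fin Orb turn_Orb turn_inj
    by (intro endo_inj_surj) (auto intro: finite_subset inj_on_subset)
  have wR: "w \<in> R" using w neg by (auto simp: R_def Orb_def)
  have vO: "v \<in> Orb" unfolding Orb_def by (metis funpow_0 rangeI)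
  obtain W where W: "open W" "x \<in> W"
    "\<And>y u. y \<in> W \<Longrightarrow> u \<in> darts \<Longrightarrow> y \<in> polygon u \<Longrightarrow> x \<in> polygon u"
    "\<And>y u. y \<in> W \<Longrightarrow> u \<in> darts \<Longrightarrow> y \<in> polygon u \<Longrightarrow> y \<in> range u \<Longrightarrow> y = x"
    using vertex_nbhd[OF vd] by blast
  have "open (klein_inv -` W \<inter> ball 0 1)"
    using W(1) continuous_klein_inv continuous_on_open_vimage[OF open_ball] by blast
  moreover have "klein x \<in> klein_inv -` W \<inter> ball 0 1" using W(2) klein_in_ball by simp
  ultimately obtain e where e: "e > 0" "ball (klein x) e \<subseteq> klein_inv -` W \<inter> ball 0 1"
    using open_contains_ball by blast
  define P where "P = klein_inv ` (ball (klein x) e - {klein x})"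
  have "connected (ball (klein x) e - {klein x})"
    by (rule connected_punctured_ball) simp
  moreover have "continuous_on (ball (klein x) e - {klein x}) klein_inv"
    using continuous_klein_inv e(2) by (meson Diff_subset continuous_on_subset inf.boundedE)
  ultimately have "connected P" unfolding P_def by (rule connected_continuous_image[rotated])
  have PW: "y \<in> W" "y \<noteq> x" if yP: "y \<in> P" for y
  proof -
    obtain z where z: "z \<in> ball (klein x) e" "z \<noteq> klein x" "y = klein_inv z"
      using yP unfolding P_def by blast
    then show "y \<in> W" using e(2) by blast
    show "y \<noteq> x" using z e(2) klein_klein_inv by auto
  qed
  have meets: "\<exists>y. y \<in> polygon u \<and> y \<in> P" if u: "u \<in> darts_from x" for u
  proof -
    have ud: "u \<in> darts" "u 0 = x" using u by (auto simp: darts_from_def)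
    have ne: "klein (u 1) \<noteq> klein x" using dart_neq[OF ud(1)] ud(2) klein_inj by metis
    define d where "d = norm (klein (u 1) - klein x)"
    have d: "d > 0" using ne by (simp add: d_def)
    \<comment> \<open>Small enough that the point at parameter t on the first side of u lies in the
      punctured disc; so the tile of u meets \<open>P\<close>.\<close>
    define t where "t = min (1/2) (e / (2 * d))"
    have t: "0 < t" "t \<le> 1" "t * d < e"
    proof -
      show "0 < t" "t \<le> 1" using e d by (auto simp: t_def)
      have "t * d \<le> e / (2 * d) * d" using d by (intro mult_right_mono) (auto simp: t_def)
      also have "\<dots> < e" using d e by simp
      finally show "t * d < e" .
    qed
    define z where "z = klein x + t *\<^sub>R (klein (u 1) - klein x)"
    have "dist (klein x) z = t * d" using t by (simp add: z_def dist_norm d_def)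
    then have "z \<in> ball (klein x) e - {klein x}" using t d ne by (auto simp: z_def)
    moreover have "z \<in> closed_segment (klein x) (klein (u 1))"
      unfolding closed_segment_def using t by (auto simp: z_def algebra_simps intro!: exI[of _ t])
    then have "z \<in> klein ` hyp_segment (u 0) (u 1)" using klein_segment ud(2) by simp
    then obtain y where "y \<in> hyp_segment (u 0) (u 1)" "z = klein y" by blast
    ultimately show ?thesis
      using polygon_segment[of u 0 1] unfolding P_def by (metis imageI klein_inv_klein subsetD)
  qed
  have closed: "closed (\<Union>(polygon ` S))" if "S \<subseteq> darts_from x" for S
    by (rule tiles_closed) (use that dartD(2) in \<open>auto simp: darts_from_def\<close>)
  have "P \<subseteq> \<Union>(polygon ` Orb) \<union> \<Union>(polygon ` R)"
  proof
    fix y assume y: "y \<in> P"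
    obtain u where u: "u \<in> darts" "y \<in> polygon u" using point_dart by blast
    then have "x \<in> polygon u" using W(3) PW y by blast
    then obtain u' where "u' \<in> darts_from x" "polygon u' = polygon u" using vertex_tile[OF v u(1)] by blast
    then show "y \<in> \<Union>(polygon ` Orb) \<union> \<Union>(polygon ` R)" using u(2) unfolding R_def by blast
  qed
  moreover have "\<Union>(polygon ` Orb) \<inter> \<Union>(polygon ` R) \<inter> P = {}"
  proof (rule ccontr)
    assume "\<Union>(polygon ` Orb) \<inter> \<Union>(polygon ` R) \<inter> P \<noteq> {}"
    then obtain y u w where y: "y \<in> P" and u: "u \<in> Orb" "y \<in> polygon u" and w: "w \<in> R" "y \<in> polygon w"
      by blast
    have ux: "u \<in> darts_from x" and wx: "w \<in> darts_from x" using u w Orb by (auto simp: R_def)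
    then have ud: "u \<in> darts" "u 0 = x" and wd: "w \<in> darts" "w 0 = x" by (auto simp: darts_from_def)
    have "u \<noteq> w" using u w by (auto simp: R_def)
    then have ne: "polygon u \<noteq> polygon w" using same_tile_same_origin ud wd by metis
    have yv: "y \<notin> range u" using W(4)[OF PW(1)[OF y] ud(1) u(2)] PW(2)[OF y] by blast
    show False
      using ud(1) wd(1) ne u(2) w(2)
    proof (cases rule: tiles_meet_cases)
      case (vertex m j)
      then show ?thesis using yv by (auto simp: shift_funpow)
    next
      case (side m j)
      define u' w' where "u' = (shift ^^ m) u" and "w' = (shift ^^ j) w"
      have d: "u' \<in> darts" "w' \<in> darts" "polygon u' = polygon u" "polygon w' = polygon w"
        using shift_funpow_dart ud wd by (auto simp: u'_def w'_def)
      have w'u': "w' = flip u'" using side(1) by (simp add: u'_def w'_def)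
      have "x \<in> polygon u" "x \<in> polygon w" using ud wd polygon_vertex by metis+
      then have xs: "x \<in> hyp_segment (u' 0) (u' 1)" using side(2) by (auto simp: u'_def)
      have "range u' = range u" using ccw_range_shift[OF dartD(1)[OF ud(1)] p_pos(1)]
        by (simp add: u'_def shift_funpow)
      then obtain k where "x = u' k" using ud(2) by (metis rangeE rangeI)
      then have "x = u' 0 \<or> x = u' 1" using vertex_on_side_dart[OF d(1), of k] xs by simp
      \<comment> \<open>Two tiles sharing a point of \<open>P\<close> share a side ending at x.
        Depending on which end is x, one rotation step leads from u to w or from w to u; either way
        w is in the orbit.\<close>
      then show False
      proof
        assume x: "x = u' 0"
        then have "u' = u" using same_tile_same_origin d ud by metis
        then have "turn u = shift w'" using w'u' by (simp add: turn_def)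
        moreover have "shift w' = w"
          using same_tile_same_origin[OF shift_dart(1)[OF d(2)] wd(1)] shift_dart(2)[OF d(2)] d(4) wd(2)
            w'u' flip(3)[OF d(1)] x by simp
        ultimately have "w \<in> Orb" using turn_Orb[OF u(1)] by simp
        then show False using w by (simp add: R_def)
      next
        assume x: "x = u' 1"
        then have "w' 0 = w 0" using w'u' flip(2)[OF d(1)] wd(2) by simp
        then have "w' = w" using same_tile_same_origin d wd by metis
        then have "flip w = u'" using w'u' flip_flip[OF d(1)] by simp
        then have "turn w = shift u'" by (simp add: turn_def)
        moreover have "shift u' = u"
          using same_tile_same_origin[OF shift_dart(1)[OF d(1)] ud(1)] shift_dart(2)[OF d(1)] d(3) ud(2) x
          by simp
        ultimately have "turn w \<in> turn ` Orb" using u(1) surj_Orb by simp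
        then obtain w2 where "w2 \<in> Orb" "turn w = turn w2" by blast
        then have "w \<in> Orb" using turn_inj wx Orb by (metis inj_onD subsetD)
        then show False using w by (simp add: R_def)
      qed
    qed
  qed
  moreover have "\<Union>(polygon ` Orb) \<inter> P \<noteq> {}" using meets[OF v] vO by blast
  moreover have "\<Union>(polygon ` R) \<inter> P \<noteq> {}" using meets[OF w] wR by blast
  ultimately show False
    using \<open>connected P\<close> closed[OF Orb] closed[of R] unfolding connected_closed R_def by blast
qed

lemma turn_cyclic:
  assumes "v \<in> darts"
  shows "cyclic_permutation (darts_from (v 0)) turn"
  by unfold_locales (use finite_darts_from assms turn_from turn_inj turn_transitive in auto)

lemma turn_funpow_q:
  assumes "v \<in> darts"
  shows "(turn ^^ q) v = v"
proof -
  interpret cyclic_permutation "darts_from (v 0)" turn by (rule turn_cyclic[OF assms])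
  show ?thesis using funpow_card[of v] card_darts_from[OF assms] assms by (simp add: darts_from_def)
qed

text \<open>An induction principle for darts. The tiles with darts in \<open>S\<close> and the
  remaining tiles form two closed sets covering the plane. Where they met they would share a side or
  a vertex, and \<open>flip\<close> or \<open>turn\<close> would carry \<open>S\<close>
  across.\<close>

lemma darts_connected:
  assumes S: "S \<subseteq> darts" "S \<noteq> {}" and sh: "\<And>v. v \<in> S \<Longrightarrow> shift v \<in> S" and fl: "\<And>v. v \<in> S \<Longrightarrow> flip v \<in> S"
  shows "S = darts"
proof -
  have shn: "(shift ^^ m) v \<in> S" if "v \<in> S" for v m using that sh by (induction m) auto
  have trn: "(turn ^^ m) v \<in> S" if "v \<in> S" for v m
    using that sh fl by (induction m) (auto simp: turn_def)
  have tile: "w \<in> S" if "v \<in> S" "w \<in> darts" "polygon v = polygon w" for v w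
    using same_tile[of v w] that shn S(1) by blast
  let ?A = "\<Union>(polygon ` S)" and ?B = "\<Union>(T - polygon ` S)"
  have "polygon ` S \<subseteq> T" using S(1) dartD(2) by blast
  then have cl: "closed ?A" "closed ?B" by (auto intro!: tiles_closed)
  have cov: "UNIV \<subseteq> ?A \<union> ?B"
  proof
    fix y :: hyperbolic_plane
    obtain F where "F \<in> T" "y \<in> F" using tess_cover by (metis UNIV_I UnionE)
    then show "y \<in> ?A \<union> ?B" by (cases "F \<in> polygon ` S") auto
  qed
  have "?A \<inter> ?B = {}"
  proof (rule ccontr)
    assume "?A \<inter> ?B \<noteq> {}"
    then obtain x v F where v: "v \<in> S" "x \<in> polygon v" and F: "F \<in> T" "F \<notin> polygon ` S" "x \<in> F" by blast
    obtain w where w: "w \<in> darts" "polygon w = F" using tile_dart F by blast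
    have vd: "v \<in> darts" using v S by blast
    have ne: "polygon v \<noteq> polygon w" using v w F by blast
    have "x \<in> polygon w" using w F by simp
    have nS: "(shift ^^ j) w \<notin> S" for j
      using shift_funpow_dart(2)[OF w(1), of j] w(2) F(2) by (metis imageI)
    show False
      using vd w(1) ne v(2) \<open>x \<in> polygon w\<close>
    proof (cases rule: tiles_meet_cases)
      case (vertex m j)
      then have "(shift ^^ j) w \<in> darts_from x" "(shift ^^ m) v \<in> darts_from x"
        using shift_funpow_dart(1) vd w(1) by (auto simp: darts_from_def)
      then obtain i where "(shift ^^ j) w = (turn ^^ i) ((shift ^^ m) v)" using turn_transitive by blast
      then show False using trn[OF shn[OF v(1)]] nS by metis
    next
      case (side m j)
      then show False using fl[OF shn[OF v(1)]] nS by metis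
    qed
  qed
  moreover have "?A \<noteq> {}" using S(2) polygon_vertex by blast
  ultimately have "?B = {}"
    using connected_closedD[OF connected_hyperbolic_plane _ cov cl] by (metis inf_top.right_neutral)
  show ?thesis
  proof
    show "darts \<subseteq> S"
    proof
      fix w assume w: "w \<in> darts"
      have "polygon w \<in> polygon ` S"
      proof (rule ccontr)
        assume "polygon w \<notin> polygon ` S"
        then have "polygon w \<subseteq> ?B" using dartD(2)[OF w] by blast
        then show False using \<open>?B = {}\<close> polygon_vertex[of w 0] by blast
      qed
      then show "w \<in> S" using tile w by blast
    qed
  qed (rule S(1))
qed

section \<open>Symmetries of the tessellation\<close>

lemma flip_comp:
  assumes "direct h" "v \<in> darts" "h \<circ> v \<in> darts"
  shows "flip (h \<circ> v) = h \<circ> flip v"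
  using ccw_unique[OF dartD(1)[OF flip(1)[OF assms(3)]] ccw_direct[OF dartD(1)[OF flip(1)[OF assms(2)]] assms(1)] p_pos(2)]
    flip(2,3)[OF assms(2)] flip(2,3)[OF assms(3)] by simp

text \<open>Composition with h commutes with \<open>shift\<close> and \<open>flip\<close>, so one
  dart sent to a dart suffices.\<close>

lemma direct_symmetry:
  assumes h: "direct h" and v: "v \<in> darts" "h \<circ> v \<in> darts" and w: "w \<in> darts"
  shows "h \<circ> w \<in> darts"
proof -
  have "{w \<in> darts. h \<circ> w \<in> darts} = darts"
  proof (rule darts_connected)
    show "{w \<in> darts. h \<circ> w \<in> darts} \<noteq> {}" using v by blast
    fix w assume w: "w \<in> {w \<in> darts. h \<circ> w \<in> darts}"
    show "shift w \<in> {w \<in> darts. h \<circ> w \<in> darts}"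
      using w shift_dart(1)[of "h \<circ> w"] shift_dart(1)[of w] by (simp add: shift_comp)
    show "flip w \<in> {w \<in> darts. h \<circ> w \<in> darts}"
      using w flip(1)[of "h \<circ> w"] flip(1)[of w] flip_comp[OF h, of w] by simp
  qed simp
  then show ?thesis using w by blast
qed

text \<open>\<open>shift\<close> and \<open>flip\<close> preserve the length of the first side, so
  all darts have the same one; equal side lengths give a direct congruence.\<close>

lemma darts_transitive:
  assumes v: "v \<in> darts" and w: "w \<in> darts"
  shows "\<exists>h. direct h \<and> w = h \<circ> v"
proof -
  let ?S = "{w \<in> darts. dist (v 0) (v 1) = dist (w 0) (w 1)}"
  have "?S = darts"
  proof (rule darts_connected)
    show "?S \<noteq> {}" using v by blast
    fix w assume w: "w \<in> ?S"
    show "shift w \<in> ?S"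
      using w shift_dart(1)[of w] ccw_side_length[OF dartD(1) p_pos(1), of w 1] by simp
    show "flip w \<in> ?S" using w flip[of w] by (simp add: dist_commute)
  qed simp
  then have "dist (v 0) (v 1) = dist (w 0) (w 1)" using w by blast
  then show ?thesis using ccw_congruent[OF dartD(1)[OF v] dartD(1)[OF w] p_pos(2)] by blast
qed

text \<open>The local counterpart of \<open>darts_connected\<close>, where only sides between two
  tiles through x may be crossed. Tiles touching only in x are linked by rotation about x, which
  stays among these tiles.\<close>

lemma darts_at_connected:
  assumes S: "S \<subseteq> darts_at x" "v \<in> S" and sh: "\<And>v. v \<in> S \<Longrightarrow> shift v \<in> S"
    and fl: "\<And>v. v \<in> S \<Longrightarrow> flip v \<in> darts_at x \<Longrightarrow> flip v \<in> S"
  shows "S = darts_at x"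
proof
  show "darts_at x \<subseteq> S"
  proof
    fix w assume "w \<in> darts_at x"
    then have w: "w \<in> darts" "x \<in> polygon w" by (auto simp: darts_at_def)
    have v: "v \<in> darts" "x \<in> polygon v" using S by (auto simp: darts_at_def)
    have shn: "(shift ^^ m) v \<in> S" if "v \<in> S" for v m using that sh by (induction m) auto
    have tile: "w \<in> S" if "v \<in> S" "w \<in> darts" "polygon v = polygon w" for v w
      using same_tile[of v w] that shn S(1) unfolding darts_at_def by blast
    show "w \<in> S"
    proof (cases "polygon v = polygon w")
      case True
      then show ?thesis using tile S(2) w by blast
    next
      case False
      show ?thesis
        using v(1) w(1) False v(2) w(2)
      proof (cases rule: tiles_meet_cases)
        case (vertex m j)
        have trn: "(turn ^^ i) u \<in> S \<inter> darts_from x" if "u \<in> S \<inter> darts_from x" for i u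
        proof (induction i)
          case (Suc i)
          define u' where "u' = (turn ^^ i) u"
          have u': "u' \<in> S" "u' \<in> darts" "u' 0 = x" using Suc by (auto simp: u'_def darts_from_def)
          have "flip u' \<in> darts_at x"
            using flip[OF u'(2)] polygon_vertex[of "flip u'" 1] u'(3) by (simp add: darts_at_def)
          then have "turn u' \<in> S" unfolding turn_def using fl u' sh by blast
          then show ?case using turn_from[of u' x] u' by (simp add: u'_def[symmetric] darts_from_def)
        qed (use that in simp)
        have "(shift ^^ j) w \<in> darts_from x" "(shift ^^ m) v \<in> darts_from x"
          using vertex shift_funpow_dart(1) v(1) w(1) by (auto simp: darts_from_def)
        then obtain i where "(shift ^^ j) w = (turn ^^ i) ((shift ^^ m) v)" using turn_transitive by blast
        then have "(shift ^^ j) w \<in> S"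
          using trn[of "(shift ^^ m) v" i] shn[OF S(2)] \<open>(shift ^^ m) v \<in> darts_from x\<close> by simp
        then show ?thesis using tile w(1) shift_funpow_dart(2)[OF w(1)] by metis
      next
        case (side m j)
        have "(shift ^^ j) w \<in> darts_at x"
          using shift_funpow_dart[OF w(1)] w(2) by (simp add: darts_at_def)
        then have "(shift ^^ j) w \<in> S" using fl[OF shn[OF S(2)]] side(1) by metis
        then show ?thesis using tile w(1) shift_funpow_dart(2)[OF w(1)] by metis
      qed
    qed
  qed
qed (rule S(1))

end

text \<open>The period n of x divides q and is at most \<open>card L\<close>, so any prime factor of
  n would be a prime divisor of q of at most that size.\<close>

lemma funpow_fixed_if_small_prime_free:
  fixes f :: "'a \<Rightarrow> 'a"
  assumes "finite L" "\<And>y. y \<in> L \<Longrightarrow> f y \<in> L" "x \<in> L" "(f ^^ q) x = x" "0 < q"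
    and np: "\<And>r. prime r \<Longrightarrow> r dvd q \<Longrightarrow> card L < r"
  shows "f x = x"
proof -
  define n where "n = (LEAST n. 0 < n \<and> (f ^^ n) x = x)"
  have n: "0 < n \<and> (f ^^ n) x = x"
    unfolding n_def by (rule LeastI[of _ q]) (use assms in simp)
  have least: "n \<le> m" if "0 < m" "(f ^^ m) x = x" for m
    unfolding n_def by (rule Least_le) (use that in simp)
  have "(f ^^ (q mod n)) x = x" using funpow_mod_eq[of n f x q] n assms(4) by simp
  then have "q mod n = 0" using least[of "q mod n"] n by (meson mod_less_divisor not_le neq0_conv)
  then have nq: "n dvd q" by blast
  have mem: "(f ^^ i) x \<in> L" for i by (induction i) (use assms in auto)
  have lt: "\<not> (i < j \<and> j < n \<and> (f ^^ i) x = (f ^^ j) x)" for i j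
  proof
    assume ij: "i < j \<and> j < n \<and> (f ^^ i) x = (f ^^ j) x"
    have "(f ^^ (n - j)) ((f ^^ i) x) = (f ^^ (n - j)) ((f ^^ j) x)" using ij by simp
    then have "(f ^^ (n - j + i)) x = (f ^^ (n - j + j)) x" by (simp add: funpow_add)
    then have "(f ^^ (n - j + i)) x = x" using ij n by simp
    then have "n \<le> n - j + i" using ij by (intro least) auto
    then show False using ij by linarith
  qed
  have "inj_on (\<lambda>i. (f ^^ i) x) {..<n}"
    by (rule inj_onI) (metis lessThan_iff linorder_neqE_nat lt)
  then have "card {..<n} \<le> card L"
    by (rule card_inj_on_le) (use mem assms(1) in auto)
  then have nL: "n \<le> card L" by simp
  have "n = 1"
  proof (rule ccontr)
    assume "n \<noteq> 1"
    then obtain r where r: "prime r" "r dvd n" using prime_factor_nat by blast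
    then have "r \<le> n" using n by (intro dvd_imp_le) auto
    moreover have "card L < r" using r nq by (intro np) (auto intro: dvd_trans)
    ultimately show False using nL by simp
  qed
  then show ?thesis using n by simp
qed

lemma subgroup_BijGroupI:
  assumes "\<And>f. f \<in> \<Gamma> \<Longrightarrow> bij f" "id \<in> \<Gamma>" "\<And>f g. f \<in> \<Gamma> \<Longrightarrow> g \<in> \<Gamma> \<Longrightarrow> f \<circ> g \<in> \<Gamma>"
    "\<And>f. f \<in> \<Gamma> \<Longrightarrow> inv_into UNIV f \<in> \<Gamma>"
  shows "subgroup \<Gamma> (BijGroup UNIV)"
proof -
  have B: "f \<in> Bij UNIV" if "f \<in> \<Gamma>" for f
    using assms(1)[OF that] by (simp add: Bij_def)
  show ?thesis
  proof
    show "\<Gamma> \<subseteq> carrier (BijGroup UNIV)" using B by (auto simp: BijGroup_def)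
    show "\<one>\<^bsub>BijGroup UNIV\<^esub> \<in> \<Gamma>" using assms(2) by (simp add: BijGroup_def id_def restrict_def)
  next
    fix f g assume f: "f \<in> \<Gamma>" and g: "g \<in> \<Gamma>"
    have "f \<otimes>\<^bsub>BijGroup UNIV\<^esub> g = f \<circ> g"
      using B[OF f] B[OF g] by (simp add: BijGroup_def compose_def comp_def restrict_def)
    then show "f \<otimes>\<^bsub>BijGroup UNIV\<^esub> g \<in> \<Gamma>" using assms(3) f g by simp
  next
    fix f assume f: "f \<in> \<Gamma>"
    have "inv\<^bsub>BijGroup UNIV\<^esub> f = inv_into UNIV f" 
      using inv_BijGroup[OF B[OF f]] by (simp add: restrict_def)
    then show "inv\<^bsub>BijGroup UNIV\<^esub> f \<in> \<Gamma>" using assms(4) f by simp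
  qed
qed

context tessellation
begin

section \<open>Labellings of the darts\<close>

text \<open>The stalk at x: labellings of the darts of the tiles through x. The \<sigma>-condition
  is imposed only on sides with both tiles through x, so that conditions drop out under restriction
  but none are added.\<close>

definition germs :: "'l set \<Rightarrow> ('l \<Rightarrow> 'l) \<Rightarrow> ('l \<Rightarrow> 'l) \<Rightarrow> hyperbolic_plane \<Rightarrow> ((nat \<Rightarrow> hyperbolic_plane) \<Rightarrow> 'l) set"
  where "germs L \<rho> \<sigma> x = {e \<in> darts_at x \<rightarrow>\<^sub>E L. (\<forall>v\<in>darts_at x. e (shift v) = \<rho> (e v)) \<and>
    (\<forall>v\<in>darts_at x. flip v \<in> darts_at x \<longrightarrow> e (flip v) = \<sigma> (e v))}"

lemma shift_darts_at: "v \<in> darts_at x \<Longrightarrow> shift v \<in> darts_at x"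
  using shift_dart by (simp add: darts_at_def)

lemma darts_from_at: "v \<in> darts_from x \<Longrightarrow> v \<in> darts_at x"
  using polygon_vertex[of v 0] by (auto simp: darts_at_def darts_from_def)

lemma darts_at_nonempty: "\<exists>v. v \<in> darts_at x"
  using point_dart by (auto simp: darts_at_def)

lemma germs_unique:
  assumes e: "e \<in> germs L \<rho> \<sigma> x" and e': "e' \<in> germs L \<rho> \<sigma> x" and v: "v \<in> darts_at x" "e v = e' v"
  shows "e = e'"
proof -
  have "{w \<in> darts_at x. e w = e' w} = darts_at x"
  proof (rule darts_at_connected)
    show "v \<in> {w \<in> darts_at x. e w = e' w}" using v by simp
  qed (use e e' in \<open>auto simp: germs_def shift_darts_at\<close>)
  then show ?thesis
    using e e' by (intro PiE_ext[of e "darts_at x" "\<lambda>_. L" e']) (auto simp: germs_def)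
qed

lemma restrict_germs:
  assumes "darts_at y \<subseteq> darts_at x" "e \<in> germs L \<rho> \<sigma> x"
  shows "restrict e (darts_at y) \<in> germs L \<rho> \<sigma> y"
  using assms shift_darts_at by (auto simp: germs_def PiE_iff subset_iff)

text \<open>Every dart at x has the form shift^j (turn^i c), which forces the label \<rho>^j
  (\<tau>^i l). Only here the condition that \<tau>^q is trivial on labels enters: it closes the
  labelling up around the vertex.\<close>

lemma germs_at_vertex:
  assumes sp: "side_pairing q L \<rho> \<sigma>" "card L = p" and c: "c \<in> darts_from x" and l: "l \<in> L"
  shows "\<exists>e\<in>germs L \<rho> \<sigma> x. e c = l"
proof -
  interpret \<rho>: cyclic_permutation L \<rho> using sp by (simp add: side_pairing_def)
  have \<sigma>: "\<sigma> y \<in> L" "\<sigma> (\<sigma> y) = y" "((\<rho> \<circ> \<sigma>) ^^ q) y = y" if "y \<in> L" for y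
    using sp that by (auto simp: side_pairing_def)
  define \<tau> where "\<tau> = \<rho> \<circ> \<sigma>"
  have cd: "c \<in> darts" "c 0 = x" using c by (auto simp: darts_from_def)
  interpret turn: cyclic_permutation "darts_from x" turn using turn_cyclic[OF cd(1)] cd(2) by simp
  have cardq: "card (darts_from x) = q" using card_darts_from[OF cd(1)] cd(2) by simp
  have \<tau>L: "(\<tau> ^^ i) l \<in> L" for i by (induction i) (auto simp: \<tau>_def l \<sigma> \<rho>.maps)
  have \<tau>q: "(\<tau> ^^ i) l = (\<tau> ^^ (i mod q)) l" for i
    using funpow_mod_eq[of q \<tau> l i] \<sigma>(3)[OF l] by (simp add: \<tau>_def)
  have td: "(turn ^^ i) c \<in> darts" "((turn ^^ i) c) 0 = x" for i
    using turn.funpow_mem[OF c, of i] by (auto simp: darts_from_def)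
  \<comment> \<open>The exponent i is determined modulo q and j modulo p, and the labels have
    exactly these periods.\<close>
  have wd: "(\<rho> ^^ j) ((\<tau> ^^ i) l) = (\<rho> ^^ j') ((\<tau> ^^ i') l)"
    if eq: "(shift ^^ j) ((turn ^^ i) c) = (shift ^^ j') ((turn ^^ i') c)" for i j i' j'
  proof -
    have "polygon ((turn ^^ i) c) = polygon ((turn ^^ i') c)"
      using shift_funpow_dart(2)[OF td(1)] eq by metis
    then have t: "(turn ^^ i) c = (turn ^^ i') c"
      using same_tile_same_origin[OF td(1) td(1)] td(2) by simp
    then have "i mod q = i' mod q" using turn.funpow_eq_iff_mod[OF c] cardq by simp
    then have \<tau>: "(\<tau> ^^ i) l = (\<tau> ^^ i') l" using \<tau>q by metis
    have "((turn ^^ i) c) j = ((turn ^^ i) c) j'"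
      using fun_cong[OF eq, of 0] t by (simp add: shift_funpow)
    then have "j mod p = j' mod p" using dart_eq_iff[OF td(1)] by simp
    then show ?thesis using \<rho>.funpow_eq_iff_mod[OF \<tau>L, of j i' j'] sp(2) \<tau> by simp
  qed
  have ex: "\<exists>i j. v = (shift ^^ j) ((turn ^^ i) c)" if v: "v \<in> darts_at x" for v
  proof -
    obtain u where u: "u \<in> darts_from x" "polygon u = polygon v"
      using vertex_tile[OF c, of v] v by (auto simp: darts_at_def)
    obtain i where i: "u = (turn ^^ i) c" using turn.transitive[OF c u(1)] by blast
    have "u \<in> darts" "v \<in> darts" using u v by (auto simp: darts_from_def darts_at_def)
    then obtain j where "v = (shift ^^ j) u" using same_tile u(2) by blast
    then show ?thesis using i by blast
  qed
  define e where "e = restrict (\<lambda>v. THE y. \<exists>i j. v = (shift ^^ j) ((turn ^^ i) c) \<and> y = (\<rho> ^^ j) ((\<tau> ^^ i) l)) (darts_at x)"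
  have mem: "(shift ^^ j) ((turn ^^ i) c) \<in> darts_at x" for i j
    using darts_from_at[OF turn.funpow_mem[OF c]] shift_funpow_dart by (simp add: darts_at_def)
  have e: "e ((shift ^^ j) ((turn ^^ i) c)) = (\<rho> ^^ j) ((\<tau> ^^ i) l)" for i j
  proof -
    have "e ((shift ^^ j) ((turn ^^ i) c)) = (THE y. \<exists>i' j'. (shift ^^ j) ((turn ^^ i) c) = (shift ^^ j') ((turn ^^ i') c) \<and> y = (\<rho> ^^ j') ((\<tau> ^^ i') l))"
      unfolding e_def using mem by simp
    also have "\<dots> = (\<rho> ^^ j) ((\<tau> ^^ i) l)"
      by (rule the_equality) (use wd in metis)+
    finally show ?thesis .
  qed
  have eL: "e v \<in> L" if v: "v \<in> darts_at x" for v
    using ex[OF v] e \<rho>.funpow_mem[OF \<tau>L] by metis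
  have esh: "e (shift v) = \<rho> (e v)" if v: "v \<in> darts_at x" for v
  proof -
    obtain i j where ij: "v = (shift ^^ j) ((turn ^^ i) c)" using ex[OF v] by blast
    have "e (shift v) = (\<rho> ^^ Suc j) ((\<tau> ^^ i) l)" using e[of "Suc j" i] ij by simp
    then show ?thesis using e[of j i] ij by simp
  qed
  \<comment> \<open>For darts starting at x the relation follows from the one for
    \<open>turn\<close> by cancelling the injective \<rho>.\<close>
  have efl: "e (flip v) = \<sigma> (e v)" if v: "v \<in> darts_from x" for v
  proof -
    have vd: "v \<in> darts" "v 0 = x" using v by (auto simp: darts_from_def)
    obtain i where i: "v = (turn ^^ i) c" using turn.transitive[OF c v] by blast
    have fm: "flip v \<in> darts_at x"
      using flip[OF vd(1)] polygon_vertex[of "flip v" 1] vd(2) by (simp add: darts_at_def)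
    have "\<rho> (e (flip v)) = e (turn v)" using esh[OF fm] by (simp add: turn_def)
    also have "\<dots> = (\<tau> ^^ Suc i) l" using e[of 0 "Suc i"] i by simp
    also have "\<dots> = \<rho> (\<sigma> (e v))" using e[of 0 i] i by (simp add: \<tau>_def)
    finally show ?thesis
      using \<rho>.inj eL[OF fm] \<sigma>(1)[OF eL[OF darts_from_at[OF v]]] by (auto dest: inj_onD)
  qed
  \<comment> \<open>A side between two tiles at the vertex x has x as an end, so v or
    \<open>flip v\<close> starts at x; the second case uses that \<sigma> is an involution.\<close>
  have "e (flip v) = \<sigma> (e v)" if v: "v \<in> darts_at x" and fv: "flip v \<in> darts_at x" for v
  proof -
    have vd: "v \<in> darts" using v by (simp add: darts_at_def)
    have xs: "x \<in> hyp_segment (v 0) (v 1)"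
      using flip_meet[OF vd] v fv by (auto simp: darts_at_def)
    obtain u where u: "u \<in> darts_from x" "polygon u = polygon v"
      using vertex_tile[OF c, of v] v by (auto simp: darts_at_def)
    have ud: "u \<in> darts" "u 0 = x" using u by (auto simp: darts_from_def)
    obtain m where "u = (shift ^^ m) v" using same_tile[OF vd ud(1)] u(2) by auto
    then have "x = v m" using ud(2) by (simp add: shift_funpow)
    then have "x = v 0 \<or> x = v 1" using vertex_on_side_dart[OF vd] xs by simp
    then show ?thesis
    proof
      assume "x = v 0"
      then show ?thesis using efl vd by (simp add: darts_from_def)
    next
      assume "x = v 1"
      then have "flip v \<in> darts_from x" using flip[OF vd] by (simp add: darts_from_def)
      then have "e v = \<sigma> (e (flip v))" using efl flip_flip[OF vd] by metis
      then show ?thesis using \<sigma>(2)[OF eL[OF fv]] by simp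
    qed
  qed
  then have "e \<in> germs L \<rho> \<sigma> x"
    using eL esh by (auto simp: germs_def e_def)
  moreover have "e c = l" using e[of 0 0] by simp
  ultimately show ?thesis by blast
qed

text \<open>If x lies in a single tile, any vertex of that tile works; if x lies inside a side, an
  end of this side belongs to every tile through x. Thus germs at vertices supply germs
  everywhere.\<close>

lemma darts_at_subset_vertex:
  shows "\<exists>c\<in>darts. darts_at x \<subseteq> darts_at (c 0)"
proof (cases "\<exists>c\<in>darts. c 0 = x")
  case True
  then show ?thesis by blast
next
  case False
  have nv: "((shift ^^ m) u) 0 \<noteq> x" if "u \<in> darts" for u m
    using shift_funpow_dart(1)[OF that] False by blast
  obtain v where v: "v \<in> darts" "x \<in> polygon v" using point_dart by blast
  show ?thesis
  proof (cases "\<forall>u\<in>darts_at x. polygon u = polygon v")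
    case True
    have "darts_at x \<subseteq> darts_at (v 0)"
    proof
      fix u assume u: "u \<in> darts_at x"
      then have "polygon u = polygon v" using True by blast
      then show "u \<in> darts_at (v 0)" using u polygon_vertex[of v 0] by (simp add: darts_at_def)
    qed
    then show ?thesis using v(1) by blast
  next
    case False
    then obtain w where w: "w \<in> darts" "x \<in> polygon w" "polygon v \<noteq> polygon w"
      by (auto simp: darts_at_def)
    show ?thesis
      using v(1) w(1,3) v(2) w(2)
    proof (cases rule: tiles_meet_cases)
      case (vertex m j)
      then show ?thesis using nv v(1) by blast
    next
      case (side m j)
      define v' where "v' = (shift ^^ m) v"
      have v': "v' \<in> darts" "polygon v' = polygon v"
        using shift_funpow_dart[OF v(1)] by (simp_all add: v'_def)
      have xs: "x \<in> hyp_segment (v' 0) (v' 1)" using side(2) v(2) w(2) by (auto simp: v'_def)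
      have x: "x \<noteq> v' 0" "x \<noteq> v' 1" using nv[OF v'(1), of 0] nv[OF v'(1), of 1] by auto
      have "v' 0 \<in> polygon u" if u: "u \<in> darts_at x" for u
      proof (cases "polygon v' = polygon u")
        case True
        then show ?thesis using polygon_vertex by metis
      next
        case False
        then have "polygon v' \<inter> polygon u = hyp_segment (v' 0) (v' 1)"
          using meet_in_side[OF v'(1) _ False _ xs x] u by (auto simp: darts_at_def)
        then show ?thesis by (metis IntD2 hyp_segment_endpoints(1))
      qed
      then have "darts_at x \<subseteq> darts_at (v' 0)" by (simp add: darts_at_def subset_iff)
      then show ?thesis using v'(1) by blast
    qed
  qed
qed

lemma germs_exist:
  assumes sp: "side_pairing q L \<rho> \<sigma>" "card L = p" and v: "v \<in> darts_at x" and l: "l \<in> L"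
  shows "\<exists>e\<in>germs L \<rho> \<sigma> x. e v = l"
proof -
  interpret \<rho>: cyclic_permutation L \<rho> using sp by (simp add: side_pairing_def)
  obtain c where c: "c \<in> darts" "darts_at x \<subseteq> darts_at (c 0)" using darts_at_subset_vertex by blast
  have cf: "c \<in> darts_from (c 0)" using c by (simp add: darts_from_def)
  have vy: "v \<in> darts_at (c 0)" using v c by blast
  then obtain u where u: "u \<in> darts_from (c 0)" "polygon u = polygon v"
    using vertex_tile[OF cf, of v] by (auto simp: darts_at_def)
  have d: "u \<in> darts" "v \<in> darts" using u v by (auto simp: darts_from_def darts_at_def)
  obtain j where j: "u = (shift ^^ j) v" using same_tile[OF d(2,1)] u(2) by auto
  \<comment> \<open>The value is prescribed at u, the dart of the same tile starting at the vertex,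
    as \<rho>^j l; injectivity of \<rho>^j brings it back to l at v.\<close>
  obtain e where e: "e \<in> germs L \<rho> \<sigma> (c 0)" "e u = (\<rho> ^^ j) l"
    using germs_at_vertex[OF sp u(1) \<rho>.funpow_mem[OF l]] by blast
  have "(shift ^^ i) v \<in> darts_at (c 0) \<and> e ((shift ^^ i) v) = (\<rho> ^^ i) (e v)" for i
    by (induction i) (use vy e(1) shift_darts_at in \<open>auto simp: germs_def\<close>)
  then have "(\<rho> ^^ j) (e v) = (\<rho> ^^ j) l" using e(2) j by simp
  moreover have "e v \<in> L" using e(1) vy by (auto simp: germs_def)
  ultimately have "e v = l" using \<rho>.funpow_inj l by blast
  then have "restrict e (darts_at x) v = l" using v by simp
  then show ?thesis using restrict_germs[OF c(2) e(1)] by blast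
qed

lemma germs_bij:
  assumes sp: "side_pairing q L \<rho> \<sigma>" "card L = p" and sub: "darts_at y \<subseteq> darts_at x"
  shows "bij_betw (\<lambda>e. restrict e (darts_at y)) (germs L \<rho> \<sigma> x) (germs L \<rho> \<sigma> y)"
  unfolding bij_betw_def
proof
  obtain v where v: "v \<in> darts_at y" "v \<in> darts_at x" using darts_at_nonempty sub by blast
  show "inj_on (\<lambda>e. restrict e (darts_at y)) (germs L \<rho> \<sigma> x)"
  proof (rule inj_onI)
    fix e e' assume e: "e \<in> germs L \<rho> \<sigma> x" "e' \<in> germs L \<rho> \<sigma> x"
      "restrict e (darts_at y) = restrict e' (darts_at y)"
    have "e v = e' v" using fun_cong[OF e(3), of v] v(1) by simp
    then show "e = e'" using germs_unique[OF e(1,2) v(2)] by blast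
  qed
  show "(\<lambda>e. restrict e (darts_at y)) ` germs L \<rho> \<sigma> x = germs L \<rho> \<sigma> y"
  proof
    show "(\<lambda>e. restrict e (darts_at y)) ` germs L \<rho> \<sigma> x \<subseteq> germs L \<rho> \<sigma> y"
      using restrict_germs[OF sub] by blast
    show "germs L \<rho> \<sigma> y \<subseteq> (\<lambda>e. restrict e (darts_at y)) ` germs L \<rho> \<sigma> x"
    proof
      fix e' assume e': "e' \<in> germs L \<rho> \<sigma> y"
      then have "e' v \<in> L" using v(1) by (auto simp: germs_def)
      then obtain e where e: "e \<in> germs L \<rho> \<sigma> x" "e v = e' v" using germs_exist[OF sp v(2)] by blast
      then have "restrict e (darts_at y) = e'"
        using germs_unique[OF restrict_germs[OF sub e(1)] e' v(1)] v(1) by simp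
      then show "e' \<in> (\<lambda>e. restrict e (darts_at y)) ` germs L \<rho> \<sigma> x" using e(1) by blast
    qed
  qed
qed

text \<open>The local system of germs has a global section because the plane is simply connected.\<close>

lemma labelling_exists:
  assumes sp: "side_pairing q L \<rho> \<sigma>" "card L = p"
  shows "\<exists>lam. \<forall>v\<in>darts. lam v \<in> L \<and> lam (shift v) = \<rho> (lam v) \<and> lam (flip v) = \<sigma> (lam v)"
proof -
  \<comment> \<open>The local system lives on the whole complex plane, so the Klein disc is first
    stretched to it.\<close>
  have "(UNIV :: complex set) homeomorphic (ball 0 1 :: complex set)"
    by (rule homeomorphic_sym[THEN iffD1, OF homeomorphic_ball_UNIV]) simp
  then obtain f g where fg: "homeomorphism (UNIV :: complex set) (ball 0 1 :: complex set) f g"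
    unfolding homeomorphic_def by blast
  define \<phi> where "\<phi> z = klein_inv (f z)" for z
  define \<psi> where "\<psi> x = g (klein x)" for x
  have f: "f z \<in> ball 0 1" for z using fg by (auto simp: homeomorphism_def)
  have \<phi>\<psi>: "\<phi> (\<psi> x) = x" for x
    using homeomorphism_apply2[OF fg klein_in_ball] by (simp add: \<phi>_def \<psi>_def)
  have c\<phi>: "continuous_on UNIV \<phi>"
    unfolding \<phi>_def using homeomorphism_cont1[OF fg] continuous_klein_inv f
    by (intro continuous_on_compose2[of "ball 0 1" klein_inv UNIV f]) auto
  have c\<psi>: "continuous_on UNIV \<psi>"
    unfolding \<psi>_def using homeomorphism_cont2[OF fg] continuous_klein klein_in_ball
    by (intro continuous_on_compose2[of "ball 0 1" g UNIV klein]) auto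
  interpret local_system "\<lambda>z. darts_at (\<phi> z)" "\<lambda>z. germs L \<rho> \<sigma> (\<phi> z)"
  proof
    fix z
    obtain W where W: "open W" "\<phi> z \<in> W" "\<And>y F. y \<in> W \<Longrightarrow> F \<in> T \<Longrightarrow> y \<in> F \<Longrightarrow> \<phi> z \<in> F"
      using star_nbhd[of "\<phi> z"] by blast
    have "darts_at (\<phi> y) \<subseteq> darts_at (\<phi> z)" if "\<phi> y \<in> W" for y
      using W(3)[OF that] dartD(2) by (auto simp: darts_at_def)
    then show "\<exists>U. open U \<and> z \<in> U \<and> (\<forall>y\<in>U. darts_at (\<phi> y) \<subseteq> darts_at (\<phi> z) \<and>
        bij_betw (\<lambda>e. restrict e (darts_at (\<phi> y))) (germs L \<rho> \<sigma> (\<phi> z)) (germs L \<rho> \<sigma> (\<phi> y)))"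
      using W(1,2) c\<phi> germs_bij[OF sp]
      by (intro exI[of _ "\<phi> -` W"]) (simp add: open_vimage)
  qed
  obtain l where "l \<in> L" using sp(2) p_pos by fastforce
  then obtain e where "e \<in> germs L \<rho> \<sigma> (\<phi> 0)" using germs_exist[OF sp] darts_at_nonempty by blast
  then obtain s where s: "flat_section UNIV s" using global_flat_section by blast
  define t where "t x = s (\<psi> x)" for x
  have tg: "t x \<in> germs L \<rho> \<sigma> x" for x
    using flat_sectionD(1)[OF s, of "\<psi> x"] by (simp add: t_def \<phi>\<psi>)
  \<comment> \<open>The label of a fixed dart is locally constant along its tile, which is
    connected, so it does not depend on the point whose germ is used.\<close>
  have const: "t x v = t y v" if v: "v \<in> darts" and x: "x \<in> polygon v" and y: "y \<in> polygon v" for v x y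
  proof -
    have "(\<lambda>x. t x v) constant_on polygon v"
    proof (rule locally_constant_imp_constant[OF polygon_connected])
      fix a assume a: "a \<in> polygon v"
      obtain U where U: "open U" "\<psi> a \<in> U" "\<And>z. z \<in> U \<Longrightarrow> s z = restrict (s (\<psi> a)) (darts_at (\<phi> z))"
        using flat_sectionD(2)[OF s, of "\<psi> a"] by blast
      have tc: "t y v = t a v" if y: "y \<in> \<psi> -` U" "y \<in> polygon v" for y
      proof -
        have "v \<in> darts_at (\<phi> (\<psi> y))" using y v by (simp add: darts_at_def \<phi>\<psi>)
        then show ?thesis using U(3)[of "\<psi> y"] y(1) by (simp add: t_def)
      qed
      show "\<exists>N. openin (top_of_set (polygon v)) N \<and> a \<in> N \<and> (\<forall>y\<in>N. t y v = t a v)"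
      proof (intro exI conjI)
        show "openin (top_of_set (polygon v)) (polygon v \<inter> \<psi> -` U)"
          using open_vimage[OF U(1) c\<psi>] by (rule openin_open_Int)
        show "a \<in> polygon v \<inter> \<psi> -` U" using U(2) a by blast
        show "\<forall>y\<in>polygon v \<inter> \<psi> -` U. t y v = t a v" using tc by blast
      qed
    qed
    then show ?thesis using x y unfolding constant_on_def by metis
  qed
  define lam where "lam v = t (v 0) v" for v
  have "lam v \<in> L \<and> lam (shift v) = \<rho> (lam v) \<and> lam (flip v) = \<sigma> (lam v)" if v: "v \<in> darts" for v
  proof -
    have v0: "v 0 \<in> polygon v" "v 1 \<in> polygon v" using polygon_vertex by auto
    have va: "v \<in> darts_at (v 0)" using v v0 by (simp add: darts_at_def)
    have "lam (shift v) = t (v 0) (shift v)"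
      unfolding lam_def using shift_dart[OF v] v0 by (intro const) auto
    moreover have f0: "v 0 \<in> polygon (flip v)" "v 1 \<in> polygon (flip v)"
      using polygon_vertex[of "flip v"] flip[OF v] by metis+
    then have "lam (flip v) = t (v 0) (flip v)"
      unfolding lam_def using flip[OF v] by (intro const) auto
    moreover have "flip v \<in> darts_at (v 0)" using f0 flip[OF v] by (simp add: darts_at_def)
    ultimately show ?thesis
      using tg[of "v 0"] va unfolding germs_def lam_def by auto
  qed
  then show ?thesis by blast
qed

lemma direct_eqI:
  assumes "direct f" "direct g" "v \<in> darts" "f \<circ> v = g \<circ> v"
  shows "f = g"
proof -
  obtain h where h: "direct h" "h \<circ> g = id" "g \<circ> h = id" using direct_inverse_ex[OF assms(2)] by blast
  have "h (f (v i)) = v i" for i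
    using fun_cong[OF assms(4), of i] h(2) by (simp add: pointfree_idE)
  then have "h \<circ> f = id"
    using direct_two_fixed_points[OF direct_comp[OF h(1) assms(1)], of "v 0" "v 1"] dart_neq[OF assms(3)] by simp
  then have "g \<circ> (h \<circ> f) = g" by simp
  then show ?thesis using h(3) by (simp add: comp_assoc[symmetric])
qed

section \<open>The group of a labelling\<close>

lemma fuchsian_group_if_side_pairing:
  assumes sp: "side_pairing q L \<rho> \<sigma>" "card L = p"
  shows "\<exists>\<Gamma>. fuchsian_group \<Gamma> \<and> tessellation_by_fundamental_domains \<Gamma> T"
proof -
  interpret \<rho>: cyclic_permutation L \<rho> using sp by (simp add: side_pairing_def)
  obtain lam where lam: "\<And>v. v \<in> darts \<Longrightarrow> lam v \<in> L" "\<And>v. v \<in> darts \<Longrightarrow> lam (shift v) = \<rho> (lam v)"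
    "\<And>v. v \<in> darts \<Longrightarrow> lam (flip v) = \<sigma> (lam v)"
    using labelling_exists[OF sp] by blast
  have lamn: "lam ((shift ^^ m) v) = (\<rho> ^^ m) (lam v)" if "v \<in> darts" for v m
    by (induction m) (use that lam(2) shift_funpow_dart(1) in auto)
  define \<Gamma> where "\<Gamma> = {h. direct h \<and> (\<forall>v\<in>darts. h \<circ> v \<in> darts \<and> lam (h \<circ> v) = lam v)}"
  \<comment> \<open>Preserving the label of one dart is enough, since labels propagate along
    \<open>shift\<close> and \<open>flip\<close>.\<close>
  have \<Gamma>I: "h \<in> \<Gamma>" if h: "direct h" and v: "v \<in> darts" "h \<circ> v \<in> darts" "lam (h \<circ> v) = lam v" for h v
  proof -
    have hd: "h \<circ> w \<in> darts" if "w \<in> darts" for w using direct_symmetry[OF h v(1,2) that] .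
    have "{w \<in> darts. lam (h \<circ> w) = lam w} = darts"
    proof (rule darts_connected)
      show "{w \<in> darts. lam (h \<circ> w) = lam w} \<noteq> {}" using v by blast
      fix w assume w: "w \<in> {w \<in> darts. lam (h \<circ> w) = lam w}"
      then have wd: "w \<in> darts" "lam (h \<circ> w) = lam w" by auto
      show "shift w \<in> {w \<in> darts. lam (h \<circ> w) = lam w}"
        using lam(2)[OF hd[OF wd(1)]] lam(2)[OF wd(1)] wd shift_dart(1) by (simp add: shift_comp)
      show "flip w \<in> {w \<in> darts. lam (h \<circ> w) = lam w}"
        using lam(3)[OF hd[OF wd(1)]] lam(3)[OF wd(1)] wd flip(1) flip_comp[OF h wd(1) hd[OF wd(1)]] by simp
    qed blast
    then show ?thesis using h hd by (auto simp: \<Gamma>_def)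
  qed
  obtain v0 where v0: "v0 \<in> darts" using point_dart by blast
  have sub: "subgroup \<Gamma> (BijGroup UNIV)"
  proof (rule subgroup_BijGroupI)
    show "bij f" if "f \<in> \<Gamma>" for f using that direct_bij by (auto simp: \<Gamma>_def)
    show "id \<in> \<Gamma>" by (simp add: \<Gamma>_def direct_id)
    show "f \<circ> g \<in> \<Gamma>" if "f \<in> \<Gamma>" "g \<in> \<Gamma>" for f g
      using that by (simp add: \<Gamma>_def direct_comp comp_assoc)
    show "inv_into UNIV f \<in> \<Gamma>" if f: "f \<in> \<Gamma>" for f
    proof -
      have d: "direct f" "f \<circ> v0 \<in> darts" "lam (f \<circ> v0) = lam v0" using f v0 by (auto simp: \<Gamma>_def)
      have "inv_into UNIV f \<circ> (f \<circ> v0) = v0"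
        using direct_bij[OF d(1)] by (simp add: comp_assoc[symmetric] bij_is_inj inv_o_cancel)
      then show ?thesis using \<Gamma>I[OF direct_inv[OF d(1)] d(2)] v0 d(3) by simp
    qed
  qed
  \<comment> \<open>Being near h at two points is open in the pointwise topology. Vertices are
    isolated, so such a group element agrees with h at \<open>v0 0\<close> and \<open>v0 1\<close>,
    and two points determine it.\<close>
  have disc: "discrete \<Gamma>"
  proof (rule discreteI)
    fix h assume h: "h \<in> \<Gamma>"
    have hv: "h \<circ> v0 \<in> darts" "shift (h \<circ> v0) \<in> darts" using h v0 shift_dart(1) by (auto simp: \<Gamma>_def)
    obtain U where U: "open U" "h (v0 0) \<in> U"
      "\<And>y u. y \<in> U \<Longrightarrow> u \<in> darts \<Longrightarrow> y \<in> polygon u \<Longrightarrow> y \<in> range u \<Longrightarrow> y = h (v0 0)"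
      using vertex_nbhd[OF hv(1) refl] by auto
    obtain V where V: "open V" "h (v0 1) \<in> V"
      "\<And>y u. y \<in> V \<Longrightarrow> u \<in> darts \<Longrightarrow> y \<in> polygon u \<Longrightarrow> y \<in> range u \<Longrightarrow> y = h (v0 1)"
      using vertex_nbhd[OF hv(2) refl] by (auto simp: shift_comp)
    let ?O = "(\<lambda>f. f (v0 0)) -` U \<inter> (\<lambda>f. f (v0 1)) -` V"
    have op: "open ?O"
      using U(1) V(1) by (intro open_Int open_vimage continuous_on_product_coordinates)
    have fh: "f = h" if f: "f \<in> ?O" "f \<in> \<Gamma>" for f
    proof -
      have fv: "f \<circ> v0 \<in> darts" "direct f" "direct h" using f h v0 by (auto simp: \<Gamma>_def)
      have "f (v0 0) = h (v0 0)" using U(3)[OF _ fv(1), of "f (v0 0)"] f(1) polygon_vertex[of "f \<circ> v0" 0] by auto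
      moreover have "f (v0 1) = h (v0 1)" using V(3)[OF _ fv(1), of "f (v0 1)"] f(1) polygon_vertex[of "f \<circ> v0" 1] by auto
      ultimately have "f \<circ> v0 = h \<circ> v0" using dart_unique[OF fv(1) hv(1)] by simp
      then show ?thesis using direct_eqI fv v0 by blast
    qed
    show "h isolated_in \<Gamma>"
      unfolding isolated_in_def
    proof (intro conjI)
      have "?O \<inter> \<Gamma> = {h}" 
      proof
        show "?O \<inter> \<Gamma> \<subseteq> {h}" using fh by blast
        show "{h} \<subseteq> ?O \<inter> \<Gamma>" using h U(2) V(2) by simp
      qed
      then show "\<exists>N. open N \<and> N \<inter> \<Gamma> = {h}" using op by blast
    qed (rule h)
  qed
  have fuchs: "fuchsian_group \<Gamma>"
    unfolding fuchsian_group_def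
    using sub disc direct_hyp_isometry direct_orientation_preserving by (auto simp: \<Gamma>_def)
  have "tessellation_by_fundamental_domains \<Gamma> T"
    unfolding tessellation_by_fundamental_domains_def
  proof (intro conjI ballI)
    fix h F assume h: "h \<in> \<Gamma>" and F: "F \<in> T"
    obtain v where v: "v \<in> darts" "polygon v = F" using tile_dart[OF F] by blast
    have "direct h" "h \<circ> v \<in> darts" using h v by (auto simp: \<Gamma>_def)
    then show "h ` F \<in> T" using polygon_direct v(2) dartD(2) by metis
  next
    fix F F' assume F: "F \<in> T" and F': "F' \<in> T"
    obtain v where v: "v \<in> darts" "polygon v = F" using tile_dart[OF F] by blast
    obtain w1 where w1: "w1 \<in> darts" "polygon w1 = F'" using tile_dart[OF F'] by blast
    \<comment> \<open>Transitivity: \<rho> is a single cycle, so some dart of F' carries the label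
      of v, and the symmetry taking v there respects labels.\<close>
    obtain j where "lam v = (\<rho> ^^ j) (lam w1)" using \<rho>.transitive lam(1) v w1 by blast
    then obtain w where w: "w \<in> darts" "polygon w = F'" "lam w = lam v"
      using lamn[OF w1(1)] shift_funpow_dart[OF w1(1)] w1(2) by metis
    obtain h where h: "direct h" "w = h \<circ> v" using darts_transitive[OF v(1) w(1)] by blast
    have h\<Gamma>: "h \<in> \<Gamma>" using \<Gamma>I[OF h(1) v(1)] w h(2) by simp
    show "\<exists>!\<gamma>. \<gamma> \<in> \<Gamma> \<and> \<gamma> ` F = F'"
    proof (rule ex1I)
      show "h \<in> \<Gamma> \<and> h ` F = F'" using h\<Gamma> polygon_direct[OF h(1)] v w h(2) by metis
      fix g assume g: "g \<in> \<Gamma> \<and> g ` F = F'"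
      then have gd: "direct g" "g \<circ> v \<in> darts" "lam (g \<circ> v) = lam v" using v by (auto simp: \<Gamma>_def)
      have "polygon w = polygon (g \<circ> v)" using g polygon_direct[OF gd(1)] v(2) w(2) by metis
      then obtain m where m: "m < p" "g \<circ> v = (shift ^^ m) w" using same_tile[OF w(1) gd(2)] by blast
      \<comment> \<open>Freeness: the p darts of a tile have distinct labels because \<rho> has
        exact period p.\<close>
      have "(\<rho> ^^ m) (lam w) = (\<rho> ^^ 0) (lam w)" using lamn[OF w(1)] m(2) gd(3) w(3) by simp
      then have "m mod p = 0 mod p" using \<rho>.funpow_eq_iff_mod[OF lam(1)[OF w(1)]] sp(2) by metis
      then have "g \<circ> v = h \<circ> v" using m h(2) by simp
      then show "g = h" using direct_eqI gd(1) h(1) v(1) by blast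
    qed
  qed
  then show ?thesis using fuchs by blast
qed

section \<open>From the group to a small prime divisor\<close>

lemma small_prime_if_fuchsian_group:
  assumes \<Gamma>: "fuchsian_group \<Gamma>" "tessellation_by_fundamental_domains \<Gamma> T"
  shows "\<exists>r. prime r \<and> r dvd q \<and> r \<le> p"
proof (rule ccontr)
  assume neg: "\<nexists>r. prime r \<and> r dvd q \<and> r \<le> p"
  have dir: "direct \<gamma>" if "\<gamma> \<in> \<Gamma>" for \<gamma>
    using \<Gamma>(1) that orientation_preserving_isometry_direct unfolding fuchsian_group_def by blast
  note \<Gamma>_conjuncts = \<Gamma>(2)[unfolded tessellation_by_fundamental_domains_def]
  have perm: "\<gamma> ` F \<in> T" if "\<gamma> \<in> \<Gamma>" "F \<in> T" for \<gamma> F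
    by (rule \<Gamma>_conjuncts[THEN conjunct1, rule_format, OF that])
  have ex1: "\<exists>!\<gamma>. \<gamma> \<in> \<Gamma> \<and> \<gamma> ` F = F'" if "F \<in> T" "F' \<in> T" for F F'
    by (rule \<Gamma>_conjuncts[THEN conjunct2, rule_format, OF that])
  have act: "\<gamma> \<circ> v \<in> darts" if g: "\<gamma> \<in> \<Gamma>" and v: "v \<in> darts" for \<gamma> v
    using ccw_direct[OF dartD(1)[OF v] dir[OF g]] polygon_direct[OF dir[OF g], of v]
      perm[OF g dartD(2)[OF v]] unfolding darts_def by (simp del: comp_apply)
  obtain v0 where v0: "v0 \<in> darts" using point_dart by blast
  have ex: "\<exists>k<p. \<exists>\<gamma>\<in>\<Gamma>. v = \<gamma> \<circ> (shift ^^ k) v0" if v: "v \<in> darts" for v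
  proof -
    obtain \<gamma> where g: "\<gamma> \<in> \<Gamma>" "\<gamma> ` polygon v0 = polygon v" 
      using ex1[OF dartD(2)[OF v0] dartD(2)[OF v]] by blast
    have "polygon (\<gamma> \<circ> v0) = polygon v" using polygon_direct[OF dir[OF g(1)]] g(2) by simp
    then obtain k where "k < p" "v = (shift ^^ k) (\<gamma> \<circ> v0)" using same_tile[OF act[OF g(1) v0] v] by blast
    then show ?thesis using g(1) by (auto simp: shift_funpow comp_def)
  qed
  \<comment> \<open>Freeness of the action: the image of the base tile determines the group element,
    and then k is determined modulo p.\<close>
  have unique: "k mod p = k' mod p"
    if g: "\<gamma> \<in> \<Gamma>" "\<gamma>' \<in> \<Gamma>" and eq: "\<gamma> \<circ> (shift ^^ k) v0 = \<gamma>' \<circ> (shift ^^ k') v0" for \<gamma> \<gamma>' k k'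
  proof -
    have "\<gamma> ` polygon v0 = \<gamma>' ` polygon v0"
      using arg_cong[OF eq, of polygon] polygon_direct dir[OF g(1)] dir[OF g(2)] shift_funpow_dart(2)[OF v0] by simp
    then have "\<gamma> = \<gamma>'" using ex1[OF dartD(2)[OF v0] perm[OF g(1) dartD(2)[OF v0]]] g by metis
    then have "\<gamma> (v0 k) = \<gamma> (v0 k')" using fun_cong[OF eq, of 0] by (simp add: shift_funpow)
    then have "v0 k = v0 k'" using direct_bij[OF dir[OF g(1)]] by (auto simp: bij_def dest: injD)
    then show ?thesis using dart_eq_iff[OF v0] by simp
  qed
  define lam where "lam v = (THE k. k < p \<and> (\<exists>\<gamma>\<in>\<Gamma>. v = \<gamma> \<circ> (shift ^^ k) v0))" for v
  have lam_eq: "lam (\<gamma> \<circ> (shift ^^ k) v0) = k mod p" if g: "\<gamma> \<in> \<Gamma>" for \<gamma> k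
    unfolding lam_def
  proof (rule the_equality)
    show "k mod p < p \<and> (\<exists>\<gamma>'\<in>\<Gamma>. \<gamma> \<circ> (shift ^^ k) v0 = \<gamma>' \<circ> (shift ^^ (k mod p)) v0)"
      using g shift_period[OF v0, of k] p_pos by auto
    fix j assume "j < p \<and> (\<exists>\<gamma>'\<in>\<Gamma>. \<gamma> \<circ> (shift ^^ k) v0 = \<gamma>' \<circ> (shift ^^ j) v0)"
    then show "j = k mod p" using unique[OF g] by (metis mod_less)
  qed
  have lam_lt: "lam v < p" if "v \<in> darts" for v
    using ex[OF that] lam_eq p_pos by (metis mod_less_divisor)
  have lam_sh: "lam (shift v) = Suc (lam v) mod p" if v: "v \<in> darts" for v
  proof -
    obtain k \<gamma> where k: "k < p" "\<gamma> \<in> \<Gamma>" "v = \<gamma> \<circ> (shift ^^ k) v0" using ex[OF v] by blast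
    have "shift v = \<gamma> \<circ> (shift ^^ Suc k) v0" using k(3) by (simp add: shift_comp)
    moreover have "lam v = k" using lam_eq[OF k(2), of k] k by simp
    ultimately show ?thesis using lam_eq[OF k(2), of "Suc k"] by (simp only:)
  qed
  \<comment> \<open>Defined on the base tile only; the group commutes with \<open>flip\<close>, so
    it describes the label across a side of every tile.\<close>
  define \<sigma> where "\<sigma> k = lam (flip ((shift ^^ k) v0))" for k
  have lam_fl: "lam (flip v) = \<sigma> (lam v)" if v: "v \<in> darts" for v
  proof -
    obtain k \<gamma> where k: "k < p" "\<gamma> \<in> \<Gamma>" "v = \<gamma> \<circ> (shift ^^ k) v0" using ex[OF v] by blast
    define u where "u = flip ((shift ^^ k) v0)"
    have ud: "(shift ^^ k) v0 \<in> darts" "u \<in> darts" using shift_funpow_dart(1)[OF v0] flip(1) by (auto simp: u_def)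
    have fv: "flip v = \<gamma> \<circ> u"
      using flip_comp[OF dir[OF k(2)] ud(1)] v k(3) by (simp add: u_def)
    obtain j \<delta> where j: "j < p" "\<delta> \<in> \<Gamma>" "u = \<delta> \<circ> (shift ^^ j) v0" using ex[OF ud(2)] by blast
    have gd: "\<gamma> \<circ> \<delta> \<in> \<Gamma>"
    proof -
      have "subgroup \<Gamma> (BijGroup UNIV)" using \<Gamma>(1) by (simp add: fuchsian_group_def)
      then have "\<gamma> \<otimes>\<^bsub>BijGroup UNIV\<^esub> \<delta> \<in> \<Gamma>" using k(2) j(2) by (rule subgroup.m_closed)
      moreover have "\<gamma> \<in> Bij UNIV" "\<delta> \<in> Bij UNIV"
        using direct_bij dir k(2) j(2) by (auto simp: Bij_def)
      ultimately show ?thesis by (simp add: BijGroup_def compose_def comp_def restrict_def)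
    qed
    have "flip v = (\<gamma> \<circ> \<delta>) \<circ> (shift ^^ j) v0" using fv j(3) by (simp add: comp_assoc)
    then have "lam (flip v) = j mod p" using lam_eq[OF gd] by simp
    moreover have "lam u = j mod p" using lam_eq[OF j(2)] j(3) by simp
    moreover have "lam v = k" using lam_eq[OF k(2), of k] k by simp
    ultimately show ?thesis by (simp add: \<sigma>_def u_def)
  qed
  define \<tau> where "\<tau> k = Suc (\<sigma> k) mod p" for k
  have lam_turn: "lam (turn v) = \<tau> (lam v)" if "v \<in> darts" for v
    using lam_sh[OF flip(1)[OF that]] lam_fl[OF that] by (simp add: turn_def \<tau>_def)
  have turnd: "(turn ^^ i) v \<in> darts" if "v \<in> darts" for i v
    by (induction i) (use that flip(1) shift_dart(1) in \<open>auto simp: turn_def\<close>)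
  have lam_turnn: "lam ((turn ^^ i) v) = (\<tau> ^^ i) (lam v)" if "v \<in> darts" for i v
    by (induction i) (use that lam_turn turnd in auto)
  have fixed: "lam (turn v) = lam v" if v: "v \<in> darts" for v
  proof -
    have "\<tau> (lam v) = lam v"
    proof (rule funpow_fixed_if_small_prime_free)
      show "finite {..<p}" by simp
      show "\<tau> k \<in> {..<p}" for k using p_pos by (simp add: \<tau>_def)
      show "lam v \<in> {..<p}" using lam_lt[OF v] by simp
      show "(\<tau> ^^ q) (lam v) = lam v" using lam_turnn[OF v, of q] turn_funpow_q[OF v] by simp
      show "card {..<p} < r" if "prime r" "r dvd q" for r using neg that by (auto simp: not_le)
    qed (use q3 in simp)
    then show ?thesis using lam_turn[OF v] by simp
  qed
  \<comment> \<open>With trivial \<tau>, \<open>flip\<close> lowers every label by one modulo p; as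
    \<open>flip\<close> is an involution, p would divide 2.\<close>
  have "Suc (lam (flip v0)) mod p = lam v0"
    using lam_sh[OF flip(1)[OF v0]] fixed[OF v0] by (simp add: turn_def)
  moreover have "Suc (lam v0) mod p = lam (flip v0)"
    using lam_sh[OF flip(1)[OF flip(1)[OF v0]]] fixed[OF flip(1)[OF v0]] flip_flip[OF v0] by (simp add: turn_def)
  ultimately show False
    using p3 lam_lt[OF v0] lam_lt[OF flip(1)[OF v0]] by (auto simp: mod_Suc split: if_splits)
qed

end

theorem theorem0p1:
  fixes p q :: nat and T :: "hyperbolic_plane set set"
  assumes "0 < p" and "0 < q"
    and "1 / real p + 1 / real q < 1 / 2"
    and "tessellation_of_type p q T"
  shows "(\<exists>\<Gamma>. fuchsian_group \<Gamma> \<and> tessellation_by_fundamental_domains \<Gamma> T)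
    \<longleftrightarrow> (\<exists>r. prime r \<and> r dvd q \<and> r \<le> p)"
proof -
  \<comment> \<open>Each summand is positive, so each alone is below 1/2, which gives p, q \<ge>
    3.\<close>
  have pos: "0 < 1 / real p" "0 < 1 / real q" using assms by simp_all
  have "1 / real p < 1 / 2" "1 / real q < 1 / 2" using pos assms(3) by linarith+
  then have "3 \<le> p" "3 \<le> q" using assms(1,2) by (simp_all add: field_simps)
  then interpret tessellation p q T using assms(4) by unfold_locales
  show ?thesis
  proof
    assume "\<exists>\<Gamma>. fuchsian_group \<Gamma> \<and> tessellation_by_fundamental_domains \<Gamma> T"
    then show "\<exists>r. prime r \<and> r dvd q \<and> r \<le> p" using small_prime_if_fuchsian_group by blast
  next
    assume "\<exists>r. prime r \<and> r dvd q \<and> r \<le> p"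
    then obtain r where r: "prime r" "r dvd q" "r \<le> p" by blast
    obtain \<rho> \<sigma> where "side_pairing q {..<p} \<rho> \<sigma>"
      using side_pairing_exists[OF prime_ge_2_nat[OF r(1)] r(3,2) assms(2)] by blast
    then show "\<exists>\<Gamma>. fuchsian_group \<Gamma> \<and> tessellation_by_fundamental_domains \<Gamma> T"
      by (rule fuchsian_group_if_side_pairing) simp
  qed
qed

end
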